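(* Let $\mathcal{T}$ be a triangulated category. For a map of triangles $(f,g,h)$ in $\mathcal{T}$ with at most two non-zero components (i.e. at least one of $f,g,h$ is zero), the following are equivalent. (1) The map is nullhomotopic. (2) The map is good. If the map has the form $(0,g,h)$ or $(f,0,h)$, then those conditions are further equivalent to: (3) The map is Verdier good.
   Context: $\mathcal{T}$ is a triangulated category with self-equivalence $\Sigma$. "Exact triangle" or "triangle" means distinguished triangle. A map of triangles $(f,g,h)$ from $X\xrightarrow{u}Y\xrightarrow{v}Z\xrightarrow{w}\Sigma X$ to $X'\xrightarrow{u'}Y'\xrightarrow{v'}Z'\xrightarrow{w'}\Sigma X'$ consists of $f\colon X\to X'$, $g\colon Y\to Y'$, $h\colon Z\to Z'$ with $gu=u'f$, $hv=v'g$, $(\Sigma f)w=w'h$. It is nullhomotopic if there are maps $F\colon Y\to X'$, $G\colon Z\to Y'$, $H\colon\Sigma X\to Z'$ with $f=Fu+\Sigma^{-1}(w'H)$, $g=Gv+u'F$, $h=Hw+v'G$. The mapping cone of $(f,g,h)$ is the sequence $X'\oplus Y\to Y'\oplus Z\to Z'\oplus\Sigma X\to\Sigma X'\oplus\Sigma Y$ with successive maps $\begin{bmatrix}u'&g\\0&-v\end{bmatrix},\begin{bmatrix}v'&h\\0&-w\end{bmatrix},\begin{bmatrix}w'&\Sigma f\\0&-\Sigma u\end{bmatrix}$ (acting on column vectors). $(f,g,h)$ is good if its mapping cone is an exact triangle. Octahedra: given composable maps $P\xrightarrow{a}Q\xrightarrow{b}R$ and exact triangles $P\xrightarrow{a}Q\xrightarrow{a'}C_a\xrightarrow{a''}\Sigma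 P$, $Q\xrightarrow{b}R\xrightarrow{b'}C_b\xrightarrow{b''}\Sigma Q$, $P\xrightarrow{ba}R\xrightarrow{c'}C\xrightarrow{c''}\Sigma P$, an octahedron for the composite $ba$ consists of maps $\alpha\colon C_a\to C$, $\beta\colon C\to C_b$, $\gamma\colon C_b\to\Sigma C_a$ such that $C_a\xrightarrow{\alpha}C\xrightarrow{\beta}C_b\xrightarrow{\gamma}\Sigma C_a$ is exact and $\alpha a'=c'b$, $c''\alpha=a''$, $\beta c'=b'$, $\gamma=(\Sigma a')b''$, $b''\beta=(\Sigma a)c''$. Verdier good: choose exact triangles $X\xrightarrow{f}X'\xrightarrow{f'}X''\xrightarrow{f''}\Sigma X$, $Y\xrightarrow{g}Y'\xrightarrow{g'}Y''\xrightarrow{g''}\Sigma Y$ and $X\xrightarrow{gu=u'f}Y'\xrightarrow{\tilde v}A\xrightarrow{\tilde w}\Sigma X$. The map $(f,g,h)$ is Verdier good if there exist an octahedron $(\alpha_1\colon Z\to A,\ \beta_1\colon A\to Y'',\ \gamma_1)$ for the composite $X\xrightarrow{u}Y\xrightarrow{g}Y'$ and an octahedron $(\alpha_2\colon X''\to A,\ \beta_2\colon A\to Z',\ \gamma_2)$ for the composite $X\xrightarrow{f}X'\xrightarrow{u'}Y'$ (both using the given and chosen triangles, in particular the same triangle on $gu=u'f$) such that $h=\beta_2\alpha_1$. This does not depend on the chosen triangles. *)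

theory Defs
  imports "HOL-Algebra.Group"
begin

section \<open>Additive categories\<close>

text \<open>Composition and addition of morphisms are not indexed by objects. Hom-sets may, but need not,
  be disjoint; nothing is required of \<open>Hom X Y\<close> unless \<open>X\<close> and \<open>Y\<close> are objects.\<close>

record ('o, 'm) category =
  Obj :: "'o set"
  Hom :: "'o \<Rightarrow> 'o \<Rightarrow> 'm set"
  Ident :: "'o \<Rightarrow> 'm"
  cmp :: "'m \<Rightarrow> 'm \<Rightarrow> 'm"  (infixl \<open>\<cdot>\<index>\<close> 70)

locale category =
  fixes C (structure)
  assumes Ident_in: "X \<in> Obj C \<Longrightarrow> Ident C X \<in> Hom C X X"
    and cmp_in: "\<lbrakk>X \<in> Obj C; Y \<in> Obj C; Z \<in> Obj C; f \<in> Hom C X Y; g \<in> Hom C Y Z\<rbrakk>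
      \<Longrightarrow> g \<cdot> f \<in> Hom C X Z"
    and cmp_Ident: "\<lbrakk>X \<in> Obj C; Y \<in> Obj C; f \<in> Hom C X Y\<rbrakk> \<Longrightarrow> f \<cdot> Ident C X = f"
    and Ident_cmp: "\<lbrakk>X \<in> Obj C; Y \<in> Obj C; f \<in> Hom C X Y\<rbrakk> \<Longrightarrow> Ident C Y \<cdot> f = f"
    and cmp_assoc: "\<lbrakk>W \<in> Obj C; X \<in> Obj C; Y \<in> Obj C; Z \<in> Obj C;
        f \<in> Hom C W X; g \<in> Hom C X Y; h \<in> Hom C Y Z\<rbrakk> \<Longrightarrow> h \<cdot> g \<cdot> f = h \<cdot> (g \<cdot> f)"

definition isomorphism :: "('o, 'm, 'e) category_scheme \<Rightarrow> 'o \<Rightarrow> 'o \<Rightarrow> 'm \<Rightarrow> bool" where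
  "isomorphism C X Y f \<longleftrightarrow> f \<in> Hom C X Y \<and>
    (\<exists>g\<in>Hom C Y X. g \<cdot>\<^bsub>C\<^esub> f = Ident C X \<and> f \<cdot>\<^bsub>C\<^esub> g = Ident C Y)"

definition zero_object :: "('o, 'm, 'e) category_scheme \<Rightarrow> 'o \<Rightarrow> bool" where
  "zero_object C N \<longleftrightarrow> N \<in> Obj C \<and>
    (\<forall>X\<in>Obj C. (\<exists>!f. f \<in> Hom C X N) \<and> (\<exists>!f. f \<in> Hom C N X))"

definition endofunctor ::
  "('o, 'm, 'e) category_scheme \<Rightarrow> ('o \<Rightarrow> 'o) \<Rightarrow> ('m \<Rightarrow> 'm) \<Rightarrow> bool" where
  "endofunctor C F\<^sub>o F\<^sub>m \<longleftrightarrow>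
    (\<forall>X\<in>Obj C. F\<^sub>o X \<in> Obj C \<and> F\<^sub>m (Ident C X) = Ident C (F\<^sub>o X)) \<and>
    (\<forall>X\<in>Obj C. \<forall>Y\<in>Obj C. \<forall>f\<in>Hom C X Y. F\<^sub>m f \<in> Hom C (F\<^sub>o X) (F\<^sub>o Y)) \<and>
    (\<forall>X\<in>Obj C. \<forall>Y\<in>Obj C. \<forall>Z\<in>Obj C. \<forall>f\<in>Hom C X Y. \<forall>g\<in>Hom C Y Z.
      F\<^sub>m (g \<cdot>\<^bsub>C\<^esub> f) = F\<^sub>m g \<cdot>\<^bsub>C\<^esub> F\<^sub>m f)"

definition natural_isomorphism ::
  "('o, 'm, 'e) category_scheme \<Rightarrow> ('o \<Rightarrow> 'o) \<Rightarrow> ('m \<Rightarrow> 'm) \<Rightarrow> ('o \<Rightarrow> 'o) \<Rightarrow> ('m \<Rightarrow> 'm)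
    \<Rightarrow> ('o \<Rightarrow> 'm) \<Rightarrow> bool" where
  "natural_isomorphism C F\<^sub>o F\<^sub>m G\<^sub>o G\<^sub>m \<eta> \<longleftrightarrow>
    (\<forall>X\<in>Obj C. isomorphism C (F\<^sub>o X) (G\<^sub>o X) (\<eta> X)) \<and>
    (\<forall>X\<in>Obj C. \<forall>Y\<in>Obj C. \<forall>f\<in>Hom C X Y. \<eta> Y \<cdot>\<^bsub>C\<^esub> F\<^sub>m f = G\<^sub>m f \<cdot>\<^bsub>C\<^esub> \<eta> X)"

definition self_equivalence ::
  "('o, 'm, 'e) category_scheme \<Rightarrow> ('o \<Rightarrow> 'o) \<Rightarrow> ('m \<Rightarrow> 'm) \<Rightarrow> bool" where
  "self_equivalence C F\<^sub>o F\<^sub>m \<longleftrightarrow> endofunctor C F\<^sub>o F\<^sub>m \<and>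
    (\<exists>G\<^sub>o G\<^sub>m. endofunctor C G\<^sub>o G\<^sub>m \<and>
      (\<exists>\<eta>. natural_isomorphism C (\<lambda>X. X) (\<lambda>f. f) (G\<^sub>o \<circ> F\<^sub>o) (G\<^sub>m \<circ> F\<^sub>m) \<eta>) \<and>
      (\<exists>\<epsilon>. natural_isomorphism C (F\<^sub>o \<circ> G\<^sub>o) (F\<^sub>m \<circ> G\<^sub>m) (\<lambda>X. X) (\<lambda>f. f) \<epsilon>))"

record ('o, 'm) preadditive = "('o, 'm) category" +
  addm :: "'m \<Rightarrow> 'm \<Rightarrow> 'm"  (infixl \<open>\<^bold>+\<index>\<close> 65)
  zerom :: "'o \<Rightarrow> 'o \<Rightarrow> 'm"

definition hom_group :: "('o, 'm, 'e) preadditive_scheme \<Rightarrow> 'o \<Rightarrow> 'o \<Rightarrow> 'm monoid" where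
  "hom_group C X Y = \<lparr>carrier = Hom C X Y, monoid.mult = addm C, one = zerom C X Y\<rparr>"

definition negm :: "('o, 'm, 'e) preadditive_scheme \<Rightarrow> 'o \<Rightarrow> 'o \<Rightarrow> 'm \<Rightarrow> 'm" where
  "negm C X Y f = inv\<^bsub>hom_group C X Y\<^esub> f"

locale preadditive_category = category C for C (structure) +
  assumes hom_comm_group: "\<lbrakk>X \<in> Obj C; Y \<in> Obj C\<rbrakk> \<Longrightarrow> comm_group (hom_group C X Y)"
    and cmp_add: "\<lbrakk>X \<in> Obj C; Y \<in> Obj C; Z \<in> Obj C; f \<in> Hom C X Y; f' \<in> Hom C X Y; g \<in> Hom C Y Z\<rbrakk>
      \<Longrightarrow> g \<cdot> (f \<^bold>+ f') = g \<cdot> f \<^bold>+ g \<cdot> f'"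
    and add_cmp: "\<lbrakk>X \<in> Obj C; Y \<in> Obj C; Z \<in> Obj C; f \<in> Hom C X Y; g \<in> Hom C Y Z; g' \<in> Hom C Y Z\<rbrakk>
      \<Longrightarrow> (g \<^bold>+ g') \<cdot> f = g \<cdot> f \<^bold>+ g' \<cdot> f"

datatype ('o, 'm) biprod = Biprod (apex: 'o) (inj1: 'm) (inj2: 'm) (prj1: 'm) (prj2: 'm)

definition is_biproduct ::
  "('o, 'm, 'e) preadditive_scheme \<Rightarrow> 'o \<Rightarrow> 'o \<Rightarrow> ('o, 'm) biprod \<Rightarrow> bool" where
  "is_biproduct C X Y B \<longleftrightarrow> apex B \<in> Obj C \<and>
    inj1 B \<in> Hom C X (apex B) \<and> inj2 B \<in> Hom C Y (apex B) \<and>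
    prj1 B \<in> Hom C (apex B) X \<and> prj2 B \<in> Hom C (apex B) Y \<and>
    prj1 B \<cdot>\<^bsub>C\<^esub> inj1 B = Ident C X \<and> prj2 B \<cdot>\<^bsub>C\<^esub> inj2 B = Ident C Y \<and>
    prj1 B \<cdot>\<^bsub>C\<^esub> inj2 B = zerom C Y X \<and> prj2 B \<cdot>\<^bsub>C\<^esub> inj1 B = zerom C X Y \<and>
    inj1 B \<cdot>\<^bsub>C\<^esub> prj1 B \<^bold>+\<^bsub>C\<^esub> inj2 B \<cdot>\<^bsub>C\<^esub> prj2 B = Ident C (apex B)"

locale additive_category = preadditive_category C for C (structure) +
  assumes ex_zero_object: "\<exists>N. zero_object C N"
    and ex_biproduct: "\<lbrakk>X \<in> Obj C; Y \<in> Obj C\<rbrakk> \<Longrightarrow> \<exists>B. is_biproduct C X Y B"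

definition dsum :: "('o, 'm, 'e) preadditive_scheme \<Rightarrow> 'o \<Rightarrow> 'o \<Rightarrow> ('o, 'm) biprod" where
  "dsum C X Y = (SOME B. is_biproduct C X Y B)"

text \<open>\<open>mat2 C B B' a b c d\<close> is the morphism from \<open>B\<close> to \<open>B'\<close> that acts on column vectors by the
  matrix with first row \<open>a b\<close> and second row \<open>c d\<close>.\<close>

definition mat2 :: "('o, 'm, 'e) preadditive_scheme \<Rightarrow> ('o, 'm) biprod \<Rightarrow> ('o, 'm) biprod
    \<Rightarrow> 'm \<Rightarrow> 'm \<Rightarrow> 'm \<Rightarrow> 'm \<Rightarrow> 'm" where
  "mat2 C B B' a b c d =
    inj1 B' \<cdot>\<^bsub>C\<^esub> (a \<cdot>\<^bsub>C\<^esub> prj1 B \<^bold>+\<^bsub>C\<^esub> b \<cdot>\<^bsub>C\<^esub> prj2 B) \<^bold>+\<^bsub>C\<^esub>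
    inj2 B' \<cdot>\<^bsub>C\<^esub> (c \<cdot>\<^bsub>C\<^esub> prj1 B \<^bold>+\<^bsub>C\<^esub> d \<cdot>\<^bsub>C\<^esub> prj2 B)"

section \<open>Triangulated categories\<close>

text \<open>\<open>Tri X Y Z u v w\<close> stands for \<open>X \<rightarrow> Y \<rightarrow> Z \<rightarrow> \<Sigma>X\<close> with successive maps \<open>u\<close>, \<open>v\<close>, \<open>w\<close>.\<close>

datatype ('o, 'm) triangle = Tri 'o 'o 'o 'm 'm 'm

record ('o, 'm) triangulated = "('o, 'm) preadditive" +
  susp_obj :: "'o \<Rightarrow> 'o"  (\<open>\<Sigma>\<^sub>o\<index>\<close>)
  susp :: "'m \<Rightarrow> 'm"  (\<open>\<Sigma>\<^sub>m\<index>\<close>)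
  exact_triangles :: "('o, 'm) triangle set"

text \<open>\<open>desusp T X Y k\<close> is \<open>\<Sigma>\<inverse>k : X \<rightarrow> Y\<close> for \<open>k : \<Sigma>X \<rightarrow> \<Sigma>Y\<close>. As \<open>\<Sigma>\<close> is merely
  a self-equivalence, this is the inverse of the bijection from \<open>Hom X Y\<close> to \<open>Hom (\<Sigma>X) (\<Sigma>Y)\<close>.\<close>

definition desusp :: "('o, 'm, 'e) triangulated_scheme \<Rightarrow> 'o \<Rightarrow> 'o \<Rightarrow> 'm \<Rightarrow> 'm" where
  "desusp T X Y k = (THE l. l \<in> Hom T X Y \<and> \<Sigma>\<^sub>m\<^bsub>T\<^esub> l = k)"

fun candidate_triangle ::
  "('o, 'm, 'e) triangulated_scheme \<Rightarrow> ('o, 'm) triangle \<Rightarrow> bool" where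
  "candidate_triangle T (Tri X Y Z u v w) \<longleftrightarrow> X \<in> Obj T \<and> Y \<in> Obj T \<and> Z \<in> Obj T \<and>
    u \<in> Hom T X Y \<and> v \<in> Hom T Y Z \<and> w \<in> Hom T Z (\<Sigma>\<^sub>o\<^bsub>T\<^esub> X)"

fun triangle_map ::
  "('o, 'm, 'e) triangulated_scheme \<Rightarrow> ('o, 'm) triangle \<Rightarrow> ('o, 'm) triangle
    \<Rightarrow> 'm \<Rightarrow> 'm \<Rightarrow> 'm \<Rightarrow> bool" where
  "triangle_map T (Tri X Y Z u v w) (Tri X' Y' Z' u' v' w') f g h \<longleftrightarrow>
    f \<in> Hom T X X' \<and> g \<in> Hom T Y Y' \<and> h \<in> Hom T Z Z' \<and>
    g \<cdot>\<^bsub>T\<^esub> u = u' \<cdot>\<^bsub>T\<^esub> f \<and> h \<cdot>\<^bsub>T\<^esub> v = v' \<cdot>\<^bsub>T\<^esub> g \<and> \<Sigma>\<^sub>m\<^bsub>T\<^esub> f \<cdot>\<^bsub>T\<^esub> w = w' \<cdot>\<^bsub>T\<^esub> h"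

text \<open>In \<open>octahedron T t\<^sub>a t\<^sub>b t\<^sub>c \<alpha> \<beta> \<gamma>\<close>, the triangles \<open>t\<^sub>a\<close>, \<open>t\<^sub>b\<close>, \<open>t\<^sub>c\<close> are those on \<open>a\<close>, \<open>b\<close> and
  the composite \<open>ba\<close>; they are required to be exact and to fit together in this way.\<close>

fun octahedron ::
  "('o, 'm, 'e) triangulated_scheme \<Rightarrow> ('o, 'm) triangle \<Rightarrow> ('o, 'm) triangle
    \<Rightarrow> ('o, 'm) triangle \<Rightarrow> 'm \<Rightarrow> 'm \<Rightarrow> 'm \<Rightarrow> bool" where
  "octahedron T (Tri P Q C\<^sub>a a a' a'') (Tri Q\<^sub>1 R C\<^sub>b b b' b'') (Tri P\<^sub>1 R\<^sub>1 C c c' c'') \<alpha> \<beta> \<gamma> \<longleftrightarrow>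
    Tri P Q C\<^sub>a a a' a'' \<in> exact_triangles T \<and>
    Tri Q\<^sub>1 R C\<^sub>b b b' b'' \<in> exact_triangles T \<and>
    Tri P\<^sub>1 R\<^sub>1 C c c' c'' \<in> exact_triangles T \<and>
    Q\<^sub>1 = Q \<and> P\<^sub>1 = P \<and> R\<^sub>1 = R \<and> c = b \<cdot>\<^bsub>T\<^esub> a \<and>
    \<alpha> \<in> Hom T C\<^sub>a C \<and> \<beta> \<in> Hom T C C\<^sub>b \<and> \<gamma> \<in> Hom T C\<^sub>b (\<Sigma>\<^sub>o\<^bsub>T\<^esub> C\<^sub>a) \<and>
    Tri C\<^sub>a C C\<^sub>b \<alpha> \<beta> \<gamma> \<in> exact_triangles T \<and>
    \<alpha> \<cdot>\<^bsub>T\<^esub> a' = c' \<cdot>\<^bsub>T\<^esub> b \<and> c'' \<cdot>\<^bsub>T\<^esub> \<alpha> = a'' \<and>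
    \<beta> \<cdot>\<^bsub>T\<^esub> c' = b' \<and> \<gamma> = \<Sigma>\<^sub>m\<^bsub>T\<^esub> a' \<cdot>\<^bsub>T\<^esub> b'' \<and> b'' \<cdot>\<^bsub>T\<^esub> \<beta> = \<Sigma>\<^sub>m\<^bsub>T\<^esub> a \<cdot>\<^bsub>T\<^esub> c''"

locale triangulated_category = additive_category T for T (structure) +
  assumes susp_equivalence: "self_equivalence T \<Sigma>\<^sub>o \<Sigma>\<^sub>m"
    and susp_add: "\<lbrakk>X \<in> Obj T; Y \<in> Obj T; f \<in> Hom T X Y; g \<in> Hom T X Y\<rbrakk>
      \<Longrightarrow> \<Sigma>\<^sub>m (f \<^bold>+ g) = \<Sigma>\<^sub>m f \<^bold>+ \<Sigma>\<^sub>m g"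
    and exact_candidate: "t \<in> exact_triangles T \<Longrightarrow> candidate_triangle T t"
    and TR1_iso: "\<lbrakk>Tri X Y Z u v w \<in> exact_triangles T;
        candidate_triangle T (Tri X' Y' Z' u' v' w');
        triangle_map T (Tri X Y Z u v w) (Tri X' Y' Z' u' v' w') f g h;
        isomorphism T X X' f; isomorphism T Y Y' g; isomorphism T Z Z' h\<rbrakk>
      \<Longrightarrow> Tri X' Y' Z' u' v' w' \<in> exact_triangles T"
    and TR1_Ident: "\<lbrakk>X \<in> Obj T; zero_object T N\<rbrakk>
      \<Longrightarrow> Tri X X N (Ident T X) (zerom T X N) (zerom T N (\<Sigma>\<^sub>o X)) \<in> exact_triangles T"
    and TR1_cone: "\<lbrakk>X \<in> Obj T; Y \<in> Obj T; u \<in> Hom T X Y\<rbrakk>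
      \<Longrightarrow> \<exists>Z v w. Tri X Y Z u v w \<in> exact_triangles T"
    and TR2: "candidate_triangle T (Tri X Y Z u v w) \<Longrightarrow>
      Tri X Y Z u v w \<in> exact_triangles T \<longleftrightarrow>
      Tri Y Z (\<Sigma>\<^sub>o X) v w (negm T (\<Sigma>\<^sub>o X) (\<Sigma>\<^sub>o Y) (\<Sigma>\<^sub>m u)) \<in> exact_triangles T"
    and TR3: "\<lbrakk>Tri X Y Z u v w \<in> exact_triangles T; Tri X' Y' Z' u' v' w' \<in> exact_triangles T;
        f \<in> Hom T X X'; g \<in> Hom T Y Y'; g \<cdot> u = u' \<cdot> f\<rbrakk>
      \<Longrightarrow> \<exists>h. triangle_map T (Tri X Y Z u v w) (Tri X' Y' Z' u' v' w') f g h"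
    and TR4: "\<lbrakk>Tri P Q C\<^sub>a a a' a'' \<in> exact_triangles T; Tri Q R C\<^sub>b b b' b'' \<in> exact_triangles T;
        Tri P R C (b \<cdot> a) c' c'' \<in> exact_triangles T\<rbrakk>
      \<Longrightarrow> \<exists>\<alpha> \<beta> \<gamma>. octahedron T (Tri P Q C\<^sub>a a a' a'') (Tri Q R C\<^sub>b b b' b'')
            (Tri P R C (b \<cdot> a) c' c'') \<alpha> \<beta> \<gamma>"

section \<open>Nullhomotopic, good and Verdier good maps of triangles\<close>

fun nullhomotopic ::
  "('o, 'm, 'e) triangulated_scheme \<Rightarrow> ('o, 'm) triangle \<Rightarrow> ('o, 'm) triangle
    \<Rightarrow> 'm \<Rightarrow> 'm \<Rightarrow> 'm \<Rightarrow> bool" where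
  "nullhomotopic T (Tri X Y Z u v w) (Tri X' Y' Z' u' v' w') f g h \<longleftrightarrow>
    (\<exists>F\<in>Hom T Y X'. \<exists>G\<in>Hom T Z Y'. \<exists>H\<in>Hom T (\<Sigma>\<^sub>o\<^bsub>T\<^esub> X) Z'.
      f = F \<cdot>\<^bsub>T\<^esub> u \<^bold>+\<^bsub>T\<^esub> desusp T X X' (w' \<cdot>\<^bsub>T\<^esub> H) \<and>
      g = G \<cdot>\<^bsub>T\<^esub> v \<^bold>+\<^bsub>T\<^esub> u' \<cdot>\<^bsub>T\<^esub> F \<and>
      h = H \<cdot>\<^bsub>T\<^esub> w \<^bold>+\<^bsub>T\<^esub> v' \<cdot>\<^bsub>T\<^esub> G)"

text \<open>The direct sum \<open>\<Sigma>X' \<oplus> \<Sigma>Y\<close> at the end of the mapping cone is identified with \<open>\<Sigma>(X' \<oplus> Y)\<close>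
  by using the images under \<open>\<Sigma>\<close> of the structure maps of \<open>X' \<oplus> Y\<close>.\<close>

definition susp_biprod ::
  "('o, 'm, 'e) triangulated_scheme \<Rightarrow> ('o, 'm) biprod \<Rightarrow> ('o, 'm) biprod" where
  "susp_biprod T B = Biprod (\<Sigma>\<^sub>o\<^bsub>T\<^esub> (apex B)) (\<Sigma>\<^sub>m\<^bsub>T\<^esub> (inj1 B)) (\<Sigma>\<^sub>m\<^bsub>T\<^esub> (inj2 B))
    (\<Sigma>\<^sub>m\<^bsub>T\<^esub> (prj1 B)) (\<Sigma>\<^sub>m\<^bsub>T\<^esub> (prj2 B))"

fun mapping_cone ::
  "('o, 'm, 'e) triangulated_scheme \<Rightarrow> ('o, 'm) triangle \<Rightarrow> ('o, 'm) triangle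
    \<Rightarrow> 'm \<Rightarrow> 'm \<Rightarrow> 'm \<Rightarrow> ('o, 'm) triangle" where
  "mapping_cone T (Tri X Y Z u v w) (Tri X' Y' Z' u' v' w') f g h =
    Tri (apex (dsum T X' Y)) (apex (dsum T Y' Z)) (apex (dsum T Z' (\<Sigma>\<^sub>o\<^bsub>T\<^esub> X)))
      (mat2 T (dsum T X' Y) (dsum T Y' Z)
        u' g
        (zerom T X' Z) (negm T Y Z v))
      (mat2 T (dsum T Y' Z) (dsum T Z' (\<Sigma>\<^sub>o\<^bsub>T\<^esub> X))
        v' h
        (zerom T Y' (\<Sigma>\<^sub>o\<^bsub>T\<^esub> X)) (negm T Z (\<Sigma>\<^sub>o\<^bsub>T\<^esub> X) w))
      (mat2 T (dsum T Z' (\<Sigma>\<^sub>o\<^bsub>T\<^esub> X)) (susp_biprod T (dsum T X' Y))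
        w' (\<Sigma>\<^sub>m\<^bsub>T\<^esub> f)
        (zerom T Z' (\<Sigma>\<^sub>o\<^bsub>T\<^esub> Y)) (negm T (\<Sigma>\<^sub>o\<^bsub>T\<^esub> X) (\<Sigma>\<^sub>o\<^bsub>T\<^esub> Y) (\<Sigma>\<^sub>m\<^bsub>T\<^esub> u)))"

text \<open>By invariance of exactness under isomorphism, the choice made in \<open>dsum\<close> does not matter.\<close>

definition good ::
  "('o, 'm, 'e) triangulated_scheme \<Rightarrow> ('o, 'm) triangle \<Rightarrow> ('o, 'm) triangle
    \<Rightarrow> 'm \<Rightarrow> 'm \<Rightarrow> 'm \<Rightarrow> bool" where
  "good T t t' f g h \<longleftrightarrow> mapping_cone T t t' f g h \<in> exact_triangles T"

text \<open>\<open>verdier_choice\<close> says that \<open>t\<^sub>f\<close>, \<open>t\<^sub>g\<close>, \<open>t\<^sub>A\<close> are exact triangles on \<open>f\<close>, \<open>g\<close> and \<open>gu\<close>.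
  Verdier goodness is defined relative to such a choice, on which it does not depend.\<close>

fun verdier_choice ::
  "('o, 'm, 'e) triangulated_scheme \<Rightarrow> ('o, 'm) triangle \<Rightarrow> ('o, 'm) triangle
    \<Rightarrow> 'm \<Rightarrow> 'm \<Rightarrow> ('o, 'm) triangle \<Rightarrow> ('o, 'm) triangle \<Rightarrow> ('o, 'm) triangle \<Rightarrow> bool" where
  "verdier_choice T (Tri X Y Z u v w) (Tri X' Y' Z' u' v' w') f g t\<^sub>f t\<^sub>g t\<^sub>A \<longleftrightarrow>
    {t\<^sub>f, t\<^sub>g, t\<^sub>A} \<subseteq> exact_triangles T \<and>
    (\<exists>X'' f' f''. t\<^sub>f = Tri X X' X'' f f' f'') \<and>
    (\<exists>Y'' g' g''. t\<^sub>g = Tri Y Y' Y'' g g' g'') \<and>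
    (\<exists>A vt wt. t\<^sub>A = Tri X Y' A (g \<cdot>\<^bsub>T\<^esub> u) vt wt)"

definition verdier_good ::
  "('o, 'm, 'e) triangulated_scheme \<Rightarrow> ('o, 'm) triangle \<Rightarrow> ('o, 'm) triangle
    \<Rightarrow> ('o, 'm) triangle \<Rightarrow> ('o, 'm) triangle \<Rightarrow> ('o, 'm) triangle \<Rightarrow> 'm \<Rightarrow> bool" where
  "verdier_good T t t' t\<^sub>f t\<^sub>g t\<^sub>A h \<longleftrightarrow>
    (\<exists>\<alpha>\<^sub>1 \<beta>\<^sub>1 \<gamma>\<^sub>1 \<alpha>\<^sub>2 \<beta>\<^sub>2 \<gamma>\<^sub>2. octahedron T t t\<^sub>g t\<^sub>A \<alpha>\<^sub>1 \<beta>\<^sub>1 \<gamma>\<^sub>1 \<and>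
      octahedron T t\<^sub>f t' t\<^sub>A \<alpha>\<^sub>2 \<beta>\<^sub>2 \<gamma>\<^sub>2 \<and> h = \<beta>\<^sub>2 \<cdot>\<^bsub>T\<^esub> \<alpha>\<^sub>1)"

end

(*
  A map of triangles that is homotopic to zero has a mapping cone isomorphic to that of the zero map,
  which is a direct sum of two exact triangles.  Conversely, let one of f, g, h vanish.  Then one of
  the three maps of the mapping cone is the same as for the zero map, and a fill-in between the two
  cones is a matrix from which a "lift" is read off: for f = 0 this is a map G from Z to Y' with
  g = Gv and h = v'G, and similarly for g = 0 and h = 0.  A lift is a null homotopy with two zero
  components.

  If f or g vanishes, then gu = 0 and the triangle on gu splits.  So h = \<beta>2 \<alpha>1 can be decomposed
  along the splitting, which produces a lift.  Conversely, a lift prescribes how to change \<alpha>1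
  (for f = 0) or \<beta>2 (for g = 0) so that the composite becomes h, and this change is realised by an
  automorphism of the splitting object A, hence respects the octahedral axiom.
*)
theory Submission
  imports Defs
begin

section \<open>Arrows\<close>

text \<open>A fill-in between two cones is merely some 2x2 matrix; it need be neither unitriangular
  nor unique. If the diagonal entry \<open>d\<close> of its second column were 1, a lift would be
  visible in the corner entry \<open>b\<close>. What the fill-in really gives is
  \<open>d v = v\<close>. Exactness turns this into \<open>d = 1 + e w\<close>, and since
  \<open>w' h = 0\<close> the error \<open>h e\<close> can be absorbed into the lift.

  The same matrix argument covers the three possible zero components after rotation. Rotation
  introduces signs and suspensions, and as \<Sigma> is not assumed to be strictly invertible, maps
  are brought back by its fullness and faithfulness.

  Exactness of a direct sum of exact triangles is not an axiom. It is derived from weak kernels and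
  weak cokernels: comparison maps exist in both directions and are mutually inverse up to
  square-zero errors.

  Verdier goodness is compared for f = 0 or g = 0 because either gives gu = 0, which is what splits
  the triangle on gu; h = 0 gives no such splitting.\<close>

text \<open>An arrow carries its domain and codomain, and an undefined composite or sum is \<open>None\<close>.
  Therefore associativity and distributivity hold without side conditions.\<close>

type_synonym ('o, 'm) arrow = "('o \<times> 'o \<times> 'm) option"

definition arr :: "'o \<Rightarrow> 'o \<Rightarrow> 'm \<Rightarrow> ('o, 'm) arrow" where
  "arr X Y f = Some (X, Y, f)"

definition dm :: "('o, 'm) arrow \<Rightarrow> 'o" where
  "dm a = fst (the a)"

definition cd :: "('o, 'm) arrow \<Rightarrow> 'o" where
  "cd a = fst (snd (the a))"

definition mor :: "('o, 'm) arrow \<Rightarrow> 'm" where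
  "mor a = snd (snd (the a))"

lemma arr_sel [simp]: "dm (arr X Y f) = X" "cd (arr X Y f) = Y" "mor (arr X Y f) = f"
  by (simp_all add: arr_def dm_def cd_def mor_def)

lemma arr_eq_iff [simp]: "arr X Y f = arr X' Y' f' \<longleftrightarrow> X = X' \<and> Y = Y' \<and> f = f'"
  by (simp add: arr_def)

lemma arr_neq_None [simp]: "arr X Y f \<noteq> None"
  by (simp add: arr_def)

section \<open>Calculus of arrows: composites, sums, negatives and zeros\<close>

context preadditive_category
begin

definition ok where
  "ok a \<longleftrightarrow> a \<noteq> None \<and> dm a \<in> Obj C \<and> cd a \<in> Obj C \<and> mor a \<in> Hom C (dm a) (cd a)"

definition comp (infixr \<open>\<odot>\<close> 70) where
  "b \<odot> a = (if ok a \<and> ok b \<and> cd a = dm b then arr (dm a) (cd b) (mor b \<cdot> mor a) else None)"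

definition plus (infixr \<open>\<oplus>\<close> 65) where
  "a \<oplus> b = (if ok a \<and> ok b \<and> dm a = dm b \<and> cd a = cd b
    then arr (dm a) (cd a) (mor a \<^bold>+ mor b) else None)"

definition neg (\<open>\<ominus> _\<close> [81] 80) where
  "\<ominus> a = (if ok a then arr (dm a) (cd a) (negm C (dm a) (cd a) (mor a)) else None)"

definition zero where
  "zero X Y = arr X Y (zerom C X Y)"

definition iden where
  "iden X = arr X X (Ident C X)"

definition harr where
  "harr a X Y \<longleftrightarrow> ok a \<and> dm a = X \<and> cd a = Y"

lemma harrD: assumes "harr a X Y"
  shows "ok a" "dm a = X" "cd a = Y" "X \<in> Obj C" "Y \<in> Obj C"
  using assms by (auto simp: harr_def ok_def)

lemma ok_None [simp]: "\<not> ok None"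
  by (simp add: ok_def)

lemma ok_arr: "ok (arr X Y f) \<longleftrightarrow> X \<in> Obj C \<and> Y \<in> Obj C \<and> f \<in> Hom C X Y"
  by (simp add: ok_def)

lemma harr_arr: "harr (arr X Y f) X Y \<longleftrightarrow> X \<in> Obj C \<and> Y \<in> Obj C \<and> f \<in> Hom C X Y"
  by (simp add: ok_arr harr_def)

lemma ok_cases: assumes "ok a"
  obtains X Y f where "a = arr X Y f" "X \<in> Obj C" "Y \<in> Obj C" "f \<in> Hom C X Y"
  using assms by (cases a) (auto simp: ok_def arr_def dm_def cd_def mor_def)

lemma harr_cases: assumes "harr a X Y"
  obtains f where "a = arr X Y f" "X \<in> Obj C" "Y \<in> Obj C" "f \<in> Hom C X Y"
  using assms by (metis arr_sel(1,2) ok_cases harr_def)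

lemma ok_obj [simp]: "ok a \<Longrightarrow> dm a \<in> Obj C" "ok a \<Longrightarrow> cd a \<in> Obj C"
  by (simp_all add: ok_def)

lemma hom_closed:
  assumes "X \<in> Obj C" "Y \<in> Obj C"
  shows "zerom C X Y \<in> Hom C X Y"
    and "f \<in> Hom C X Y \<Longrightarrow> f' \<in> Hom C X Y \<Longrightarrow> f \<^bold>+ f' \<in> Hom C X Y"
    and "f \<in> Hom C X Y \<Longrightarrow> negm C X Y f \<in> Hom C X Y"
proof -
  interpret G: comm_group "hom_group C X Y" using hom_comm_group assms .
  show "zerom C X Y \<in> Hom C X Y" using G.one_closed by (simp add: hom_group_def)
  show "f \<in> Hom C X Y \<Longrightarrow> f' \<in> Hom C X Y \<Longrightarrow> f \<^bold>+ f' \<in> Hom C X Y"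
    using G.m_closed[of f f'] by (simp add: hom_group_def)
  show "f \<in> Hom C X Y \<Longrightarrow> negm C X Y f \<in> Hom C X Y"
    using G.inv_closed[of f] by (simp add: hom_group_def negm_def)
qed

lemma hom_arith:
  assumes "X \<in> Obj C" "Y \<in> Obj C" "f \<in> Hom C X Y"
  shows "g \<in> Hom C X Y \<Longrightarrow> h \<in> Hom C X Y \<Longrightarrow> (f \<^bold>+ g) \<^bold>+ h = f \<^bold>+ (g \<^bold>+ h)"
    and "g \<in> Hom C X Y \<Longrightarrow> f \<^bold>+ g = g \<^bold>+ f"
    and "zerom C X Y \<^bold>+ f = f"
    and "f \<^bold>+ negm C X Y f = zerom C X Y"
proof -
  interpret G: comm_group "hom_group C X Y" using hom_comm_group assms by blast
  show "g \<in> Hom C X Y \<Longrightarrow> h \<in> Hom C X Y \<Longrightarrow> (f \<^bold>+ g) \<^bold>+ h = f \<^bold>+ (g \<^bold>+ h)"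
    using G.m_assoc[of f g h] assms by (simp add: hom_group_def)
  show "g \<in> Hom C X Y \<Longrightarrow> f \<^bold>+ g = g \<^bold>+ f"
    using G.m_comm[of f g] assms by (simp add: hom_group_def)
  show "zerom C X Y \<^bold>+ f = f"
    using G.l_one[of f] assms by (simp add: hom_group_def)
  show "f \<^bold>+ negm C X Y f = zerom C X Y"
    using G.r_inv[of f] assms by (simp add: hom_group_def negm_def)
qed

lemma ok_mor: "ok a \<Longrightarrow> mor a \<in> Hom C (dm a) (cd a)"
  unfolding ok_def by blast

lemma ok_comp [simp]: "ok (b \<odot> a) \<longleftrightarrow> ok a \<and> ok b \<and> cd a = dm b"
proof -
  have "ok a \<Longrightarrow> ok b \<Longrightarrow> cd a = dm b \<Longrightarrow> mor b \<cdot> mor a \<in> Hom C (dm a) (cd b)"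
    by (metis cmp_in ok_def)
  then show ?thesis by (auto simp: comp_def ok_arr)
qed

lemma ok_plus [simp]: "ok (a \<oplus> b) \<longleftrightarrow> ok a \<and> ok b \<and> dm a = dm b \<and> cd a = cd b"
proof -
  have "ok a \<Longrightarrow> ok b \<Longrightarrow> dm a = dm b \<Longrightarrow> cd a = cd b \<Longrightarrow> mor a \<^bold>+ mor b \<in> Hom C (dm a) (cd a)"
    by (metis hom_closed(2) ok_def)
  then show ?thesis by (auto simp: plus_def ok_arr)
qed

lemma ok_neg [simp]: "ok (\<ominus> a) \<longleftrightarrow> ok a"
  unfolding neg_def using ok_mor hom_closed(3) by (auto simp: ok_arr)

lemma ok_zero [simp]: "ok (zero X Y) \<longleftrightarrow> X \<in> Obj C \<and> Y \<in> Obj C"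
  unfolding zero_def using hom_closed(1) by (auto simp: ok_arr)

lemma ok_iden [simp]: "ok (iden X) \<longleftrightarrow> X \<in> Obj C"
  unfolding iden_def using Ident_in by (auto simp: ok_arr)

lemma dm_cd_simps [simp]:
  "ok a \<Longrightarrow> ok b \<Longrightarrow> cd a = dm b \<Longrightarrow> dm (b \<odot> a) = dm a"
  "ok a \<Longrightarrow> ok b \<Longrightarrow> cd a = dm b \<Longrightarrow> cd (b \<odot> a) = cd b"
  "ok a \<Longrightarrow> ok b \<Longrightarrow> dm a = dm b \<Longrightarrow> cd a = cd b \<Longrightarrow> dm (a \<oplus> b) = dm b"
  "ok a \<Longrightarrow> ok b \<Longrightarrow> dm a = dm b \<Longrightarrow> cd a = cd b \<Longrightarrow> cd (a \<oplus> b) = cd b"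
  "ok a \<Longrightarrow> dm (\<ominus> a) = dm a" "ok a \<Longrightarrow> cd (\<ominus> a) = cd a"
  "dm (zero X Y) = X" "cd (zero X Y) = Y" "dm (iden X) = X" "cd (iden X) = X"
  by (simp_all add: comp_def plus_def neg_def zero_def iden_def)

lemma not_ok: "\<not> ok (b \<odot> a) \<Longrightarrow> b \<odot> a = None" "\<not> ok (b \<oplus> a) \<Longrightarrow> b \<oplus> a = None"
  "\<not> ok (\<ominus> a) \<Longrightarrow> \<ominus> a = None"
  unfolding ok_comp ok_plus ok_neg by (auto simp: comp_def plus_def neg_def)

lemma arr_ops:
  "\<lbrakk>X \<in> Obj C; Y \<in> Obj C; Z \<in> Obj C; f \<in> Hom C X Y; g \<in> Hom C Y Z\<rbrakk>
    \<Longrightarrow> arr Y Z g \<odot> arr X Y f = arr X Z (g \<cdot> f)"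
  "\<lbrakk>X \<in> Obj C; Y \<in> Obj C; f \<in> Hom C X Y; g \<in> Hom C X Y\<rbrakk>
    \<Longrightarrow> arr X Y f \<oplus> arr X Y g = arr X Y (f \<^bold>+ g)"
  "\<lbrakk>X \<in> Obj C; Y \<in> Obj C; f \<in> Hom C X Y\<rbrakk> \<Longrightarrow> \<ominus> (arr X Y f) = arr X Y (negm C X Y f)"
  by (simp_all add: comp_def plus_def neg_def ok_arr)

lemma comp_assoc: "(c \<odot> b) \<odot> a = c \<odot> (b \<odot> a)"
proof (cases "ok a \<and> ok b \<and> ok c \<and> cd a = dm b \<and> cd b = dm c")
  case True
  then show ?thesis
    by (auto elim!: ok_cases simp: arr_ops cmp_in cmp_assoc)
next
  case False
  then show ?thesis by (subst (1 2) not_ok(1)) auto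
qed

lemma plus_assoc: "(a \<oplus> b) \<oplus> c = a \<oplus> (b \<oplus> c)"
proof (cases "ok a \<and> ok b \<and> ok c \<and> dm a = dm b \<and> cd a = cd b \<and> dm b = dm c \<and> cd b = cd c")
  case True
  then show ?thesis
    by (auto elim!: ok_cases simp: arr_ops hom_closed hom_arith(1))
next
  case False
  then show ?thesis by (subst (1 2) not_ok(2)) auto
qed

lemma plus_commute: "a \<oplus> b = b \<oplus> a"
proof (cases "ok a \<and> ok b \<and> dm a = dm b \<and> cd a = cd b")
  case True
  then show ?thesis
    by (auto elim!: ok_cases simp: arr_ops hom_closed hom_arith(2))
next
  case False
  then show ?thesis by (subst (1 2) not_ok(2)) auto
qed

lemma plus_left_commute: "a \<oplus> (b \<oplus> c) = b \<oplus> (a \<oplus> c)"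
  by (metis plus_assoc plus_commute)

lemma comp_plus: "c \<odot> (a \<oplus> b) = (c \<odot> a) \<oplus> (c \<odot> b)"
proof (cases "ok a \<and> ok b \<and> ok c \<and> dm a = dm b \<and> cd a = cd b \<and> cd a = dm c")
  case True
  then show ?thesis
    by (auto elim!: ok_cases simp: arr_ops hom_closed cmp_in cmp_add)
next
  case False
  then show ?thesis by (subst not_ok(1), force, subst not_ok(2)) auto
qed

lemma plus_comp: "(a \<oplus> b) \<odot> c = (a \<odot> c) \<oplus> (b \<odot> c)"
proof (cases "ok a \<and> ok b \<and> ok c \<and> dm a = dm b \<and> cd a = cd b \<and> dm a = cd c")
  case True
  then show ?thesis
    by (auto elim!: ok_cases simp: arr_ops hom_closed cmp_in add_cmp)
next
  case False
  then show ?thesis by (subst not_ok(1), force, subst not_ok(2)) auto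
qed

lemma plus_zero [simp]:
  "ok a \<Longrightarrow> dm a = X \<Longrightarrow> cd a = Y \<Longrightarrow> zero X Y \<oplus> a = a"
  "ok a \<Longrightarrow> dm a = X \<Longrightarrow> cd a = Y \<Longrightarrow> a \<oplus> zero X Y = a"
  unfolding plus_commute[of a]
  by (auto elim!: ok_cases simp: arr_ops hom_closed hom_arith(3) zero_def)

lemma plus_neg [simp]:
  "ok a \<Longrightarrow> a \<oplus> \<ominus> a = zero (dm a) (cd a)"
  "ok a \<Longrightarrow> \<ominus> a \<oplus> a = zero (dm a) (cd a)"
  unfolding plus_commute[of "\<ominus> a"]
  by (auto elim!: ok_cases simp: arr_ops hom_closed hom_arith(4) zero_def)

lemma plus_neg_cancel [simp]:
  assumes "ok a" "ok b" "dm a = dm b" "cd a = cd b"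
  shows "a \<oplus> (\<ominus> a \<oplus> b) = b" "\<ominus> a \<oplus> (a \<oplus> b) = b" "a \<oplus> (b \<oplus> \<ominus> a) = b" "\<ominus> a \<oplus> (b \<oplus> a) = b"
  using assms by (simp_all flip: plus_assoc) (simp_all add: plus_commute[of _ b] plus_assoc)

lemma plus_left_cancel:
  assumes "a \<oplus> b = a \<oplus> c" "ok (a \<oplus> b)" shows "b = c"
  by (metis assms ok_plus plus_neg_cancel(2))

text \<open>Additive inverses are unique. The sign rules below use this to trade a statement about
  \<open>\<ominus>\<close> for a sum equal to zero, which distributivity can settle.\<close>

lemma eq_neg_iff:
  assumes "ok a" "ok b" "dm a = dm b" "cd a = cd b"
  shows "a = \<ominus> b \<longleftrightarrow> a \<oplus> b = zero (dm a) (cd a)"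
  using assms
  by (metis ok_neg ok_plus dm_cd_simps(5,6) plus_commute plus_left_cancel plus_neg(1))

lemma comp_zero [simp]:
  "ok a \<Longrightarrow> dm a = Y \<Longrightarrow> X \<in> Obj C \<Longrightarrow> a \<odot> zero X Y = zero X (cd a)"
  "ok a \<Longrightarrow> cd a = Y \<Longrightarrow> Z \<in> Obj C \<Longrightarrow> zero Y Z \<odot> a = zero (dm a) Z"
proof -
  assume a: "ok a" "dm a = Y" "X \<in> Obj C"
  \<comment> \<open>Since zero is its own double, so is the composite; cancelling one copy leaves
    zero.\<close>
  then have "a \<odot> zero X Y \<oplus> a \<odot> zero X Y = a \<odot> zero X Y \<oplus> zero X (cd a)"
    by (auto simp flip: comp_plus)
  then show "a \<odot> zero X Y = zero X (cd a)"
    using a by (auto dest: plus_left_cancel)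
next
  assume a: "ok a" "cd a = Y" "Z \<in> Obj C"
  then have "zero Y Z \<odot> a \<oplus> zero Y Z \<odot> a = zero Y Z \<odot> a \<oplus> zero (dm a) Z"
    by (auto simp flip: plus_comp)
  then show "zero Y Z \<odot> a = zero (dm a) Z"
    using a by (auto dest: plus_left_cancel)
qed

lemma comp_iden [simp]:
  "ok a \<Longrightarrow> dm a = X \<Longrightarrow> a \<odot> iden X = a"
  "ok a \<Longrightarrow> cd a = X \<Longrightarrow> iden X \<odot> a = a"
  by (auto elim!: ok_cases simp: arr_ops Ident_in cmp_Ident Ident_cmp iden_def)

lemma comp_neg: "a \<odot> \<ominus> b = \<ominus> (a \<odot> b)"
proof (cases "ok a \<and> ok b \<and> cd b = dm a")
  case True
  then show ?thesis
    by (auto simp: eq_neg_iff simp flip: comp_plus)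
next
  case False
  then show ?thesis by (metis not_ok(1,3) ok_comp ok_neg dm_cd_simps(6))
qed

lemma neg_comp: "\<ominus> a \<odot> b = \<ominus> (a \<odot> b)"
proof (cases "ok a \<and> ok b \<and> cd b = dm a")
  case True
  then show ?thesis
    by (auto simp: eq_neg_iff simp flip: plus_comp)
next
  case False
  then show ?thesis by (metis not_ok(1,3) ok_comp ok_neg dm_cd_simps(5))
qed

lemma neg_neg [simp]: "ok a \<Longrightarrow> \<ominus> (\<ominus> a) = a"
  by (rule sym) (simp add: eq_neg_iff)

lemma neg_zero [simp]: "X \<in> Obj C \<Longrightarrow> Y \<in> Obj C \<Longrightarrow> \<ominus> (zero X Y) = zero X Y"
  by (rule sym) (simp add: eq_neg_iff)

lemma neg_plus: "\<ominus> (a \<oplus> b) = \<ominus> a \<oplus> \<ominus> b"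
proof (cases "ok a \<and> ok b \<and> dm a = dm b \<and> cd a = cd b")
  case True
  then have "\<ominus> a \<oplus> \<ominus> b = \<ominus> (a \<oplus> b)"
    by (subst eq_neg_iff) (auto simp: plus_assoc plus_left_commute[of "\<ominus> b"])
  then show ?thesis by simp
next
  case False
  then show ?thesis by (metis not_ok(2,3) ok_plus ok_neg dm_cd_simps(5,6))
qed

lemmas ring_simps = comp_assoc plus_assoc comp_plus plus_comp comp_neg neg_comp neg_plus

lemmas plus_ac = plus_assoc plus_commute plus_left_commute

section \<open>Isomorphisms and biproducts in terms of arrows\<close>

definition iso where
  "iso a \<longleftrightarrow> ok a \<and> (\<exists>b. harr b (cd a) (dm a) \<and> b \<odot> a = iden (dm a) \<and> a \<odot> b = iden (cd a))"

text \<open>A left inverse and a right inverse coincide, so they may be given by different formulas;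
  \<open>iso_if_square_zero\<close> depends on this freedom.\<close>

lemma isoI:
  assumes "harr a X Y" "harr b Y X" "harr c Y X" "b \<odot> a = iden X" "a \<odot> c = iden Y"
  shows "iso a"
proof -
  have "b = b \<odot> (a \<odot> c)" using assms by (simp add: harr_def)
  also have "\<dots> = (b \<odot> a) \<odot> c" by (simp only: comp_assoc)
  also have "\<dots> = c" using assms by (simp add: harr_def)
  finally show ?thesis using assms by (auto simp: iso_def harr_def)
qed

lemma iso_iden: "X \<in> Obj C \<Longrightarrow> iso (iden X)"
  unfolding iso_def by (intro conjI exI[of _ "iden X"]) (auto simp: harr_def)

lemma isomorphism_if_iso:
  assumes "iso a"
  shows "isomorphism C (dm a) (cd a) (mor a)"
proof -
  obtain b where b: "ok a" "harr b (cd a) (dm a)" "b \<odot> a = iden (dm a)" "a \<odot> b = iden (cd a)"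
    using assms by (auto simp: iso_def)
  then have "mor b \<in> Hom C (cd a) (dm a)"
    by (metis harr_def ok_mor)
  moreover from b have "mor b \<cdot> mor a = Ident C (dm a)" "mor a \<cdot> mor b = Ident C (cd a)"
    by (simp_all add: comp_def iden_def harr_def)
  ultimately show ?thesis
    using b(1) ok_mor by (auto simp: isomorphism_def)
qed

definition biproduct where
  "biproduct X Y P i\<^sub>1 i\<^sub>2 p\<^sub>1 p\<^sub>2 \<longleftrightarrow>
    harr i\<^sub>1 X P \<and> harr i\<^sub>2 Y P \<and> harr p\<^sub>1 P X \<and> harr p\<^sub>2 P Y \<and>
    p\<^sub>1 \<odot> i\<^sub>1 = iden X \<and> p\<^sub>2 \<odot> i\<^sub>2 = iden Y \<and> p\<^sub>1 \<odot> i\<^sub>2 = zero Y X \<and> p\<^sub>2 \<odot> i\<^sub>1 = zero X Y \<and>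
    i\<^sub>1 \<odot> p\<^sub>1 \<oplus> i\<^sub>2 \<odot> p\<^sub>2 = iden P"

lemma biproductD:
  assumes "biproduct X Y P i\<^sub>1 i\<^sub>2 p\<^sub>1 p\<^sub>2"
  shows "ok i\<^sub>1" "ok i\<^sub>2" "ok p\<^sub>1" "ok p\<^sub>2"
    and "dm i\<^sub>1 = X" "dm i\<^sub>2 = Y" "cd p\<^sub>1 = X" "cd p\<^sub>2 = Y"
    and "cd i\<^sub>1 = P" "cd i\<^sub>2 = P" "dm p\<^sub>1 = P" "dm p\<^sub>2 = P"
    and "X \<in> Obj C" "Y \<in> Obj C" "P \<in> Obj C"
    and "p\<^sub>1 \<odot> i\<^sub>1 = iden X" "p\<^sub>2 \<odot> i\<^sub>2 = iden Y" "p\<^sub>1 \<odot> i\<^sub>2 = zero Y X" "p\<^sub>2 \<odot> i\<^sub>1 = zero X Y"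
  using assms by (auto simp: biproduct_def harr_def)

text \<open>Composites are normalised to the right, where \<open>p\<^sub>1 \<odot> i\<^sub>1\<close>
  no longer occurs as a subterm once another arrow follows. The biproduct relations are therefore
  repeated with such an arrow attached.\<close>

lemma biproduct_comp:
  assumes "biproduct X Y P i\<^sub>1 i\<^sub>2 p\<^sub>1 p\<^sub>2"
  shows "ok a \<Longrightarrow> cd a = X \<Longrightarrow> p\<^sub>1 \<odot> i\<^sub>1 \<odot> a = a" "ok b \<Longrightarrow> cd b = Y \<Longrightarrow> p\<^sub>2 \<odot> i\<^sub>2 \<odot> b = b"
    and "ok a \<Longrightarrow> cd a = X \<Longrightarrow> p\<^sub>2 \<odot> i\<^sub>1 \<odot> a = zero (dm a) Y"
    and "ok b \<Longrightarrow> cd b = Y \<Longrightarrow> p\<^sub>1 \<odot> i\<^sub>2 \<odot> b = zero (dm b) X"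
  using biproductD[OF assms] by (simp_all flip: comp_assoc)

lemma biproduct_sum:
  assumes "biproduct X Y P i\<^sub>1 i\<^sub>2 p\<^sub>1 p\<^sub>2"
  shows "ok a \<Longrightarrow> cd a = P \<Longrightarrow> i\<^sub>1 \<odot> p\<^sub>1 \<odot> a \<oplus> i\<^sub>2 \<odot> p\<^sub>2 \<odot> a = a"
    and "ok a \<Longrightarrow> dm a = P \<Longrightarrow> a \<odot> i\<^sub>1 \<odot> p\<^sub>1 \<oplus> a \<odot> i\<^sub>2 \<odot> p\<^sub>2 = a"
proof -
  have *: "i\<^sub>1 \<odot> p\<^sub>1 \<oplus> i\<^sub>2 \<odot> p\<^sub>2 = iden P"
    using assms by (simp add: biproduct_def)
  show "i\<^sub>1 \<odot> p\<^sub>1 \<odot> a \<oplus> i\<^sub>2 \<odot> p\<^sub>2 \<odot> a = a" if "ok a" "cd a = P"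
    using arg_cong[OF *, of "\<lambda>x. x \<odot> a"] that by (simp add: plus_comp comp_assoc)
  show "a \<odot> i\<^sub>1 \<odot> p\<^sub>1 \<oplus> a \<odot> i\<^sub>2 \<odot> p\<^sub>2 = a" if "ok a" "dm a = P"
    using arg_cong[OF *, of "\<lambda>x. a \<odot> x"] that by (simp add: comp_plus)
qed

lemma biproduct_arr:
  assumes "is_biproduct C X Y B" "X \<in> Obj C" "Y \<in> Obj C"
  shows "biproduct X Y (apex B) (arr X (apex B) (inj1 B)) (arr Y (apex B) (inj2 B))
    (arr (apex B) X (prj1 B)) (arr (apex B) Y (prj2 B))"
  using assms unfolding is_biproduct_def biproduct_def
  by (auto simp: harr_arr arr_ops iden_def zero_def cmp_in)

text \<open>Links the matrices in the definition of the mapping cone to arrows. The diagonal comes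
  first and the upper right corner last, so that an upper triangular matrix appears as a direct sum
  of maps plus a perturbation.\<close>

lemma arr_mat2:
  assumes "is_biproduct C X Y B" "is_biproduct C X' Y' B'"
    and "X \<in> Obj C" "Y \<in> Obj C" "X' \<in> Obj C" "Y' \<in> Obj C"
    and "a \<in> Hom C X X'" "b \<in> Hom C Y X'" "d \<in> Hom C Y Y'"
  shows "arr (apex B) (apex B') (mat2 C B B' a b (zerom C X Y') d) =
    arr X' (apex B') (inj1 B') \<odot> arr X X' a \<odot> arr (apex B) X (prj1 B) \<oplus>
    arr Y' (apex B') (inj2 B') \<odot> arr Y Y' d \<odot> arr (apex B) Y (prj2 B) \<oplus>
    arr X' (apex B') (inj1 B') \<odot> arr Y X' b \<odot> arr (apex B) Y (prj2 B)"
    (is "_ = ?i\<^sub>1 \<odot> ?a \<odot> ?p\<^sub>1 \<oplus> ?i\<^sub>2 \<odot> ?d \<odot> ?p\<^sub>2 \<oplus> ?i\<^sub>1 \<odot> ?b \<odot> ?p\<^sub>2")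
    and "mat2 C B B' a b (zerom C X Y') d \<in> Hom C (apex B) (apex B')"
proof -
  have B: "apex B \<in> Obj C" "prj1 B \<in> Hom C (apex B) X" "prj2 B \<in> Hom C (apex B) Y"
    "apex B' \<in> Obj C" "inj1 B' \<in> Hom C X' (apex B')" "inj2 B' \<in> Hom C Y' (apex B')"
    using assms(1,2) by (simp_all add: is_biproduct_def)
  have eq: "arr (apex B) (apex B') (mat2 C B B' a b (zerom C X Y') d) =
    ?i\<^sub>1 \<odot> (?a \<odot> ?p\<^sub>1 \<oplus> ?b \<odot> ?p\<^sub>2) \<oplus> ?i\<^sub>2 \<odot> (zero X Y' \<odot> ?p\<^sub>1 \<oplus> ?d \<odot> ?p\<^sub>2)"
    using assms B by (simp add: arr_ops cmp_in hom_closed zero_def mat2_def)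
  have "zero X Y' \<odot> ?p\<^sub>1 \<oplus> ?d \<odot> ?p\<^sub>2 = ?d \<odot> ?p\<^sub>2"
    using assms B by (simp add: ok_arr)
  then show "arr (apex B) (apex B') (mat2 C B B' a b (zerom C X Y') d) =
    ?i\<^sub>1 \<odot> ?a \<odot> ?p\<^sub>1 \<oplus> ?i\<^sub>2 \<odot> ?d \<odot> ?p\<^sub>2 \<oplus> ?i\<^sub>1 \<odot> ?b \<odot> ?p\<^sub>2"
    unfolding eq by (simp add: comp_plus plus_ac)
  have "ok (arr (apex B) (apex B') (mat2 C B B' a b (zerom C X Y') d))"
    unfolding eq using assms B by (simp add: ok_arr)
  then show "mat2 C B B' a b (zerom C X Y') d \<in> Hom C (apex B) (apex B')"
    by (simp add: ok_arr)
qed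

text \<open>\<open>b\<close> is a weak cokernel of \<open>a\<close> and \<open>a\<close> is a weak
  kernel of \<open>b\<close>: the universal properties without uniqueness. This is the form of
  exactness that consecutive maps of a triangle have.\<close>

definition weakly_exact where
  "weakly_exact a b \<longleftrightarrow> ok a \<and> ok b \<and> dm b = cd a \<and> b \<odot> a = zero (dm a) (cd b) \<and>
    (\<forall>n. ok n \<longrightarrow> dm n = cd a \<longrightarrow> n \<odot> a = zero (dm a) (cd n) \<longrightarrow>
      (\<exists>e. harr e (cd b) (cd n) \<and> n = e \<odot> b)) \<and>
    (\<forall>n. ok n \<longrightarrow> cd n = cd a \<longrightarrow> b \<odot> n = zero (dm n) (cd b) \<longrightarrow>
      (\<exists>e. harr e (dm n) (dm a) \<and> n = a \<odot> e))"

text \<open>Rotation produces signs. They do not affect weak exactness, since a sign can be moved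
  into the factor \<open>e\<close>.\<close>

lemma weakly_exact_neg1:
  assumes "weakly_exact a (\<ominus> b)"
  shows "weakly_exact a b"
proof -
  have ok: "ok a" "ok b" "dm b = cd a"
    using assms by (auto simp: weakly_exact_def)
  have "b \<odot> a = \<ominus> (\<ominus> b \<odot> a)"
    using ok by (simp add: neg_comp)
  also have "\<dots> = zero (dm a) (cd b)"
    using assms ok by (simp add: weakly_exact_def)
  finally have "b \<odot> a = zero (dm a) (cd b)" .
  moreover have "\<exists>e. harr e (cd b) (cd n) \<and> n = e \<odot> b"
    if n: "ok n" "dm n = cd a" "n \<odot> a = zero (dm a) (cd n)" for n
  proof -
    obtain e where "harr e (cd b) (cd n)" "n = e \<odot> \<ominus> b"
      using assms n ok by (auto simp: weakly_exact_def)
    then show ?thesis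
      by (intro exI[of _ "\<ominus> e"]) (simp add: harr_def comp_neg neg_comp)
  qed
  moreover have "\<exists>e. harr e (dm n) (dm a) \<and> n = a \<odot> e"
    if n: "ok n" "cd n = cd a" "b \<odot> n = zero (dm n) (cd b)" for n
    using assms n ok by (simp add: weakly_exact_def neg_comp)
  ultimately show ?thesis
    using ok by (simp add: weakly_exact_def)
qed

lemma weakly_exact_neg2:
  assumes "weakly_exact (\<ominus> a) b"
  shows "weakly_exact a b"
proof -
  have ok: "ok a" "ok b" "dm b = cd a"
    using assms by (auto simp: weakly_exact_def)
  have "b \<odot> a = \<ominus> (b \<odot> \<ominus> a)"
    using ok by (simp add: comp_neg)
  also have "\<dots> = zero (dm a) (cd b)"
    using assms ok by (simp add: weakly_exact_def)
  finally have "b \<odot> a = zero (dm a) (cd b)" .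
  moreover have "\<exists>e. harr e (cd b) (cd n) \<and> n = e \<odot> b"
    if n: "ok n" "dm n = cd a" "n \<odot> a = zero (dm a) (cd n)" for n
    using assms n ok by (simp add: weakly_exact_def comp_neg)
  moreover have "\<exists>e. harr e (dm n) (dm a) \<and> n = a \<odot> e"
    if n: "ok n" "cd n = cd a" "b \<odot> n = zero (dm n) (cd b)" for n
  proof -
    obtain e where "harr e (dm n) (dm a)" "n = \<ominus> a \<odot> e"
      using assms n ok by (auto simp: weakly_exact_def)
    then show ?thesis
      by (intro exI[of _ "\<ominus> e"]) (simp add: harr_def comp_neg neg_comp)
  qed
  ultimately show ?thesis
    using ok by (simp add: weakly_exact_def)
qed

lemma weakly_exactD:
  assumes "weakly_exact a b"
  shows "b \<odot> a = zero (dm a) (cd b)"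
    and "ok n \<Longrightarrow> dm n = cd a \<Longrightarrow> n \<odot> a = zero (dm a) (cd n) \<Longrightarrow>
      \<exists>e. harr e (cd b) (cd n) \<and> n = e \<odot> b"
    and "ok n \<Longrightarrow> cd n = cd a \<Longrightarrow> b \<odot> n = zero (dm n) (cd b) \<Longrightarrow>
      \<exists>e. harr e (dm n) (dm a) \<and> n = a \<odot> e"
  using assms by (simp_all add: weakly_exact_def)

lemma minus_eq_iff:
  assumes "ok a" "ok b" "ok c" "dm a = dm b" "cd a = cd b" "dm b = dm c" "cd b = cd c"
  shows "a \<oplus> \<ominus> b = c \<longleftrightarrow> a = b \<oplus> c"
proof
  assume "a \<oplus> \<ominus> b = c"
  then have "b \<oplus> c = b \<oplus> (a \<oplus> \<ominus> b)" by simp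
  then show "a = b \<oplus> c" using assms by simp
next
  assume "a = b \<oplus> c"
  then have "a \<oplus> \<ominus> b = (c \<oplus> b) \<oplus> \<ominus> b" by (simp add: plus_commute)
  then show "a \<oplus> \<ominus> b = c" using assms by (simp add: plus_assoc)
qed

text \<open>The key step from good to nullhomotopic: \<open>\<phi>\<close> is a fill-in that compares a mapping cone with
  the direct sum of its two triangles, and \<open>G\<close> is built from the second column of \<open>\<phi>\<close>.\<close>

lemma lift_of_comparison:
  assumes "biproduct X Y P i\<^sub>1 i\<^sub>2 p\<^sub>1 p\<^sub>2" "biproduct X' Y' Q j\<^sub>1 j\<^sub>2 q\<^sub>1 q\<^sub>2"
    and "biproduct X'' Y'' R k\<^sub>1 k\<^sub>2 r\<^sub>1 r\<^sub>2"
    and "harr v Y Y'" "harr w Y' Y''" "harr v' X' X''" "harr w' X'' W"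
    and "harr g Y X'" "harr h Y' X''"
    and "weakly_exact v w" "weakly_exact v' w'" "w' \<odot> h = zero Y' W"
    and "harr D P Q" "harr E Q R" "harr \<phi> Q Q"
    and Di: "D \<odot> i\<^sub>2 = \<ominus> (j\<^sub>2 \<odot> v)" and rE: "r\<^sub>1 \<odot> E = v' \<odot> q\<^sub>1" "r\<^sub>2 \<odot> E = \<ominus> (w \<odot> q\<^sub>2)"
    and \<phi>: "\<phi> \<odot> D = D \<oplus> j\<^sub>1 \<odot> g \<odot> p\<^sub>2" "(E \<oplus> k\<^sub>1 \<odot> h \<odot> q\<^sub>2) \<odot> \<phi> = E"
  shows "\<exists>G. harr G Y' X' \<and> g = G \<odot> v \<and> h = v' \<odot> G"
proof -
  note B1 = biproductD[OF assms(1)] biproduct_comp[OF assms(1)]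
  note B2 = biproductD[OF assms(2)] biproduct_comp[OF assms(2)]
  note B3 = biproductD[OF assms(3)] biproduct_comp[OF assms(3)]
  note ar = assms(4-9,13-15)[THEN harrD(1)] assms(4-9,13-15)[THEN harrD(2)]
    assms(4-9,13-15)[THEN harrD(3)] assms(7)[THEN harrD(5)]
  note [simp] = B1 B2 B3 ar
  \<comment> \<open>The second column of the matrix \<phi>: \<open>b\<close> is its corner entry,
    \<open>d\<close> its diagonal entry.\<close>
  define b d where "b = q\<^sub>1 \<odot> \<phi> \<odot> j\<^sub>2" and "d = q\<^sub>2 \<odot> \<phi> \<odot> j\<^sub>2"
  have bd [simp]: "ok b" "ok d" "dm b = Y'" "cd b = X'" "dm d = Y'" "cd d = Y'"
    by (simp_all add: b_def d_def)
  \<comment> \<open>The second column of the first equation for \<phi>. Its two rows yield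
    \<open>g = \<ominus> b \<odot> v\<close> and \<open>d \<odot> v = v\<close>.\<close>
  have "\<ominus> (\<phi> \<odot> j\<^sub>2 \<odot> v) = (\<phi> \<odot> D) \<odot> i\<^sub>2"
    by (simp add: comp_assoc Di comp_neg)
  also have "\<dots> = \<ominus> (j\<^sub>2 \<odot> v) \<oplus> j\<^sub>1 \<odot> g"
    by (simp add: \<phi>(1) plus_comp comp_assoc Di)
  finally have \<phi>v: "\<ominus> (\<phi> \<odot> j\<^sub>2 \<odot> v) = \<ominus> (j\<^sub>2 \<odot> v) \<oplus> j\<^sub>1 \<odot> g" .
  have bv: "g = \<ominus> b \<odot> v"
    using arg_cong[OF \<phi>v, of "\<lambda>x. q\<^sub>1 \<odot> x"] by (simp add: b_def ring_simps)
  have "\<ominus> (d \<odot> v) = \<ominus> v"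
    using arg_cong[OF \<phi>v, of "\<lambda>x. q\<^sub>2 \<odot> x"] by (simp add: d_def ring_simps)
  then have dv: "d \<odot> v = v"
    using neg_neg[of "d \<odot> v"] neg_neg[of v] by simp
  have r1: "r\<^sub>1 \<odot> E \<odot> x = v' \<odot> q\<^sub>1 \<odot> x" for x
    using rE(1) by (simp flip: comp_assoc)
  \<comment> \<open>The upper right entry of the second equation for \<phi>; on the right-hand side
    that entry vanishes.\<close>
  have "(r\<^sub>1 \<odot> (E \<oplus> k\<^sub>1 \<odot> h \<odot> q\<^sub>2) \<odot> \<phi>) \<odot> j\<^sub>2 = v' \<odot> b \<oplus> h \<odot> d"
    by (simp add: ring_simps r1 b_def d_def)
  moreover have "(r\<^sub>1 \<odot> (E \<oplus> k\<^sub>1 \<odot> h \<odot> q\<^sub>2) \<odot> \<phi>) \<odot> j\<^sub>2 = zero Y' X''"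
    unfolding \<phi>(2) by (simp add: comp_assoc r1)
  ultimately have hd: "v' \<odot> b \<oplus> h \<odot> d = zero Y' X''"
    by simp
  \<comment> \<open>As \<open>d\<close> need not be the identity, its deviation from 1 is factored
    through \<open>w\<close>.\<close>
  have "(d \<oplus> \<ominus> (iden Y')) \<odot> v = zero (dm v) Y'"
    by (simp add: plus_comp neg_comp dv)
  then obtain e where e: "harr e Y'' Y'" "d \<oplus> \<ominus> (iden Y') = e \<odot> w"
    using weakly_exactD(2)[OF assms(10), of "d \<oplus> \<ominus> (iden Y')"] by auto
  note [simp] = e(1)[THEN harrD(1)] e(1)[THEN harrD(2)] e(1)[THEN harrD(3)]
  have d_eq: "d = iden Y' \<oplus> e \<odot> w"
    using e(2) by (simp add: minus_eq_iff)
  \<comment> \<open>The deviation contributes \<open>h \<odot> e \<odot> w\<close>. Lifting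
    \<open>h \<odot> e\<close> through \<open>v'\<close> to \<open>k\<close> turns it into a
    correction of \<open>b\<close> by \<open>k \<odot> w\<close>, which does not disturb the formula
    for \<open>g\<close> because \<open>w \<odot> v\<close> is zero.\<close>
  have "w' \<odot> h \<odot> e = zero Y'' W"
    using assms(12) by (simp flip: comp_assoc)
  then obtain k where k: "harr k Y'' X'" "h \<odot> e = v' \<odot> k"
    using weakly_exactD(3)[OF assms(11), of "h \<odot> e"] by auto
  note [simp] = k(1)[THEN harrD(1)] k(1)[THEN harrD(2)] k(1)[THEN harrD(3)]
  have "v' \<odot> b \<oplus> h \<oplus> v' \<odot> k \<odot> w = zero Y' X''"
    using hd arg_cong[OF k(2), of "\<lambda>x. x \<odot> w"] by (simp add: d_eq comp_plus comp_assoc)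
  then have "h = \<ominus> (v' \<odot> b \<oplus> v' \<odot> k \<odot> w)"
    by (subst eq_neg_iff) (simp_all add: plus_ac)
  also have "\<dots> = v' \<odot> \<ominus> (b \<oplus> k \<odot> w)"
    by (simp add: comp_plus comp_neg)
  finally have "h = v' \<odot> \<ominus> (b \<oplus> k \<odot> w)" .
  moreover have "g = \<ominus> (b \<oplus> k \<odot> w) \<odot> v"
    using weakly_exactD(1)[OF assms(10)] bv by (simp add: ring_simps)
  moreover have "harr (\<ominus> (b \<oplus> k \<odot> w)) Y' X'"
    by (simp add: harr_def)
  ultimately show ?thesis
    by (intro exI[of _ "\<ominus> (b \<oplus> k \<odot> w)"] conjI)
qed

end

section \<open>Triangles in terms of arrows\<close>

lemma (in category) natural_isomorphism_cancel:
  assumes "natural_isomorphism C F\<^sub>o F\<^sub>m G\<^sub>o G\<^sub>m \<eta>" "X \<in> Obj C" "Y \<in> Obj C"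
    and "F\<^sub>o X \<in> Obj C" "F\<^sub>o Y \<in> Obj C" "G\<^sub>o X \<in> Obj C" "G\<^sub>o Y \<in> Obj C"
    and "f \<in> Hom C X Y" "g \<in> Hom C X Y"
  shows "F\<^sub>m f \<in> Hom C (F\<^sub>o X) (F\<^sub>o Y) \<Longrightarrow> F\<^sub>m g \<in> Hom C (F\<^sub>o X) (F\<^sub>o Y) \<Longrightarrow>
      G\<^sub>m f = G\<^sub>m g \<Longrightarrow> F\<^sub>m f = F\<^sub>m g"
    and "G\<^sub>m f \<in> Hom C (G\<^sub>o X) (G\<^sub>o Y) \<Longrightarrow> G\<^sub>m g \<in> Hom C (G\<^sub>o X) (G\<^sub>o Y) \<Longrightarrow>
      F\<^sub>m f = F\<^sub>m g \<Longrightarrow> G\<^sub>m f = G\<^sub>m g"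
proof -
  have iso: "isomorphism C (F\<^sub>o X) (G\<^sub>o X) (\<eta> X)" "isomorphism C (F\<^sub>o Y) (G\<^sub>o Y) (\<eta> Y)"
    and nat: "\<eta> Y \<cdot> F\<^sub>m f = G\<^sub>m f \<cdot> \<eta> X" "\<eta> Y \<cdot> F\<^sub>m g = G\<^sub>m g \<cdot> \<eta> X"
    using assms unfolding natural_isomorphism_def by blast+
  obtain x where x: "\<eta> X \<in> Hom C (F\<^sub>o X) (G\<^sub>o X)" "x \<in> Hom C (G\<^sub>o X) (F\<^sub>o X)" "\<eta> X \<cdot> x = Ident C (G\<^sub>o X)"
    using iso(1) by (auto simp: isomorphism_def)
  obtain y where y: "\<eta> Y \<in> Hom C (F\<^sub>o Y) (G\<^sub>o Y)" "y \<in> Hom C (G\<^sub>o Y) (F\<^sub>o Y)" "y \<cdot> \<eta> Y = Ident C (F\<^sub>o Y)"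
    using iso(2) by (auto simp: isomorphism_def)
  show "F\<^sub>m f = F\<^sub>m g"
    if "F\<^sub>m f \<in> Hom C (F\<^sub>o X) (F\<^sub>o Y)" "F\<^sub>m g \<in> Hom C (F\<^sub>o X) (F\<^sub>o Y)" "G\<^sub>m f = G\<^sub>m g"
  proof -
    \<comment> \<open>Composing the naturality square with the inverse of one component of \<eta>
      recovers the value of one functor from that of the other.\<close>
    have "y \<cdot> \<eta> Y \<cdot> F\<^sub>m f = y \<cdot> (\<eta> Y \<cdot> F\<^sub>m f)" "y \<cdot> \<eta> Y \<cdot> F\<^sub>m g = y \<cdot> (\<eta> Y \<cdot> F\<^sub>m g)"
      using that(1,2) assms(4-7) y(1,2) by (metis cmp_assoc)+
    then have "y \<cdot> \<eta> Y \<cdot> F\<^sub>m f = y \<cdot> \<eta> Y \<cdot> F\<^sub>m g"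
      using nat that(3) by simp
    then show ?thesis using that assms(4,5) y(3) Ident_cmp by simp
  qed
  show "G\<^sub>m f = G\<^sub>m g"
    if "G\<^sub>m f \<in> Hom C (G\<^sub>o X) (G\<^sub>o Y)" "G\<^sub>m g \<in> Hom C (G\<^sub>o X) (G\<^sub>o Y)" "F\<^sub>m f = F\<^sub>m g"
  proof -
    have "G\<^sub>m f \<cdot> (\<eta> X \<cdot> x) = G\<^sub>m f \<cdot> \<eta> X \<cdot> x" "G\<^sub>m g \<cdot> (\<eta> X \<cdot> x) = G\<^sub>m g \<cdot> \<eta> X \<cdot> x"
      using that(1,2) assms(4-7) x(1,2) by (metis cmp_assoc)+
    then have "G\<^sub>m f \<cdot> (\<eta> X \<cdot> x) = G\<^sub>m g \<cdot> (\<eta> X \<cdot> x)"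
      using nat that(3) by simp
    then show ?thesis using that assms(6,7) x(3) cmp_Ident by simp
  qed
qed

lemma endofunctorD:
  assumes "endofunctor C F\<^sub>o F\<^sub>m"
  shows "X \<in> Obj C \<Longrightarrow> F\<^sub>o X \<in> Obj C" "X \<in> Obj C \<Longrightarrow> F\<^sub>m (Ident C X) = Ident C (F\<^sub>o X)"
    and "X \<in> Obj C \<Longrightarrow> Y \<in> Obj C \<Longrightarrow> f \<in> Hom C X Y \<Longrightarrow> F\<^sub>m f \<in> Hom C (F\<^sub>o X) (F\<^sub>o Y)"
    and "X \<in> Obj C \<Longrightarrow> Y \<in> Obj C \<Longrightarrow> Z \<in> Obj C \<Longrightarrow> f \<in> Hom C X Y \<Longrightarrow> g \<in> Hom C Y Z \<Longrightarrow>
      F\<^sub>m (g \<cdot>\<^bsub>C\<^esub> f) = F\<^sub>m g \<cdot>\<^bsub>C\<^esub> F\<^sub>m f"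
  using assms unfolding endofunctor_def by blast+

text \<open>The unit \<eta> compares the identity functor with GF, so equality of the images under
  F, and hence under GF, descends to the maps themselves.\<close>

lemma (in category) self_equivalence_faithful:
  assumes "self_equivalence C F\<^sub>o F\<^sub>m" "X \<in> Obj C" "Y \<in> Obj C" "f \<in> Hom C X Y" "g \<in> Hom C X Y"
    and "F\<^sub>m f = F\<^sub>m g"
  shows "f = g"
proof -
  obtain G\<^sub>o G\<^sub>m \<eta> where F: "endofunctor C F\<^sub>o F\<^sub>m" and G: "endofunctor C G\<^sub>o G\<^sub>m"
    and \<eta>: "natural_isomorphism C (\<lambda>X. X) (\<lambda>f. f) (G\<^sub>o \<circ> F\<^sub>o) (G\<^sub>m \<circ> F\<^sub>m) \<eta>"
    using assms(1) unfolding self_equivalence_def by blast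
  show ?thesis
    by (rule natural_isomorphism_cancel(1)[OF \<eta>, of X Y])
      (use assms(2-) F G in \<open>auto simp: endofunctorD\<close>)
qed

lemma (in category) self_equivalence_full:
  assumes "self_equivalence C F\<^sub>o F\<^sub>m" "X \<in> Obj C" "Y \<in> Obj C" "k \<in> Hom C (F\<^sub>o X) (F\<^sub>o Y)"
  shows "\<exists>f\<in>Hom C X Y. F\<^sub>m f = k"
proof -
  obtain G\<^sub>o G\<^sub>m \<eta> \<epsilon> where F: "endofunctor C F\<^sub>o F\<^sub>m" and G: "endofunctor C G\<^sub>o G\<^sub>m"
    and \<eta>: "natural_isomorphism C (\<lambda>X. X) (\<lambda>f. f) (G\<^sub>o \<circ> F\<^sub>o) (G\<^sub>m \<circ> F\<^sub>m) \<eta>"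
    and \<epsilon>: "natural_isomorphism C (F\<^sub>o \<circ> G\<^sub>o) (F\<^sub>m \<circ> G\<^sub>m) (\<lambda>X. X) (\<lambda>f. f) \<epsilon>"
    using assms(1) unfolding self_equivalence_def by blast
  let ?H = "\<lambda>X. G\<^sub>o (F\<^sub>o X)"
  have ob: "F\<^sub>o X \<in> Obj C" "F\<^sub>o Y \<in> Obj C" "?H X \<in> Obj C" "?H Y \<in> Obj C"
    using assms(2,3) F G by (auto simp: endofunctorD)
  have iso: "isomorphism C X (?H X) (\<eta> X)" "isomorphism C Y (?H Y) (\<eta> Y)"
    using \<eta> assms(2,3) by (auto simp: natural_isomorphism_def)
  obtain x where x: "\<eta> X \<in> Hom C X (?H X)" "x \<in> Hom C (?H X) X" "\<eta> X \<cdot> x = Ident C (?H X)"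
    using iso(1) by (auto simp: isomorphism_def)
  obtain y where y: "\<eta> Y \<in> Hom C Y (?H Y)" "y \<in> Hom C (?H Y) Y" "\<eta> Y \<cdot> y = Ident C (?H Y)"
    using iso(2) by (auto simp: isomorphism_def)
  \<comment> \<open>The preimage is forced by naturality of the unit, because GF applied to it has
    to equal G applied to \<open>k\<close>.\<close>
  define f where "f = y \<cdot> (G\<^sub>m k \<cdot> \<eta> X)"
  have Gk: "G\<^sub>m k \<in> Hom C (?H X) (?H Y)"
    using assms(4) G ob by (auto simp: endofunctorD)
  have Gk\<eta>: "G\<^sub>m k \<cdot> \<eta> X \<in> Hom C X (?H Y)"
    using cmp_in[OF assms(2) ob(3,4) x(1) Gk] .
  have f: "f \<in> Hom C X Y"
    unfolding f_def using cmp_in[OF assms(2) ob(4) assms(3) Gk\<eta> y(2)] .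
  have Hf: "G\<^sub>m (F\<^sub>m f) \<in> Hom C (?H X) (?H Y)"
    using f assms(2,3) F G by (auto simp: endofunctorD)
  have "G\<^sub>m (F\<^sub>m f) \<cdot> \<eta> X = \<eta> Y \<cdot> f"
    using \<eta> assms(2,3) f by (simp add: natural_isomorphism_def)
  also have "\<dots> = \<eta> Y \<cdot> y \<cdot> (G\<^sub>m k \<cdot> \<eta> X)"
    unfolding f_def using cmp_assoc[OF assms(2) ob(4) assms(3) ob(4) Gk\<eta> y(2,1)] by simp
  also have "\<dots> = G\<^sub>m k \<cdot> \<eta> X"
    using y(3) Ident_cmp[OF assms(2) ob(4) Gk\<eta>] by simp
  finally have "G\<^sub>m (F\<^sub>m f) \<cdot> \<eta> X \<cdot> x = G\<^sub>m k \<cdot> \<eta> X \<cdot> x" by simp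
  then have "G\<^sub>m (F\<^sub>m f) = G\<^sub>m k"
    using cmp_assoc[OF ob(3) assms(2) ob(3,4) x(2,1) Gk] cmp_assoc[OF ob(3) assms(2) ob(3,4) x(2,1) Hf]
      cmp_Ident[OF ob(3,4) Gk] cmp_Ident[OF ob(3,4) Hf] x(3) by simp
  \<comment> \<open>G is cancelled with the counit: FG is naturally isomorphic to the identity, so
    FG cannot identify two different maps.\<close>
  then have "F\<^sub>m (G\<^sub>m (F\<^sub>m f)) = F\<^sub>m (G\<^sub>m k)" by simp
  moreover have "F\<^sub>m f \<in> Hom C (F\<^sub>o X) (F\<^sub>o Y)" "F\<^sub>o (?H X) \<in> Obj C" "F\<^sub>o (?H Y) \<in> Obj C"
    using f assms(2,3) ob F by (auto intro: endofunctorD)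
  ultimately have "F\<^sub>m f = k"
    using natural_isomorphism_cancel(2)[OF \<epsilon>, of "F\<^sub>o X" "F\<^sub>o Y" "F\<^sub>m f" k] assms(4) ob
    by simp
  with f show ?thesis by blast
qed

section \<open>Suspension, rotation and fill-ins for arrows\<close>

context triangulated_category
begin

notation comp (infixr \<open>\<odot>\<close> 70) and plus (infixr \<open>\<oplus>\<close> 65) and neg (\<open>\<ominus> _\<close> [81] 80)

lemma susp_functor: "endofunctor T \<Sigma>\<^sub>o \<Sigma>\<^sub>m"
  using susp_equivalence by (simp add: self_equivalence_def)

lemma susp_obj_in [simp]: "X \<in> Obj T \<Longrightarrow> \<Sigma>\<^sub>o X \<in> Obj T"
  using endofunctorD(1)[OF susp_functor] .

definition sus where
  "sus a = (if ok a then arr (\<Sigma>\<^sub>o (dm a)) (\<Sigma>\<^sub>o (cd a)) (\<Sigma>\<^sub>m (mor a)) else None)"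

lemma sus_arr:
  "X \<in> Obj T \<Longrightarrow> Y \<in> Obj T \<Longrightarrow> f \<in> Hom T X Y \<Longrightarrow>
    sus (arr X Y f) = arr (\<Sigma>\<^sub>o X) (\<Sigma>\<^sub>o Y) (\<Sigma>\<^sub>m f)"
  by (simp add: sus_def ok_arr)

lemma ok_sus [simp]: "ok (sus a) \<longleftrightarrow> ok a"
  using endofunctorD(3)[OF susp_functor] by (auto simp: sus_def ok_arr ok_mor)

lemma dm_cd_sus [simp]: "ok a \<Longrightarrow> dm (sus a) = \<Sigma>\<^sub>o (dm a)" "ok a \<Longrightarrow> cd (sus a) = \<Sigma>\<^sub>o (cd a)"
  by (simp_all add: sus_def)

lemma sus_iden: "X \<in> Obj T \<Longrightarrow> sus (iden X) = iden (\<Sigma>\<^sub>o X)"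
  by (simp add: iden_def sus_arr Ident_in endofunctorD(2)[OF susp_functor])

lemma sus_comp: "ok a \<Longrightarrow> ok b \<Longrightarrow> cd a = dm b \<Longrightarrow> sus (b \<odot> a) = sus b \<odot> sus a"
  by (auto elim!: ok_cases simp: sus_arr arr_ops cmp_in endofunctorD[OF susp_functor])

lemma sus_plus:
  "ok a \<Longrightarrow> ok b \<Longrightarrow> dm a = dm b \<Longrightarrow> cd a = cd b \<Longrightarrow> sus (a \<oplus> b) = sus a \<oplus> sus b"
  by (auto elim!: ok_cases simp: sus_arr arr_ops hom_closed susp_add endofunctorD[OF susp_functor])

lemma sus_zero: "X \<in> Obj T \<Longrightarrow> Y \<in> Obj T \<Longrightarrow> sus (zero X Y) = zero (\<Sigma>\<^sub>o X) (\<Sigma>\<^sub>o Y)"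
  using sus_plus[of "zero X Y" "zero X Y"] plus_left_cancel[of "sus (zero X Y)" "sus (zero X Y)"]
  by simp

lemma sus_neg:
  assumes "ok a" shows "sus (\<ominus> a) = \<ominus> (sus a)"
proof -
  have "sus (\<ominus> a) \<oplus> sus a = zero (\<Sigma>\<^sub>o (dm a)) (\<Sigma>\<^sub>o (cd a))"
    using assms sus_plus[of "\<ominus> a" a] sus_zero by simp
  then show ?thesis using assms by (simp add: eq_neg_iff)
qed

lemmas sus_simps = sus_iden sus_comp sus_plus sus_zero sus_neg

lemma sus_cancel:
  assumes "sus a = sus b" "ok a" "ok b" "dm a = dm b" "cd a = cd b"
  shows "a = b"
  using assms self_equivalence_faithful[OF susp_equivalence]
  by (auto elim!: ok_cases simp: sus_arr)

text \<open>Source and target of the preimage are prescribed, since \<Sigma> need not be injective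
  on objects. With \<open>sus_cancel\<close> this replaces a strict inverse of \<Sigma>.\<close>

lemma ex_desus:
  assumes "harr k (\<Sigma>\<^sub>o X) (\<Sigma>\<^sub>o Y)" "X \<in> Obj T" "Y \<in> Obj T"
  shows "\<exists>a. harr a X Y \<and> sus a = k"
proof -
  obtain m where m: "k = arr (\<Sigma>\<^sub>o X) (\<Sigma>\<^sub>o Y) m" "m \<in> Hom T (\<Sigma>\<^sub>o X) (\<Sigma>\<^sub>o Y)"
    using assms(1) by (auto elim: harr_cases)
  then obtain f where "f \<in> Hom T X Y" "\<Sigma>\<^sub>m f = m"
    using self_equivalence_full[OF susp_equivalence assms(2,3)] by auto
  then show ?thesis
    using assms m(1) by (intro exI[of _ "arr X Y f"]) (simp add: harr_arr sus_arr)
qed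

lemma desusp_arr:
  assumes "X \<in> Obj T" "Y \<in> Obj T" "k \<in> Hom T (\<Sigma>\<^sub>o X) (\<Sigma>\<^sub>o Y)"
  shows "desusp T X Y k \<in> Hom T X Y" "sus (arr X Y (desusp T X Y k)) = arr (\<Sigma>\<^sub>o X) (\<Sigma>\<^sub>o Y) k"
proof -
  have "\<exists>!l. l \<in> Hom T X Y \<and> \<Sigma>\<^sub>m l = k"
    using self_equivalence_full[OF susp_equivalence assms]
      self_equivalence_faithful[OF susp_equivalence assms(1,2)] by auto
  then have "desusp T X Y k \<in> Hom T X Y \<and> \<Sigma>\<^sub>m (desusp T X Y k) = k"
    unfolding desusp_def by (rule theI')
  then show "desusp T X Y k \<in> Hom T X Y" "sus (arr X Y (desusp T X Y k)) = arr (\<Sigma>\<^sub>o X) (\<Sigma>\<^sub>o Y) k"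
    using assms by (simp_all add: sus_arr)
qed

definition candidate where
  "candidate u v w \<longleftrightarrow> ok u \<and> ok v \<and> ok w \<and> dm v = cd u \<and> dm w = cd v \<and> cd w = \<Sigma>\<^sub>o (dm u)"

definition tri where
  "tri u v w \<longleftrightarrow> candidate u v w \<and>
    Tri (dm u) (cd u) (cd v) (mor u) (mor v) (mor w) \<in> exact_triangles T"

lemma candidateD:
  assumes "candidate u v w"
  shows "ok u" "ok v" "ok w" "dm v = cd u" "dm w = cd v" "cd w = \<Sigma>\<^sub>o (dm u)"
  using assms by (simp_all add: candidate_def)

lemma triD:
  assumes "tri u v w"
  shows "ok u" "ok v" "ok w" "dm v = cd u" "dm w = cd v" "cd w = \<Sigma>\<^sub>o (dm u)"
  using assms by (simp_all add: tri_def candidate_def)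

lemma candidate_triangle_arr:
  "candidate_triangle T (Tri X Y Z u v w) \<Longrightarrow>
    candidate (arr X Y u) (arr Y Z v) (arr Z (\<Sigma>\<^sub>o X) w)"
  by (simp add: candidate_def ok_arr)

lemma candidate_triangle_if_candidate:
  "candidate u v w \<Longrightarrow>
    candidate_triangle T (Tri (dm u) (cd u) (cd v) (mor u) (mor v) (mor w))"
  by (auto elim!: ok_cases simp: candidate_def)

lemma mor_simps:
  "ok a \<Longrightarrow> ok b \<Longrightarrow> cd a = dm b \<Longrightarrow> mor (b \<odot> a) = mor b \<cdot> mor a"
  "ok a \<Longrightarrow> ok b \<Longrightarrow> dm a = dm b \<Longrightarrow> cd a = cd b \<Longrightarrow> mor (a \<oplus> b) = mor a \<^bold>+ mor b"
  "ok a \<Longrightarrow> mor (sus a) = \<Sigma>\<^sub>m (mor a)"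
  by (simp_all add: comp_def plus_def sus_def)

lemma arrow_eq_iff:
  assumes "ok a" "ok b" "dm a = dm b" "cd a = cd b"
  shows "a = b \<longleftrightarrow> mor a = mor b"
  using assms by (auto elim!: ok_cases)

lemma triangle_map_mor_iff:
  assumes "candidate u v w" "candidate u' v' w'"
    and "harr f (dm u) (dm u')" "harr g (cd u) (cd u')" "harr h (cd v) (cd v')"
  shows "triangle_map T (Tri (dm u) (cd u) (cd v) (mor u) (mor v) (mor w))
      (Tri (dm u') (cd u') (cd v') (mor u') (mor v') (mor w')) (mor f) (mor g) (mor h) \<longleftrightarrow>
    g \<odot> u = u' \<odot> f \<and> h \<odot> v = v' \<odot> g \<and> sus f \<odot> w = w' \<odot> h"
proof -
  have "mor f \<in> Hom T (dm u) (dm u')" "mor g \<in> Hom T (cd u) (cd u')" "mor h \<in> Hom T (cd v) (cd v')"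
    using assms(3-5) ok_mor by (metis harr_def)+
  then show ?thesis
    using candidateD[OF assms(1)] candidateD[OF assms(2)] assms(3-5)[THEN harrD(1)]
      assms(3-5)[THEN harrD(2)] assms(3-5)[THEN harrD(3)]
    by (simp add: arrow_eq_iff mor_simps)
qed

lemma tri_arr:
  "tri (arr X Y u) (arr Y Z v) (arr Z (\<Sigma>\<^sub>o X) w) \<longleftrightarrow> Tri X Y Z u v w \<in> exact_triangles T"
  using exact_candidate[of "Tri X Y Z u v w"] candidate_triangle_arr by (auto simp: tri_def)

lemma tri_rotate_iff:
  assumes "candidate u v w"
  shows "tri v w (\<ominus> (sus u)) \<longleftrightarrow> tri u v w"
proof -
  obtain X Y u0 where u: "u = arr X Y u0" "X \<in> Obj T" "Y \<in> Obj T" "u0 \<in> Hom T X Y"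
    using assms by (auto simp: candidate_def elim: ok_cases)
  obtain Z v0 where v: "v = arr Y Z v0" "Z \<in> Obj T" "v0 \<in> Hom T Y Z"
    using assms u by (auto simp: candidate_def elim!: ok_cases)
  obtain w0 where w: "w = arr Z (\<Sigma>\<^sub>o X) w0" "w0 \<in> Hom T Z (\<Sigma>\<^sub>o X)"
    using assms u v by (auto simp: candidate_def elim!: ok_cases)
  have "\<ominus> (sus u) = arr (\<Sigma>\<^sub>o X) (\<Sigma>\<^sub>o Y) (negm T (\<Sigma>\<^sub>o X) (\<Sigma>\<^sub>o Y) (\<Sigma>\<^sub>m u0))"
    using u endofunctorD(3)[OF susp_functor] by (simp add: sus_arr arr_ops)
  then show ?thesis
    using u v w TR2[of X Y Z u0 v0 w0] by (simp add: tri_arr)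
qed

lemma tri_rotate: "tri u v w \<Longrightarrow> tri v w (\<ominus> (sus u))"
  using tri_rotate_iff tri_def by blast

lemma tri_iso:
  assumes "tri u v w" "candidate u' v' w'" "iso a" "iso b" "iso c"
    and "dm a = dm u" "cd a = dm u'" "dm b = cd u" "cd b = cd u'" "dm c = cd v" "cd c = cd v'"
    and "b \<odot> u = u' \<odot> a" "c \<odot> v = v' \<odot> b" "sus a \<odot> w = w' \<odot> c"
  shows "tri u' v' w'"
proof -
  have "triangle_map T (Tri (dm u) (cd u) (cd v) (mor u) (mor v) (mor w))
      (Tri (dm u') (cd u') (cd v') (mor u') (mor v') (mor w')) (mor a) (mor b) (mor c)"
    using assms triD[OF assms(1)] candidateD[OF assms(2)]
    by (subst triangle_map_mor_iff) (simp_all add: harr_def iso_def tri_def)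
  moreover note isomorphism_if_iso[OF assms(3)] isomorphism_if_iso[OF assms(4)]
    isomorphism_if_iso[OF assms(5)]
  ultimately show ?thesis
    using assms TR1_iso candidate_triangle_if_candidate[OF assms(2)]
    unfolding tri_def by metis
qed

lemma ex_tri: "ok u \<Longrightarrow> \<exists>v w. tri u v w"
  using TR1_cone by (metis ok_cases tri_arr)

lemma tri_fill3:
  assumes "tri u v w" "tri u' v' w'"
    and "harr f (dm u) (dm u')" "harr g (cd u) (cd u')" "g \<odot> u = u' \<odot> f"
  shows "\<exists>h. harr h (cd v) (cd v') \<and> h \<odot> v = v' \<odot> g \<and> sus f \<odot> w = w' \<odot> h"
proof -
  have can: "candidate u v w" "candidate u' v' w'"
    using assms(1,2) by (simp_all add: tri_def)
  have fg: "mor f \<in> Hom T (dm u) (dm u')" "mor g \<in> Hom T (cd u) (cd u')"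
    using assms(3,4) ok_mor by (metis harr_def)+
  have "mor g \<cdot> mor u = mor u' \<cdot> mor f"
    using arg_cong[OF assms(5), of mor] assms(3,4) triD[OF assms(1)] triD[OF assms(2)]
    by (simp add: harr_def mor_simps)
  then obtain h where h: "triangle_map T (Tri (dm u) (cd u) (cd v) (mor u) (mor v) (mor w))
      (Tri (dm u') (cd u') (cd v') (mor u') (mor v') (mor w')) (mor f) (mor g) h"
    using assms(1,2) fg TR3 unfolding tri_def by metis
  let ?h = "arr (cd v) (cd v') h"
  have "harr ?h (cd v) (cd v')"
    using h can by (simp add: harr_arr candidateD)
  moreover from this h have "?h \<odot> v = v' \<odot> g \<and> sus f \<odot> w = w' \<odot> ?h"
    using triangle_map_mor_iff[OF can assms(3,4), of ?h] by simp
  ultimately show ?thesis by blast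
qed

end

section \<open>Exactness and direct sums of triangles\<close>

context preadditive_category
begin

lemma neg_eq_iff [simp]: "ok a \<Longrightarrow> ok b \<Longrightarrow> \<ominus> a = \<ominus> b \<longleftrightarrow> a = b"
  by (metis neg_neg)

text \<open>If \<open>n \<odot> n\<close> is zero, then \<open>1 + n\<close> has the inverse
  \<open>1 - n\<close>. Correcting \<open>i\<close> by such inverses on the left and on the right
  gives a left and a right inverse of \<open>p\<close>. In \<open>tri_direct_sum\<close> this takes
  the place of the five lemma.\<close>

lemma iso_if_square_zero:
  assumes "harr i R W" "harr p W R" "harr n W W" "harr m R R"
    and ip: "i \<odot> p = iden W \<oplus> n" and pi: "p \<odot> i = iden R \<oplus> m"
    and "n \<odot> n = zero W W" "m \<odot> m = zero R R"
  shows "iso p"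
proof (rule isoI)
  show "harr p W R" "harr ((iden W \<oplus> \<ominus> n) \<odot> i) R W" "harr (i \<odot> (iden R \<oplus> \<ominus> m)) R W"
    using assms by (auto simp: harr_def)
  have "((iden W \<oplus> \<ominus> n) \<odot> i) \<odot> p = (iden W \<oplus> \<ominus> n) \<odot> (iden W \<oplus> n)"
    by (simp only: comp_assoc ip)
  also have "\<dots> = iden W"
    using assms harrD[OF assms(3)] by (simp add: ring_simps)
  finally show "((iden W \<oplus> \<ominus> n) \<odot> i) \<odot> p = iden W" .
  have "p \<odot> i \<odot> (iden R \<oplus> \<ominus> m) = (p \<odot> i) \<odot> (iden R \<oplus> \<ominus> m)"
    by (simp only: comp_assoc)
  also have "\<dots> = iden R"
    unfolding pi using assms harrD[OF assms(4)] by (simp add: ring_simps)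
  finally show "p \<odot> i \<odot> (iden R \<oplus> \<ominus> m) = iden R" .
qed

text \<open>An equational description of zero objects, which an additive functor visibly preserves;
  it is used to see that \<Sigma> sends zero objects to zero objects.\<close>

lemma zero_object_iff:
  assumes "N \<in> Obj C"
  shows "zero_object C N \<longleftrightarrow> iden N = zero N N"
proof
  assume "zero_object C N"
  then have "Ident C N = zerom C N N"
    using assms Ident_in hom_closed(1) unfolding zero_object_def by blast
  then show "iden N = zero N N"
    by (simp add: iden_def zero_def)
next
  assume eq: "iden N = zero N N"
  have *: "a = zero (dm a) N" if "ok a" "cd a = N" for a
    using arg_cong[OF eq, of "\<lambda>x. x \<odot> a"] that assms by simp
  have **: "a = zero N (cd a)" if "ok a" "dm a = N" for a
    using arg_cong[OF eq, of "\<lambda>x. a \<odot> x"] that assms by simp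
  have "f = zerom C X N" if "X \<in> Obj C" "f \<in> Hom C X N" for X f
    using *[of "arr X N f"] that assms by (simp add: ok_arr zero_def)
  moreover have "f = zerom C N X" if "X \<in> Obj C" "f \<in> Hom C N X" for X f
    using **[of "arr N X f"] that assms by (simp add: ok_arr zero_def)
  ultimately show "zero_object C N"
    using assms hom_closed(1) unfolding zero_object_def by blast
qed

end

context triangulated_category
begin

lemma zero_object_susp:
  assumes "zero_object T N"
  shows "zero_object T (\<Sigma>\<^sub>o N)"
proof -
  have "N \<in> Obj T"
    using assms by (simp add: zero_object_def)
  then show ?thesis
    using assms sus_iden[of N] sus_zero[of N N] by (simp add: zero_object_iff)
qed

lemma tri_iden:
  assumes "zero_object T N" "X \<in> Obj T"
  shows "tri (iden X) (zero X N) (zero N (\<Sigma>\<^sub>o X))"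
  using TR1_Ident[OF assms(2,1)] by (simp add: iden_def zero_def tri_arr)

lemma tri_comp_zero:
  assumes "tri u v w"
  shows "v \<odot> u = zero (dm u) (cd v)"
proof -
  note u = triD[OF assms]
  obtain N where N: "zero_object T N"
    using ex_zero_object by blast
  then have "N \<in> Obj T"
    by (simp add: zero_object_def)
  \<comment> \<open>A map from the triangle on the identity, with first two components 1 and
    \<open>u\<close>: its third component shows that \<open>v \<odot> u\<close> factors through a
    zero object.\<close>
  moreover have "\<exists>h. harr h N (cd v) \<and> h \<odot> zero (dm u) N = v \<odot> u"
    using tri_fill3[OF tri_iden[OF N, of "dm u"] assms, of "iden (dm u)" u] u \<open>N \<in> Obj T\<close>
    by (auto simp: harr_def)
  ultimately show ?thesis
    using u by (auto simp: harr_def)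
qed

lemma tri_cokernel:
  assumes "tri u v w" "ok n" "dm n = cd u" "n \<odot> u = zero (dm u) (cd n)"
  shows "\<exists>e. harr e (cd v) (cd n) \<and> n = e \<odot> v"
proof -
  note u = triD[OF assms(1)]
  obtain N where N: "zero_object T N"
    using ex_zero_object by blast
  then have NO: "N \<in> Obj T"
    by (simp add: zero_object_def)
  \<comment> \<open>The rotation of this triangle is the one on the identity of \<open>cd n\<close>,
    with the zero object \<open>\<Sigma>\<^sub>o N\<close>. A map into it with middle component
    \<open>n\<close> provides the factorisation.\<close>
  have "tri (zero N (cd n)) (iden (cd n)) (zero (cd n) (\<Sigma>\<^sub>o N))"
    using tri_iden[OF zero_object_susp[OF N], of "cd n"] assms(2) NO
    by (subst tri_rotate_iff[symmetric]) (simp_all add: candidate_def sus_zero)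
  then have "\<exists>h. harr h (cd v) (cd n) \<and> h \<odot> v = iden (cd n) \<odot> n"
    using tri_fill3[OF assms(1), of "zero N (cd n)" "iden (cd n)" "zero (cd n) (\<Sigma>\<^sub>o N)" "zero (dm u) N" n]
      assms u NO by (auto simp: harr_def)
  then show ?thesis
    using assms by auto
qed

lemma tri_weakly_exact:
  assumes "tri u v w"
  shows "weakly_exact v w"
proof -
  note u = triD[OF assms]
  note rot = tri_rotate[OF assms]
  have "\<exists>e. harr e (dm n) (dm v) \<and> n = v \<odot> e"
    if n: "ok n" "cd n = cd v" "w \<odot> n = zero (dm n) (cd w)" for n
  proof -
    let ?Q = "dm n"
    obtain N where N: "zero_object T N"
      using ex_zero_object by blast
    then have NO: "N \<in> Obj T"
      by (simp add: zero_object_def)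
    \<comment> \<open>For the weak kernel, the rotated identity triangle of the source of
      \<open>n\<close> is mapped to the twice rotated given triangle. The fill-in is the suspension
      of the wanted factor; the signs on both sides cancel.\<close>
    have "tri (zero ?Q N) (zero N (\<Sigma>\<^sub>o ?Q)) (\<ominus> (sus (iden ?Q)))"
      using tri_rotate[OF tri_iden[OF N, of ?Q]] n by simp
    from tri_fill3[OF this tri_rotate[OF rot], of n "zero N (cd w)"]
    obtain k where k: "harr k (\<Sigma>\<^sub>o ?Q) (\<Sigma>\<^sub>o (dm v))"
      "sus n \<odot> \<ominus> (sus (iden ?Q)) = \<ominus> (sus v) \<odot> k"
      using n u NO by (auto simp: harr_def)
    obtain e where e: "harr e ?Q (dm v)" "sus e = k"
      using ex_desus[OF k(1)] n u by auto
    have "sus n = sus (v \<odot> e)"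
      using k e u n
      by (auto simp: harr_def ring_simps sus_simps)
    then have "n = v \<odot> e"
      using e u n by - (rule sus_cancel, auto simp: harr_def)
    with e(1) show ?thesis by blast
  qed
  moreover have "\<exists>e. harr e (cd w) (cd n) \<and> n = e \<odot> w"
    if "ok n" "dm n = cd v" "n \<odot> v = zero (dm v) (cd n)" for n
    using tri_cokernel[OF rot] that by blast
  ultimately show ?thesis
    using u tri_comp_zero[OF rot] by (simp add: weakly_exact_def)
qed

text \<open>After one rotation the missing component is a third one, suspended. Fullness of \<Sigma>
  desuspends it and faithfulness desuspends its square. The same rotation reduces
  \<open>tri_fill2\<close> to this case.\<close>

lemma tri_fill1:
  assumes "tri u v w" "tri u' v' w'"
    and "harr g (cd u) (cd u')" "harr h (cd v) (cd v')" "h \<odot> v = v' \<odot> g"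
  shows "\<exists>f. harr f (dm u) (dm u') \<and> u' \<odot> f = g \<odot> u \<and> sus f \<odot> w = w' \<odot> h"
proof -
  note u = triD[OF assms(1)] triD[OF assms(2)]
  obtain k where k: "harr k (\<Sigma>\<^sub>o (dm u)) (\<Sigma>\<^sub>o (dm u'))" "k \<odot> w = w' \<odot> h"
    "sus g \<odot> \<ominus> (sus u) = \<ominus> (sus u') \<odot> k"
    using tri_fill3[OF tri_rotate[OF assms(1)] tri_rotate[OF assms(2)], of g h] assms(3-) u
    by auto
  obtain f where f: "harr f (dm u) (dm u')" "sus f = k"
    using ex_desus[OF k(1)] u by auto
  have "sus (g \<odot> u) = sus (u' \<odot> f)"
    using k(3)[folded f(2)] f(1) assms(3) u
    by (simp add: harr_def ring_simps sus_simps)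
  then have "g \<odot> u = u' \<odot> f"
    using f assms(3) u by - (rule sus_cancel, auto simp: harr_def)
  then show ?thesis
    using f k(2) by metis
qed

lemma tri_fill2:
  assumes "tri u v w" "tri u' v' w'"
    and "harr f (dm u) (dm u')" "harr h (cd v) (cd v')" "sus f \<odot> w = w' \<odot> h"
  shows "\<exists>g. harr g (cd u) (cd u') \<and> g \<odot> u = u' \<odot> f \<and> h \<odot> v = v' \<odot> g"
proof -
  note u = triD[OF assms(1)] triD[OF assms(2)]
  obtain g where g: "harr g (cd u) (cd u')" "v' \<odot> g = h \<odot> v"
    "sus g \<odot> \<ominus> (sus u) = \<ominus> (sus u') \<odot> sus f"
    using tri_fill1[OF tri_rotate[OF assms(1)] tri_rotate[OF assms(2)], of h "sus f"] assms(3-) u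
    by (auto simp: harr_def)
  have "sus (g \<odot> u) = sus (u' \<odot> f)"
    using g(1,3) assms(3) u
    by (simp add: harr_def ring_simps sus_simps)
  then have "g \<odot> u = u' \<odot> f"
    using g assms(3) u by - (rule sus_cancel, auto simp: harr_def)
  then show ?thesis
    using g by metis
qed

lemma biproduct_sus:
  assumes "biproduct X Y P i\<^sub>1 i\<^sub>2 p\<^sub>1 p\<^sub>2"
  shows "biproduct (\<Sigma>\<^sub>o X) (\<Sigma>\<^sub>o Y) (\<Sigma>\<^sub>o P) (sus i\<^sub>1) (sus i\<^sub>2) (sus p\<^sub>1) (sus p\<^sub>2)"
proof -
  note B = biproductD[OF assms]
  have "i\<^sub>1 \<odot> p\<^sub>1 \<oplus> i\<^sub>2 \<odot> p\<^sub>2 = iden P"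
    using assms by (simp add: biproduct_def)
  from arg_cong[OF this, of sus] B show ?thesis
    by (simp add: biproduct_def harr_def sus_simps flip: sus_comp)
qed

text \<open>The sum of the first maps is completed to some exact triangle. Injections and
  projections extend to comparison maps \<open>a\<close> and \<open>b\<close> between its third
  object and the sum of the third objects. They need not be inverse to each other, but they are up
  to square-zero errors, so \<open>b\<close> is invertible.\<close>

lemma tri_direct_sum:
  assumes "biproduct X\<^sub>1 X\<^sub>2 P i\<^sub>1 i\<^sub>2 p\<^sub>1 p\<^sub>2" "biproduct Y\<^sub>1 Y\<^sub>2 Q j\<^sub>1 j\<^sub>2 q\<^sub>1 q\<^sub>2"
    and "biproduct Z\<^sub>1 Z\<^sub>2 R k\<^sub>1 k\<^sub>2 r\<^sub>1 r\<^sub>2"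
    and "tri u\<^sub>1 v\<^sub>1 w\<^sub>1" "tri u\<^sub>2 v\<^sub>2 w\<^sub>2"
    and "dm u\<^sub>1 = X\<^sub>1" "cd u\<^sub>1 = Y\<^sub>1" "cd v\<^sub>1 = Z\<^sub>1" "dm u\<^sub>2 = X\<^sub>2" "cd u\<^sub>2 = Y\<^sub>2" "cd v\<^sub>2 = Z\<^sub>2"
  shows "tri (j\<^sub>1 \<odot> u\<^sub>1 \<odot> p\<^sub>1 \<oplus> j\<^sub>2 \<odot> u\<^sub>2 \<odot> p\<^sub>2) (k\<^sub>1 \<odot> v\<^sub>1 \<odot> q\<^sub>1 \<oplus> k\<^sub>2 \<odot> v\<^sub>2 \<odot> q\<^sub>2)
    (sus i\<^sub>1 \<odot> w\<^sub>1 \<odot> r\<^sub>1 \<oplus> sus i\<^sub>2 \<odot> w\<^sub>2 \<odot> r\<^sub>2)" (is "tri ?D ?E ?W")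
proof -
  note B1 = biproductD[OF assms(1)] biproduct_comp[OF assms(1)]
  note B2 = biproductD[OF assms(2)] biproduct_comp[OF assms(2)]
  note B3 = biproductD[OF assms(3)] biproduct_comp[OF assms(3)]
  note B4 = biproduct_comp[OF biproduct_sus[OF assms(1)]] biproductD(16-19)[OF biproduct_sus[OF assms(1)]]
  note [simp] = B1 B2 B3 B4 assms(6-) triD[OF assms(4)] triD[OF assms(5)]
  obtain v w where vw: "tri ?D v w"
    using ex_tri[of ?D] by auto
  note [simp] = triD(2-)[OF vw]
  obtain a\<^sub>1 where a1: "harr a\<^sub>1 Z\<^sub>1 (cd v)" "a\<^sub>1 \<odot> v\<^sub>1 = v \<odot> j\<^sub>1" "sus i\<^sub>1 \<odot> w\<^sub>1 = w \<odot> a\<^sub>1"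
    using tri_fill3[OF assms(4) vw, of i\<^sub>1 j\<^sub>1] by (auto simp: harr_def ring_simps)
  obtain a\<^sub>2 where a2: "harr a\<^sub>2 Z\<^sub>2 (cd v)" "a\<^sub>2 \<odot> v\<^sub>2 = v \<odot> j\<^sub>2" "sus i\<^sub>2 \<odot> w\<^sub>2 = w \<odot> a\<^sub>2"
    using tri_fill3[OF assms(5) vw, of i\<^sub>2 j\<^sub>2] by (auto simp: harr_def ring_simps)
  obtain b\<^sub>1 where b1: "harr b\<^sub>1 (cd v) Z\<^sub>1" "b\<^sub>1 \<odot> v = v\<^sub>1 \<odot> q\<^sub>1" "sus p\<^sub>1 \<odot> w = w\<^sub>1 \<odot> b\<^sub>1"
    using tri_fill3[OF vw assms(4), of p\<^sub>1 q\<^sub>1] by (auto simp: harr_def ring_simps)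
  obtain b\<^sub>2 where b2: "harr b\<^sub>2 (cd v) Z\<^sub>2" "b\<^sub>2 \<odot> v = v\<^sub>2 \<odot> q\<^sub>2" "sus p\<^sub>2 \<odot> w = w\<^sub>2 \<odot> b\<^sub>2"
    using tri_fill3[OF vw assms(5), of p\<^sub>2 q\<^sub>2] by (auto simp: harr_def ring_simps)
  note [simp] = harrD[OF a1(1)] harrD[OF a2(1)] harrD[OF b1(1)] harrD[OF b2(1)]
  define a b where "a = a\<^sub>1 \<odot> r\<^sub>1 \<oplus> a\<^sub>2 \<odot> r\<^sub>2" and "b = k\<^sub>1 \<odot> b\<^sub>1 \<oplus> k\<^sub>2 \<odot> b\<^sub>2"
  have [simp]: "ok a" "dm a = R" "cd a = cd v" "ok b" "dm b = cd v" "cd b = R"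
    by (simp_all add: a_def b_def)
  have a1v: "a\<^sub>1 \<odot> v\<^sub>1 \<odot> x = v \<odot> j\<^sub>1 \<odot> x" "a\<^sub>2 \<odot> v\<^sub>2 \<odot> x = v \<odot> j\<^sub>2 \<odot> x"
    "b\<^sub>1 \<odot> v \<odot> x = v\<^sub>1 \<odot> q\<^sub>1 \<odot> x" for x
    using a1(2) a2(2) b1(2) by (simp_all flip: comp_assoc)
  have aE: "a \<odot> ?E = v"
    using biproduct_sum(2)[OF assms(2), of v] by (simp add: a_def ring_simps a1v)
  have wa: "w \<odot> a = ?W"
    using a1(3) a2(3) by (simp add: a_def comp_plus flip: comp_assoc)
  have bv: "b \<odot> v = ?E"
    using b1(2) b2(2) by (simp add: b_def plus_comp comp_assoc)
  have "sus i\<^sub>1 \<odot> w\<^sub>1 \<odot> b\<^sub>1 \<oplus> sus i\<^sub>2 \<odot> w\<^sub>2 \<odot> b\<^sub>2 = w"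
    using biproduct_sum(1)[OF biproduct_sus[OF assms(1)], of w] b1(3) b2(3) by simp
  then have Wb: "?W \<odot> b = w"
    by (simp add: b_def ring_simps)
  \<comment> \<open>The errors of the two composites. \<open>n\<close> kills \<open>v\<close>, hence
    factors through \<open>w\<close>, and is itself killed by \<open>w\<close>; together these give
    \<open>n \<odot> n = 0\<close>.\<close>
  define n m where "n = a \<odot> b \<oplus> \<ominus> (iden (cd v))" and "m = b \<odot> a \<oplus> \<ominus> (iden R)"
  have nm [simp]: "ok n" "dm n = cd v" "cd n = cd v" "ok m" "dm m = R" "cd m = R"
    by (simp_all add: n_def m_def)
  have nv: "n \<odot> v = zero (cd ?D) (cd v)"
    by (simp add: n_def plus_comp comp_assoc neg_comp bv aE)
  have wn: "w \<odot> n = zero (cd v) (cd w)"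
  proof -
    have "w \<odot> a \<odot> b = w"
      using wa Wb by (simp flip: comp_assoc)
    then show ?thesis
      by (simp add: n_def comp_plus comp_neg)
  qed
  obtain e where "harr e (cd w) (cd v)" "n = e \<odot> w"
    using weakly_exactD(2)[OF tri_weakly_exact[OF vw], of n] nv by auto
  then have nn: "n \<odot> n = zero (cd v) (cd v)"
    using wn by (simp add: comp_assoc harr_def)
  have mE: "m \<odot> ?E = zero Q R"
    by (simp only: m_def plus_comp comp_assoc neg_comp aE bv) simp
  have Wm: "?W \<odot> m = zero R (cd ?W)"
  proof -
    have "?W \<odot> b \<odot> a = ?W"
      using wa Wb by (simp flip: comp_assoc)
    then show ?thesis
      unfolding m_def comp_plus[of ?W] comp_neg by simp
  qed
  \<comment> \<open>The sum triangle is not yet known to be exact, so \<open>m\<close> is factored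
    on each summand separately, using exactness of the two given triangles.\<close>
  have "m \<odot> k\<^sub>1 \<odot> v\<^sub>1 = (m \<odot> ?E) \<odot> j\<^sub>1"
    by (simp add: ring_simps)
  then have "\<exists>e. harr e (cd w\<^sub>1) R \<and> m \<odot> k\<^sub>1 = e \<odot> w\<^sub>1"
    using weakly_exactD(2)[OF tri_weakly_exact[OF assms(4)], of "m \<odot> k\<^sub>1"] mE
    by (simp add: comp_assoc)
  then obtain e\<^sub>1 where e1: "harr e\<^sub>1 (\<Sigma>\<^sub>o X\<^sub>1) R" "m \<odot> k\<^sub>1 = e\<^sub>1 \<odot> w\<^sub>1"
    by auto
  have "m \<odot> k\<^sub>2 \<odot> v\<^sub>2 = (m \<odot> ?E) \<odot> j\<^sub>2"
    by (simp add: ring_simps)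
  then have "\<exists>e. harr e (cd w\<^sub>2) R \<and> m \<odot> k\<^sub>2 = e \<odot> w\<^sub>2"
    using weakly_exactD(2)[OF tri_weakly_exact[OF assms(5)], of "m \<odot> k\<^sub>2"] mE
    by (simp add: comp_assoc)
  then obtain e\<^sub>2 where e2: "harr e\<^sub>2 (\<Sigma>\<^sub>o X\<^sub>2) R" "m \<odot> k\<^sub>2 = e\<^sub>2 \<odot> w\<^sub>2"
    by auto
  have [simp]: "ok e\<^sub>1" "dm e\<^sub>1 = \<Sigma>\<^sub>o X\<^sub>1" "cd e\<^sub>1 = R" "ok e\<^sub>2" "dm e\<^sub>2 = \<Sigma>\<^sub>o X\<^sub>2" "cd e\<^sub>2 = R"
    using e1(1) e2(1) by (simp_all add: harr_def)
  have "m = (m \<odot> k\<^sub>1) \<odot> r\<^sub>1 \<oplus> (m \<odot> k\<^sub>2) \<odot> r\<^sub>2"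
    using biproduct_sum(2)[OF assms(3), of m] by (simp add: comp_assoc)
  also have "\<dots> = (e\<^sub>1 \<odot> sus p\<^sub>1 \<oplus> e\<^sub>2 \<odot> sus p\<^sub>2) \<odot> ?W"
    unfolding e1(2) e2(2) by (simp add: ring_simps)
  finally have "m \<odot> m = (e\<^sub>1 \<odot> sus p\<^sub>1 \<oplus> e\<^sub>2 \<odot> sus p\<^sub>2) \<odot> (?W \<odot> m)"
    by (metis comp_assoc)
  then have mm: "m \<odot> m = zero R R"
    using Wm by simp
  have "a \<odot> b = iden (cd v) \<oplus> n" "b \<odot> a = iden R \<oplus> m"
    by (simp_all add: n_def m_def)
  then have "iso b"
    using nn mm by (intro iso_if_square_zero[of a R "cd v" b n m]) (simp_all add: harr_def)
  then show ?thesis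
    using bv Wb
    by (intro tri_iso[OF vw, of _ _ _ "iden P" "iden Q" b])
      (auto simp: candidate_def iso_iden sus_iden)
qed

end

section \<open>Mapping cones\<close>

context preadditive_category
begin

text \<open>The unitriangular matrix with corner \<open>\<ominus> F\<close>; changing the sign of
  the corner inverts it.\<close>

lemma biproduct_shear_iso:
  assumes "biproduct X Y P i\<^sub>1 i\<^sub>2 p\<^sub>1 p\<^sub>2" "harr F Y X"
  shows "iso (iden P \<oplus> \<ominus> (i\<^sub>1 \<odot> F \<odot> p\<^sub>2))"
proof -
  note [simp] = biproductD[OF assms(1)] biproduct_comp[OF assms(1)] harrD[OF assms(2)]
  let ?n = "i\<^sub>1 \<odot> F \<odot> p\<^sub>2"
  have "?n \<odot> ?n = zero P P"
    by (simp add: comp_assoc)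
  then show ?thesis
    by (intro isoI[of _ P P "iden P \<oplus> ?n" "iden P \<oplus> ?n"])
      (simp_all add: harr_def comp_plus plus_comp comp_neg neg_comp plus_assoc)
qed

text \<open>As matrices, both sides have diagonal \<open>a\<close>, \<open>d\<close> and corner
  \<open>\<ominus> (G \<odot> d)\<close>. The condition on \<open>b\<close> is precisely one of the
  three homotopy equations once \<open>d\<close> carries the sign it has in the mapping
  cone.\<close>

lemma biproduct_shear_comm:
  assumes "biproduct X Y P i\<^sub>1 i\<^sub>2 p\<^sub>1 p\<^sub>2" "biproduct X' Y' Q j\<^sub>1 j\<^sub>2 q\<^sub>1 q\<^sub>2"
    and "harr a X X'" "harr d Y Y'" "harr F Y X" "harr G Y' X'" "b = a \<odot> F \<oplus> \<ominus> (G \<odot> d)"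
  shows "(iden Q \<oplus> \<ominus> (j\<^sub>1 \<odot> G \<odot> q\<^sub>2)) \<odot> (j\<^sub>1 \<odot> a \<odot> p\<^sub>1 \<oplus> j\<^sub>2 \<odot> d \<odot> p\<^sub>2) =
    (j\<^sub>1 \<odot> a \<odot> p\<^sub>1 \<oplus> j\<^sub>2 \<odot> d \<odot> p\<^sub>2 \<oplus> j\<^sub>1 \<odot> b \<odot> p\<^sub>2) \<odot> (iden P \<oplus> \<ominus> (i\<^sub>1 \<odot> F \<odot> p\<^sub>2))"
proof -
  note [simp] = biproductD[OF assms(1)] biproduct_comp[OF assms(1)]
    biproductD[OF assms(2)] biproduct_comp[OF assms(2)]
    harrD[OF assms(3)] harrD[OF assms(4)] harrD[OF assms(5)] harrD[OF assms(6)]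
  let ?D = "j\<^sub>1 \<odot> a \<odot> p\<^sub>1 \<oplus> j\<^sub>2 \<odot> d \<odot> p\<^sub>2" and ?x = "j\<^sub>1 \<odot> a \<odot> F \<odot> p\<^sub>2"
  have "(iden Q \<oplus> \<ominus> (j\<^sub>1 \<odot> G \<odot> q\<^sub>2)) \<odot> ?D = ?D \<oplus> \<ominus> (j\<^sub>1 \<odot> G \<odot> d \<odot> p\<^sub>2)"
    by (simp add: plus_comp neg_comp comp_plus comp_assoc plus_assoc)
  also have "\<dots> = (?D \<oplus> ?x \<oplus> \<ominus> (j\<^sub>1 \<odot> G \<odot> d \<odot> p\<^sub>2)) \<oplus> \<ominus> ?x"
    by (simp add: plus_assoc)
  also have "\<dots> = (j\<^sub>1 \<odot> a \<odot> p\<^sub>1 \<oplus> j\<^sub>2 \<odot> d \<odot> p\<^sub>2 \<oplus> j\<^sub>1 \<odot> b \<odot> p\<^sub>2) \<odot> (iden P \<oplus> \<ominus> (i\<^sub>1 \<odot> F \<odot> p\<^sub>2))"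
    by (simp add: assms(7) comp_plus comp_neg plus_comp neg_comp comp_assoc plus_assoc)
  finally show ?thesis .
qed

end

context triangulated_category
begin

text \<open>The isomorphism is (1, -1, 1). Applied to the rotated first triangle it yields the signs
  that the mapping cone puts on all three of its maps.\<close>

lemma tri_neg:
  assumes "tri u v w" shows "tri (\<ominus> u) (\<ominus> v) w"
proof -
  note [simp] = triD[OF assms]
  have "iso (\<ominus> (iden (cd u)))"
    by (rule isoI[of _ "cd u" "cd u" "\<ominus> (iden (cd u))" "\<ominus> (iden (cd u))"])
      (simp_all add: harr_def comp_neg neg_comp)
  then show ?thesis
    by (intro tri_iso[OF assms, of _ _ _ "iden (dm u)" "\<ominus> (iden (cd u))" "iden (cd v)"])
      (simp_all add: candidate_def iso_iden sus_iden comp_neg neg_comp)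
qed

lemma tri_weakly_exact_sus:
  assumes "tri u v w"
  shows "weakly_exact w (sus u)" "weakly_exact (sus u) (sus v)"
proof -
  note rot = tri_rotate[OF assms]
  show "weakly_exact w (sus u)"
    using tri_weakly_exact[OF rot] by (rule weakly_exact_neg1)
  show "weakly_exact (sus u) (sus v)"
    using tri_weakly_exact[OF tri_rotate[OF rot]] by (blast intro: weakly_exact_neg1 weakly_exact_neg2)
qed

end

locale map_of_triangles = triangulated_category +
  fixes X Y Z X' Y' Z' u v w u' v' w' f g h
  assumes tris: "tri u v w" "tri u' v' w'"
    and arrows: "harr u X Y" "harr v Y Z" "harr u' X' Y'" "harr v' Y' Z'"
      "harr f X X'" "harr g Y Y'" "harr h Z Z'"
    and squares: "g \<odot> u = u' \<odot> f" "h \<odot> v = v' \<odot> g" "sus f \<odot> w = w' \<odot> h"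
begin

lemmas arrowsD = arrows[THEN harrD(1)] arrows[THEN harrD(2)] arrows[THEN harrD(3)]
  arrows[THEN harrD(4)] arrows[THEN harrD(5)]

lemma wD: "ok w" "dm w = Z" "cd w = \<Sigma>\<^sub>o X" "ok w'" "dm w' = Z'" "cd w' = \<Sigma>\<^sub>o X'"
  using triD[OF tris(1)] triD[OF tris(2)] arrowsD by simp_all

lemmas arrows_typing [simp] = arrowsD wD

end

text \<open>The three direct sums of the mapping cone are arbitrary here.\<close>

locale cone = map_of_triangles +
  fixes P Q R i\<^sub>1 i\<^sub>2 p\<^sub>1 p\<^sub>2 j\<^sub>1 j\<^sub>2 q\<^sub>1 q\<^sub>2 k\<^sub>1 k\<^sub>2 r\<^sub>1 r\<^sub>2
  assumes biproducts: "biproduct X' Y P i\<^sub>1 i\<^sub>2 p\<^sub>1 p\<^sub>2" "biproduct Y' Z Q j\<^sub>1 j\<^sub>2 q\<^sub>1 q\<^sub>2"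
      "biproduct Z' (\<Sigma>\<^sub>o X) R k\<^sub>1 k\<^sub>2 r\<^sub>1 r\<^sub>2"
begin

text \<open>\<open>D\<close>, \<open>E\<close> and \<open>W\<close> are the maps of the cone of the
  zero map. In \<open>cone_tri\<close> each of them is perturbed by one corner, involving
  \<open>g\<close>, \<open>h\<close> and \<open>f\<close> respectively.\<close>

abbreviation "D \<equiv> j\<^sub>1 \<odot> u' \<odot> p\<^sub>1 \<oplus> j\<^sub>2 \<odot> (\<ominus> v) \<odot> p\<^sub>2"
abbreviation "E \<equiv> k\<^sub>1 \<odot> v' \<odot> q\<^sub>1 \<oplus> k\<^sub>2 \<odot> (\<ominus> w) \<odot> q\<^sub>2"
abbreviation "W \<equiv> sus i\<^sub>1 \<odot> w' \<odot> r\<^sub>1 \<oplus> sus i\<^sub>2 \<odot> (\<ominus> (sus u)) \<odot> r\<^sub>2"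

abbreviation "cone_tri \<equiv> tri
  (j\<^sub>1 \<odot> u' \<odot> p\<^sub>1 \<oplus> j\<^sub>2 \<odot> (\<ominus> v) \<odot> p\<^sub>2 \<oplus> j\<^sub>1 \<odot> g \<odot> p\<^sub>2)
  (k\<^sub>1 \<odot> v' \<odot> q\<^sub>1 \<oplus> k\<^sub>2 \<odot> (\<ominus> w) \<odot> q\<^sub>2 \<oplus> k\<^sub>1 \<odot> h \<odot> q\<^sub>2)
  (sus i\<^sub>1 \<odot> w' \<odot> r\<^sub>1 \<oplus> sus i\<^sub>2 \<odot> (\<ominus> (sus u)) \<odot> r\<^sub>2 \<oplus> sus i\<^sub>1 \<odot> sus f \<odot> r\<^sub>2)"

lemmas B1 = biproductD[OF biproducts(1)] biproduct_comp[OF biproducts(1)]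
lemmas B2 = biproductD[OF biproducts(2)] biproduct_comp[OF biproducts(2)]
lemmas B3 = biproductD[OF biproducts(3)] biproduct_comp[OF biproducts(3)]
lemmas sus_biproducts = biproduct_sus[OF biproducts(1)] biproduct_sus[OF biproducts(2)]
lemmas B4 = biproductD(16-19)[OF sus_biproducts(1)] biproduct_comp[OF sus_biproducts(1)]
lemmas B5 = biproductD(16-19)[OF sus_biproducts(2)] biproduct_comp[OF sus_biproducts(2)]
lemmas typing [simp] = B1 B2 B3 B4 B5

lemma tri_zero_cone: "tri D E W"
  using tri_direct_sum[OF biproducts tris(2) tri_neg[OF tri_rotate[OF tris(1)]]] by simp

lemma cone_tri_if_nullhomotopic:
  assumes "harr F Y X'" "harr G Z Y'" "harr H (\<Sigma>\<^sub>o X) Z'"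
    and "sus f = sus (F \<odot> u) \<oplus> w' \<odot> H" "g = G \<odot> v \<oplus> u' \<odot> F" "h = H \<odot> w \<oplus> v' \<odot> G"
  shows "cone_tri"
proof -
  note [simp] = harrD[OF assms(1)] harrD[OF assms(2)] harrD[OF assms(3)]
  have W: "biproduct (\<Sigma>\<^sub>o X') (\<Sigma>\<^sub>o Y) (\<Sigma>\<^sub>o P) (sus i\<^sub>1) (sus i\<^sub>2) (sus p\<^sub>1) (sus p\<^sub>2)"
    by (rule sus_biproducts)
  \<comment> \<open>The third square of the isomorphism involves the suspension of the shear used on
    \<open>P\<close>; it is again a shear, with corner given by \<open>sus F\<close>.\<close>
  have s: "sus (iden P \<oplus> \<ominus> (i\<^sub>1 \<odot> F \<odot> p\<^sub>2)) =
      iden (\<Sigma>\<^sub>o P) \<oplus> \<ominus> (sus i\<^sub>1 \<odot> sus F \<odot> sus p\<^sub>2)"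
    by (simp add: sus_simps)
  have ar: "harr u' X' Y'" "harr (\<ominus> v) Y Z" "harr v' Y' Z'" "harr (\<ominus> w) Z (\<Sigma>\<^sub>o X)"
    "harr w' Z' (\<Sigma>\<^sub>o X')" "harr (\<ominus> (sus u)) (\<Sigma>\<^sub>o X) (\<Sigma>\<^sub>o Y)" "harr (sus F) (\<Sigma>\<^sub>o Y) (\<Sigma>\<^sub>o X')"
    by (simp_all add: harr_def)
  \<comment> \<open>The homotopy equations in the form required by
    \<open>biproduct_shear_comm\<close>, with shears given by \<open>F\<close>, \<open>G\<close>,
    \<open>H\<close> and finally \<open>sus F\<close>.\<close>
  have eqs: "g = u' \<odot> F \<oplus> \<ominus> (G \<odot> \<ominus> v)" "h = v' \<odot> G \<oplus> \<ominus> (H \<odot> \<ominus> w)"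
    "sus f = w' \<odot> H \<oplus> \<ominus> (sus F \<odot> \<ominus> (sus u))"
    using assms(4-6) by (simp_all add: comp_neg sus_comp plus_commute)
  note comm = biproduct_shear_comm[OF biproducts(1,2) ar(1,2) assms(1,2) eqs(1)]
    biproduct_shear_comm[OF biproducts(2,3) ar(3,4) assms(2,3) eqs(2)]
    biproduct_shear_comm[OF biproducts(3) W ar(5,6) assms(3) ar(7) eqs(3)]
  show ?thesis
    by (rule tri_iso[OF tri_zero_cone _ biproduct_shear_iso[OF biproducts(1) assms(1)]
          biproduct_shear_iso[OF biproducts(2) assms(2)] biproduct_shear_iso[OF biproducts(3) assms(3)]
          _ _ _ _ _ _ comm(1,2) comm(3)[folded s]])
      (simp_all add: candidate_def)
qed

lemma zero_cone_components:
  "D \<odot> i\<^sub>2 = \<ominus> (j\<^sub>2 \<odot> v)" "q\<^sub>1 \<odot> D = u' \<odot> p\<^sub>1" "q\<^sub>2 \<odot> D = \<ominus> (v \<odot> p\<^sub>2)"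
  "E \<odot> j\<^sub>2 = \<ominus> (k\<^sub>2 \<odot> w)" "r\<^sub>1 \<odot> E = v' \<odot> q\<^sub>1" "r\<^sub>2 \<odot> E = \<ominus> (w \<odot> q\<^sub>2)"
  "W \<odot> k\<^sub>2 = \<ominus> (sus i\<^sub>2 \<odot> sus u)" "sus p\<^sub>1 \<odot> W = w' \<odot> r\<^sub>1" "sus p\<^sub>2 \<odot> W = \<ominus> (sus u \<odot> r\<^sub>2)"
  by (simp_all add: comp_plus plus_comp comp_assoc comp_neg neg_comp)

lemma lift_if_cone_tri_1:
  assumes "f = zero X X'" "cone_tri"
  shows "\<exists>G. harr G Z Y' \<and> g = G \<odot> v \<and> h = v' \<odot> G"
proof -
  \<comment> \<open>With \<open>f\<close> zero the third maps of the two cones agree, so the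
    identities of \<open>P\<close> and \<open>R\<close> can be completed by a map in the
    middle.\<close>
  obtain \<phi> where \<phi>: "harr \<phi> Q Q" "\<phi> \<odot> D = D \<oplus> j\<^sub>1 \<odot> g \<odot> p\<^sub>2"
    "(E \<oplus> k\<^sub>1 \<odot> h \<odot> q\<^sub>2) \<odot> \<phi> = E"
    using tri_fill2[OF tri_zero_cone assms(2), of "iden P" "iden R"] assms(1)
    by (auto simp: harr_def sus_iden sus_zero plus_assoc)
  note [simp] = harrD[OF \<phi>(1)]
  have "w' \<odot> h = zero Z (\<Sigma>\<^sub>o X')"
    using squares(3) assms(1) by (simp add: sus_zero)
  then show ?thesis
    by (intro lift_of_comparison[OF biproducts, of v w v' w' "\<Sigma>\<^sub>o X'" g h D E \<phi>])
      (simp_all add: \<phi> tri_weakly_exact[OF tris(1)] tri_weakly_exact[OF tris(2)]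
        zero_cone_components harr_def)
qed

lemma lift_if_cone_tri_2:
  assumes "g = zero Y Y'" "cone_tri"
  shows "\<exists>H. harr H (\<Sigma>\<^sub>o X) Z' \<and> h = H \<odot> w \<and> sus f = w' \<odot> H"
proof -
  \<comment> \<open>Here the first maps agree and the fill-in sits on \<open>R\<close>. One rotation
    makes \<open>R\<close> the middle object, so \<open>E\<close> and \<open>W\<close> take the
    roles of \<open>D\<close> and \<open>E\<close> in the comparison.\<close>
  obtain \<phi> where \<phi>: "harr \<phi> R R" "\<phi> \<odot> E = E \<oplus> k\<^sub>1 \<odot> h \<odot> q\<^sub>2"
    "(W \<oplus> sus i\<^sub>1 \<odot> sus f \<odot> r\<^sub>2) \<odot> \<phi> = W"
    using tri_fill3[OF tri_zero_cone assms(2), of "iden P" "iden Q"] assms(1)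
    by (auto simp: harr_def sus_iden plus_assoc)
  note [simp] = harrD[OF \<phi>(1)]
  have "sus u' \<odot> sus f = zero (\<Sigma>\<^sub>o X) (\<Sigma>\<^sub>o Y')"
    using arg_cong[OF squares(1), of sus] assms(1) by (simp add: sus_zero sus_comp)
  then show ?thesis
    by (intro lift_of_comparison[OF biproducts(2,3) sus_biproducts(1),
          of w "sus u" w' "sus u'" "\<Sigma>\<^sub>o Y'" h "sus f" E W \<phi>])
      (simp_all add: \<phi> tri_weakly_exact_sus[OF tris(1)] tri_weakly_exact_sus[OF tris(2)]
        zero_cone_components harr_def)
qed

lemma lift_if_cone_tri_3:
  assumes "h = zero Z Z'" "cone_tri"
  shows "\<exists>F. harr F Y X' \<and> f = F \<odot> u \<and> g = u' \<odot> F"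
proof -
  obtain \<phi> where \<phi>: "harr \<phi> P P" "(D \<oplus> j\<^sub>1 \<odot> g \<odot> p\<^sub>2) \<odot> \<phi> = D"
    "sus \<phi> \<odot> W = W \<oplus> sus i\<^sub>1 \<odot> sus f \<odot> r\<^sub>2"
    using tri_fill1[OF tri_zero_cone assms(2), of "iden Q" "iden R"] assms(1)
    by (auto simp: harr_def plus_assoc)
  note [simp] = harrD[OF \<phi>(1)]
  \<comment> \<open>Now the second maps agree and the fill-in sits on \<open>P\<close>. Two
    rotations make the suspension of \<open>P\<close> the middle object between \<open>W\<close> and
    \<open>sus D\<close>; the resulting lift is a suspended one and is desuspended at the
    end.\<close>
  have \<phi>': "(sus D \<oplus> sus j\<^sub>1 \<odot> sus g \<odot> sus p\<^sub>2) \<odot> sus \<phi> = sus D"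
    using arg_cong[OF \<phi>(2), of sus] by (simp add: sus_comp sus_plus)
  have components: "sus q\<^sub>1 \<odot> sus D = sus u' \<odot> sus p\<^sub>1" "sus q\<^sub>2 \<odot> sus D = \<ominus> (sus v \<odot> sus p\<^sub>2)"
    using arg_cong[OF zero_cone_components(2), of sus] arg_cong[OF zero_cone_components(3), of sus]
    by (simp_all add: sus_comp sus_neg)
  have "sus v' \<odot> sus g = zero (\<Sigma>\<^sub>o Y) (\<Sigma>\<^sub>o Z')"
    using arg_cong[OF squares(2), of sus] assms(1) by (simp add: sus_zero sus_comp)
  then have "\<exists>G. harr G (\<Sigma>\<^sub>o Y) (\<Sigma>\<^sub>o X') \<and> sus f = G \<odot> sus u \<and> sus g = sus u' \<odot> G"
    by (intro lift_of_comparison[OF biproducts(3) sus_biproducts,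
          of "sus u" "sus v" "sus u'" "sus v'" "\<Sigma>\<^sub>o Z'" "sus f" "sus g" W "sus D" "sus \<phi>"])
      (simp_all only: \<phi> \<phi>' components tri_weakly_exact_sus[OF tris(1)] tri_weakly_exact_sus[OF tris(2)]
        zero_cone_components, simp_all add: harr_def)
  then obtain G where G: "harr G (\<Sigma>\<^sub>o Y) (\<Sigma>\<^sub>o X')" "sus f = G \<odot> sus u" "sus g = sus u' \<odot> G"
    by blast
  obtain F where F: "harr F Y X'" "sus F = G"
    using ex_desus[OF G(1)] by auto
  note [simp] = harrD[OF F(1)]
  have "f = F \<odot> u"
    by (rule sus_cancel) (simp_all add: sus_comp F(2) G(2))
  moreover have "g = u' \<odot> F"
    by (rule sus_cancel) (simp_all add: sus_comp F(2) G(3))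
  ultimately show ?thesis
    using F(1) by blast
qed

end

section \<open>Octahedra\<close>

context triangulated_category
begin

definition oct where
  "oct a a' a'' b b' b'' c' c'' \<alpha> \<beta> \<gamma> \<longleftrightarrow>
    tri a a' a'' \<and> tri b b' b'' \<and> tri (b \<odot> a) c' c'' \<and> tri \<alpha> \<beta> \<gamma> \<and>
    dm \<alpha> = cd a' \<and> cd \<alpha> = cd c' \<and> cd \<beta> = cd b' \<and>
    \<alpha> \<odot> a' = c' \<odot> b \<and> c'' \<odot> \<alpha> = a'' \<and> \<beta> \<odot> c' = b' \<and> \<gamma> = sus a' \<odot> b'' \<and>
    b'' \<odot> \<beta> = sus a \<odot> c''"

lemma octahedron_mor_iff:
  assumes "candidate a a' a''" "candidate b b' b''" "candidate (b \<odot> a) c' c''"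
    and "harr \<alpha> (cd a') (cd c')" "harr \<beta> (cd c') (cd b')" "harr \<gamma> (cd b') (\<Sigma>\<^sub>o (cd a'))"
  shows "octahedron T (Tri (dm a) (cd a) (cd a') (mor a) (mor a') (mor a''))
      (Tri (dm b) (cd b) (cd b') (mor b) (mor b') (mor b''))
      (Tri (dm a) (cd b) (cd c') (mor b \<cdot> mor a) (mor c') (mor c''))
      (mor \<alpha>) (mor \<beta>) (mor \<gamma>) \<longleftrightarrow> oct a a' a'' b b' b'' c' c'' \<alpha> \<beta> \<gamma>"
proof -
  have mem: "mor \<alpha> \<in> Hom T (cd a') (cd c')" "mor \<beta> \<in> Hom T (cd c') (cd b')"
    "mor \<gamma> \<in> Hom T (cd b') (\<Sigma>\<^sub>o (cd a'))"
    using assms(4-6) ok_mor by (metis harr_def)+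
  have ba: "cd a = dm b"
    using candidateD(1)[OF assms(3)] by simp
  note [simp] = candidateD[OF assms(1)] candidateD[OF assms(2)] harrD[OF assms(4)] harrD[OF assms(5)]
    harrD[OF assms(6)] ba
  note [simp] = candidateD(2-)[OF assms(3)]
  have can: "candidate \<alpha> \<beta> \<gamma>"
    by (simp add: candidate_def)
  show ?thesis
    using assms(1-3) can by (auto simp: oct_def tri_def mem arrow_eq_iff mor_simps)
qed

lemma ex_oct:
  assumes "tri a a' a''" "tri b b' b''" "tri (b \<odot> a) c' c''"
  shows "\<exists>\<alpha> \<beta> \<gamma>. oct a a' a'' b b' b'' c' c'' \<alpha> \<beta> \<gamma>"
proof -
  have can: "candidate a a' a''" "candidate b b' b''" "candidate (b \<odot> a) c' c''"
    using assms by (simp_all add: tri_def)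
  have ab: "ok a" "ok b" "cd a = dm b"
    using triD(1)[OF assms(3)] by simp_all
  obtain \<alpha> \<beta> \<gamma> where oct: "octahedron T (Tri (dm a) (cd a) (cd a') (mor a) (mor a') (mor a''))
      (Tri (dm b) (cd b) (cd b') (mor b) (mor b') (mor b''))
      (Tri (dm a) (cd b) (cd c') (mor b \<cdot> mor a) (mor c') (mor c'')) \<alpha> \<beta> \<gamma>"
    using TR4[of "dm a" "cd a" "cd a'" "mor a" "mor a'" "mor a''" "cd b" "cd b'" "mor b" "mor b'" "mor b''"
        "cd c'" "mor c'" "mor c''"] assms ab unfolding tri_def by (auto simp: mor_simps)
  let ?\<alpha> = "arr (cd a') (cd c') \<alpha>" and ?\<beta> = "arr (cd c') (cd b') \<beta>"
    and ?\<gamma> = "arr (cd b') (\<Sigma>\<^sub>o (cd a')) \<gamma>"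
  have m: "\<alpha> \<in> Hom T (cd a') (cd c')" "\<beta> \<in> Hom T (cd c') (cd b')"
    "\<gamma> \<in> Hom T (cd b') (\<Sigma>\<^sub>o (cd a'))"
    using oct unfolding octahedron.simps by blast+
  have "harr ?\<alpha> (cd a') (cd c')" "harr ?\<beta> (cd c') (cd b')" "harr ?\<gamma> (cd b') (\<Sigma>\<^sub>o (cd a'))"
    using m can by (simp_all add: harr_arr candidateD)
  then have "oct a a' a'' b b' b'' c' c'' ?\<alpha> ?\<beta> ?\<gamma>"
    using oct octahedron_mor_iff[OF can, of ?\<alpha> ?\<beta> ?\<gamma>]
    by (simp del: octahedron.simps)
  then show ?thesis by blast
qed

text \<open>The octahedron conditions tie \<alpha> and \<beta> to the triangle on
  \<open>b \<odot> a\<close> only through \<open>c'\<close> and \<open>c''\<close>. An automorphism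
  of the common object that fixes both therefore carries octahedra to octahedra, leaving \<gamma>
  alone.\<close>

lemma oct_change:
  assumes "oct a a' a'' b b' b'' c' c'' \<alpha> \<beta> \<gamma>" "harr \<psi> (cd c') (cd c')" "harr \<psi>' (cd c') (cd c')"
    and "\<psi>' \<odot> \<psi> = iden (cd c')" "\<psi> \<odot> \<psi>' = iden (cd c')" "\<psi> \<odot> c' = c'" "c'' \<odot> \<psi> = c''"
  shows "oct a a' a'' b b' b'' c' c'' (\<psi> \<odot> \<alpha>) (\<beta> \<odot> \<psi>') \<gamma>"
proof -
  have oct: "tri a a' a''" "tri b b' b''" "tri (b \<odot> a) c' c''" "tri \<alpha> \<beta> \<gamma>"
    "dm \<alpha> = cd a'" "cd \<alpha> = cd c'" "cd \<beta> = cd b'" "\<alpha> \<odot> a' = c' \<odot> b" "c'' \<odot> \<alpha> = a''"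
    "\<beta> \<odot> c' = b'" "\<gamma> = sus a' \<odot> b''" "b'' \<odot> \<beta> = sus a \<odot> c''"
    using assms(1) unfolding oct_def by blast+
  note [simp] = triD[OF oct(1)] triD[OF oct(2)] triD(2-)[OF oct(3)] triD[OF oct(4)] oct(5-7)
    harrD[OF assms(2)] harrD[OF assms(3)]
  have "\<psi>' \<odot> \<psi> \<odot> c' = c'"
    using assms(4) by (simp flip: comp_assoc)
  then have c': "\<psi>' \<odot> c' = c'"
    using assms(6) by simp
  have "c'' \<odot> \<psi> \<odot> \<psi>' = c''"
    using assms(5) by simp
  then have c'': "c'' \<odot> \<psi>' = c''"
    using assms(7) by (simp flip: comp_assoc)
  have \<psi>\<alpha>: "\<psi>' \<odot> \<psi> \<odot> \<alpha> = \<alpha>"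
    using assms(4) by (simp flip: comp_assoc)
  have "iso \<psi>"
    using assms(2-5) by (intro isoI)
  then have "tri (\<psi> \<odot> \<alpha>) (\<beta> \<odot> \<psi>') \<gamma>"
    by (intro tri_iso[OF oct(4), of _ _ _ "iden (cd a')" \<psi> "iden (cd b')"])
      (simp_all add: candidate_def iso_iden sus_iden comp_assoc assms(4))
  moreover have "(\<psi> \<odot> \<alpha>) \<odot> a' = c' \<odot> b"
    using assms(6) oct(8) by (metis comp_assoc)
  moreover have "c'' \<odot> \<psi> \<odot> \<alpha> = a''"
    using assms(7) oct(9) by (metis comp_assoc)
  moreover have "b'' \<odot> \<beta> \<odot> \<psi>' = sus a \<odot> c''"
    using c'' oct(12) by (metis comp_assoc)
  ultimately show ?thesis
    using oct by (simp add: oct_def comp_assoc c')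
qed

lemma split_triangle:
  assumes "tri (zero X Y) v w"
  obtains r s where "harr r (cd v) Y" "harr s (\<Sigma>\<^sub>o X) (cd v)"
    "r \<odot> v = iden Y" "w \<odot> s = iden (\<Sigma>\<^sub>o X)" "v \<odot> r \<oplus> s \<odot> w = iden (cd v)"
proof -
  have ob [simp]: "X \<in> Obj T" "Y \<in> Obj T"
    using triD(1)[OF assms] by simp_all
  note [simp] = triD(2-)[OF assms]
  \<comment> \<open>An arbitrary retraction of \<open>v\<close>, not necessarily complementary to
    the section \<open>s\<close>. It is used below to cancel \<open>v\<close> on the left.\<close>
  obtain r\<^sub>0 where r0: "harr r\<^sub>0 (cd v) Y" "r\<^sub>0 \<odot> v = iden Y"
    using tri_cokernel[OF assms, of "iden Y"] by auto
  have "weakly_exact w (zero (\<Sigma>\<^sub>o X) (\<Sigma>\<^sub>o Y))"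
    using tri_weakly_exact_sus(1)[OF assms] by (simp add: sus_zero)
  from weakly_exactD(3)[OF this, of "iden (\<Sigma>\<^sub>o X)"]
  obtain s where s: "harr s (\<Sigma>\<^sub>o X) (cd v)" "w \<odot> s = iden (\<Sigma>\<^sub>o X)"
    by auto
  note [simp] = harrD[OF r0(1)] harrD[OF s(1)]
  have wv: "w \<odot> v = zero Y (\<Sigma>\<^sub>o X)"
    using weakly_exactD(1)[OF tri_weakly_exact[OF assms]] by simp
  have wsw: "w \<odot> s \<odot> w = w"
    using s(2) by (simp flip: comp_assoc)
  have "w \<odot> (iden (cd v) \<oplus> \<ominus> (s \<odot> w)) = zero (cd v) (cd w)"
    by (simp add: comp_plus comp_neg wsw)
  \<comment> \<open>The complementary retraction: \<open>w\<close> kills \<open>1 - s w\<close>, so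
    this idempotent factors as \<open>v \<odot> r\<close>.\<close>
  then obtain r where r: "harr r (cd v) Y" "iden (cd v) \<oplus> \<ominus> (s \<odot> w) = v \<odot> r"
    using weakly_exactD(3)[OF tri_weakly_exact[OF assms], of "iden (cd v) \<oplus> \<ominus> (s \<odot> w)"] by auto
  note [simp] = harrD[OF r(1)]
  have "v \<odot> r \<odot> v = (iden (cd v) \<oplus> \<ominus> (s \<odot> w)) \<odot> v"
    by (simp only: r(2) comp_assoc)
  then have "r\<^sub>0 \<odot> v \<odot> r \<odot> v = r\<^sub>0 \<odot> v"
    by (simp add: plus_comp neg_comp comp_assoc wv)
  then have "r \<odot> v = iden Y"
    using r0(2) by (simp flip: comp_assoc)
  moreover have "v \<odot> r \<oplus> s \<odot> w = iden (cd v)"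
    by (simp add: r(2)[symmetric] plus_assoc)
  ultimately show thesis
    using that r(1) s by blast
qed

text \<open>The automorphism is \<open>1 + c' k c''\<close>. Because \<open>c'' \<odot> c'\<close>
  is zero, the correction squares to zero and both \<open>c'\<close> and \<open>c''\<close> are
  fixed.\<close>

lemma oct_shear:
  assumes "oct a a' a'' b b' b'' c' c'' \<alpha> \<beta> \<gamma>" "harr k (cd c'') (dm c')"
  shows "oct a a' a'' b b' b'' c' c'' (\<alpha> \<oplus> c' \<odot> k \<odot> a'') (\<beta> \<oplus> \<ominus> (b' \<odot> k \<odot> c'')) \<gamma>"
proof -
  have oct: "tri a a' a''" "tri (b \<odot> a) c' c''" "tri \<alpha> \<beta> \<gamma>"
    "dm \<alpha> = cd a'" "cd \<alpha> = cd c'" "c'' \<odot> \<alpha> = a''" "\<beta> \<odot> c' = b'"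
    using assms(1) unfolding oct_def by blast+
  note [simp] = triD[OF oct(1)] triD(2-)[OF oct(2)] triD[OF oct(3)] oct(4,5) harrD[OF assms(2)]
  have ba [simp]: "ok b" "dm b = cd a" "cd c'' = \<Sigma>\<^sub>o (dm a)" "dm c' = cd b"
    using triD[OF oct(2)] by auto
  have cc: "c'' \<odot> c' = zero (cd b) (\<Sigma>\<^sub>o (dm a))"
    using weakly_exactD(1)[OF tri_weakly_exact[OF oct(2)]] by simp
  have cc': "c'' \<odot> c' \<odot> x = zero (dm x) (\<Sigma>\<^sub>o (dm a))" if "ok x" "cd x = cd b" for x
    using cc that by (simp flip: comp_assoc)
  let ?n = "c' \<odot> k \<odot> c''"
  have "oct a a' a'' b b' b'' c' c'' ((iden (cd c') \<oplus> ?n) \<odot> \<alpha>) (\<beta> \<odot> (iden (cd c') \<oplus> \<ominus> ?n)) \<gamma>"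
    by (rule oct_change[OF assms(1)])
      (simp_all add: harr_def comp_plus plus_comp comp_neg neg_comp comp_assoc cc cc' plus_assoc)
  moreover have "(iden (cd c') \<oplus> ?n) \<odot> \<alpha> = \<alpha> \<oplus> c' \<odot> k \<odot> a''"
    by (simp add: plus_comp comp_assoc oct(6))
  moreover have "\<beta> \<odot> (iden (cd c') \<oplus> \<ominus> ?n) = \<beta> \<oplus> \<ominus> (b' \<odot> k \<odot> c'')"
    using oct(7) by (simp add: comp_plus comp_neg flip: comp_assoc)
  ultimately show ?thesis by simp
qed

lemma octD:
  assumes "oct a a' a'' b b' b'' c' c'' \<alpha> \<beta> \<gamma>"
  shows "harr \<alpha> (cd a') (cd c')" "harr \<beta> (cd c') (cd b')"
    "\<alpha> \<odot> a' = c' \<odot> b" "c'' \<odot> \<alpha> = a''" "\<beta> \<odot> c' = b'" "b'' \<odot> \<beta> = sus a \<odot> c''"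
    "harr \<gamma> (cd b') (\<Sigma>\<^sub>o (cd a'))"
  using assms triD[of \<alpha> \<beta> \<gamma>] by (auto simp: oct_def harr_def)

end

section \<open>Verdier good maps when gu = 0\<close>

locale verdier_data = map_of_triangles +
  fixes f' f'' g' g'' c d
  assumes choice: "tri f f' f''" "tri g g' g''" "tri (g \<odot> u) c d"
begin

abbreviation "oct\<^sub>1 \<equiv> oct u v w g g' g'' c d"
abbreviation "oct\<^sub>2 \<equiv> oct f f' f'' u' v' w' c d"

abbreviation "verdier_octahedra \<equiv>
  \<exists>\<alpha>\<^sub>1 \<beta>\<^sub>1 \<gamma>\<^sub>1 \<alpha>\<^sub>2 \<beta>\<^sub>2 \<gamma>\<^sub>2. oct\<^sub>1 \<alpha>\<^sub>1 \<beta>\<^sub>1 \<gamma>\<^sub>1 \<and> oct\<^sub>2 \<alpha>\<^sub>2 \<beta>\<^sub>2 \<gamma>\<^sub>2 \<and> h = \<beta>\<^sub>2 \<odot> \<alpha>\<^sub>1"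

lemma ex_octs:
  obtains \<alpha>\<^sub>1 \<beta>\<^sub>1 \<gamma>\<^sub>1 \<alpha>\<^sub>2 \<beta>\<^sub>2 \<gamma>\<^sub>2 where "oct\<^sub>1 \<alpha>\<^sub>1 \<beta>\<^sub>1 \<gamma>\<^sub>1" "oct\<^sub>2 \<alpha>\<^sub>2 \<beta>\<^sub>2 \<gamma>\<^sub>2"
  using ex_oct[OF tris(1) choice(2,3)] ex_oct[OF choice(1) tris(2) choice(3)[unfolded squares(1)]]
  by blast

lemma choice_typing [simp]: "ok c" "dm c = Y'" "ok d" "dm d = cd c" "cd d = \<Sigma>\<^sub>o X"
  using triD(2-)[OF choice(3)] by simp_all

lemma exact_zero: "v' \<odot> u' = zero X' Z'" "w \<odot> v = zero Y (\<Sigma>\<^sub>o X)" "w' \<odot> v' = zero Y' (\<Sigma>\<^sub>o X')"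
  using tri_comp_zero[OF tris(2)] weakly_exactD(1)[OF tri_weakly_exact[OF tris(1)]]
    weakly_exactD(1)[OF tri_weakly_exact[OF tris(2)]] by simp_all

text \<open>When \<open>gu = 0\<close>, the triangle on \<open>gu\<close> splits. Any two candidates for \<open>\<alpha>\<^sub>1\<close> then differ by a
  composite through \<open>c\<close> and \<open>w\<close>, and any two candidates for \<open>\<beta>\<^sub>2\<close> by one through \<open>d\<close> and \<open>v'\<close>,
  so that \<open>oct_shear\<close> moves a given octahedron to any candidate.\<close>

lemma verdier_iff_lift_1:
  assumes "f = zero X X'"
  shows "verdier_octahedra \<longleftrightarrow> (\<exists>G. harr G Z Y' \<and> g = G \<odot> v \<and> h = v' \<odot> G)"
proof -
  have "g \<odot> u = zero X Y'"
    using assms squares(1) by simp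
  then obtain r s where rs: "harr r (cd c) Y'" "harr s (\<Sigma>\<^sub>o X) (cd c)"
    "r \<odot> c = iden Y'" "d \<odot> s = iden (\<Sigma>\<^sub>o X)" "c \<odot> r \<oplus> s \<odot> d = iden (cd c)"
    using choice(3) split_triangle by metis
  note [simp] = harrD[OF rs(1)] harrD[OF rs(2)]
  \<comment> \<open>Here \<open>f\<close> zero is used a second time:
    \<open>w' \<odot> \<beta> = sus f \<odot> d\<close> vanishes, so the part of \<beta> on the
    summand \<open>\<Sigma>\<^sub>o X\<close> lifts through \<open>v'\<close>.\<close>
  have K: "\<exists>K. harr K (\<Sigma>\<^sub>o X) Y' \<and> \<beta> \<odot> s = v' \<odot> K" if "oct\<^sub>2 \<alpha> \<beta> \<gamma>" for \<alpha> \<beta> \<gamma>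
  proof -
    note o2 = octD[OF that]
    note [simp] = harrD[OF o2(2)]
    have "w' \<odot> \<beta> \<odot> s = (w' \<odot> \<beta>) \<odot> s"
      by (simp only: comp_assoc)
    also have "\<dots> = zero (\<Sigma>\<^sub>o X) (\<Sigma>\<^sub>o X')"
      unfolding o2(6) assms by (simp add: sus_zero)
    finally show ?thesis
      using weakly_exactD(3)[OF tri_weakly_exact[OF tris(2)], of "\<beta> \<odot> s"] by simp
  qed
  \<comment> \<open>Decomposition of \<alpha> along the splitting. Its component in
    \<open>\<Sigma>\<^sub>o X\<close> is \<open>d \<odot> \<alpha> = w\<close> for every octahedron,
    so only \<open>r \<odot> \<alpha>\<close> is free.\<close>
  have \<alpha>_eq: "\<alpha> = c \<odot> r \<odot> \<alpha> \<oplus> s \<odot> w" if "oct\<^sub>1 \<alpha> \<beta> \<gamma>" for \<alpha> \<beta> \<gamma>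
    using arg_cong[OF rs(5), of "\<lambda>x. x \<odot> \<alpha>"] octD[OF that] by (simp add: plus_comp comp_assoc harr_def)
  have r\<alpha>v: "r \<odot> \<alpha> \<odot> v = g" if "oct\<^sub>1 \<alpha> \<beta> \<gamma>" for \<alpha> \<beta> \<gamma>
    using octD(3)[OF that] rs(3) by (simp flip: comp_assoc)
  show ?thesis
  proof
    assume verdier_octahedra
    then obtain \<alpha>\<^sub>1 \<beta>\<^sub>1 \<gamma>\<^sub>1 \<alpha>\<^sub>2 \<beta>\<^sub>2 \<gamma>\<^sub>2 where o1: "oct\<^sub>1 \<alpha>\<^sub>1 \<beta>\<^sub>1 \<gamma>\<^sub>1" and o2: "oct\<^sub>2 \<alpha>\<^sub>2 \<beta>\<^sub>2 \<gamma>\<^sub>2"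
      and h: "h = \<beta>\<^sub>2 \<odot> \<alpha>\<^sub>1"
      by blast
    note [simp] = harrD[OF octD(1)[OF o1]] harrD[OF octD(2)[OF o2]]
    obtain K where K: "harr K (\<Sigma>\<^sub>o X) Y'" "\<beta>\<^sub>2 \<odot> s = v' \<odot> K"
      using K[OF o2] by blast
    note [simp] = harrD[OF K(1)]
    have "h = \<beta>\<^sub>2 \<odot> (c \<odot> r \<odot> \<alpha>\<^sub>1 \<oplus> s \<odot> w)"
      using h \<alpha>_eq[OF o1] by simp
    also have "\<dots> = (\<beta>\<^sub>2 \<odot> c) \<odot> r \<odot> \<alpha>\<^sub>1 \<oplus> (\<beta>\<^sub>2 \<odot> s) \<odot> w"
      by (simp only: comp_plus comp_assoc)
    also have "\<dots> = v' \<odot> (r \<odot> \<alpha>\<^sub>1 \<oplus> K \<odot> w)"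
      unfolding K(2) octD(5)[OF o2] by (simp add: comp_plus comp_assoc)
    finally have "h = v' \<odot> (r \<odot> \<alpha>\<^sub>1 \<oplus> K \<odot> w)" .
    moreover have "g = (r \<odot> \<alpha>\<^sub>1 \<oplus> K \<odot> w) \<odot> v"
      using r\<alpha>v[OF o1] by (simp add: plus_comp comp_assoc exact_zero)
    moreover have "harr (r \<odot> \<alpha>\<^sub>1 \<oplus> K \<odot> w) Z Y'"
      by (simp add: harr_def)
    ultimately show "\<exists>G. harr G Z Y' \<and> g = G \<odot> v \<and> h = v' \<odot> G"
      by (intro exI[of _ "r \<odot> \<alpha>\<^sub>1 \<oplus> K \<odot> w"] conjI)
  next
    assume "\<exists>G. harr G Z Y' \<and> g = G \<odot> v \<and> h = v' \<odot> G"
    then obtain G where G: "harr G Z Y'" "g = G \<odot> v" "h = v' \<odot> G"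
      by blast
    obtain \<alpha>\<^sub>1 \<beta>\<^sub>1 \<gamma>\<^sub>1 \<alpha>\<^sub>2 \<beta>\<^sub>2 \<gamma>\<^sub>2 where o1: "oct\<^sub>1 \<alpha>\<^sub>1 \<beta>\<^sub>1 \<gamma>\<^sub>1" and o2: "oct\<^sub>2 \<alpha>\<^sub>2 \<beta>\<^sub>2 \<gamma>\<^sub>2"
      by (rule ex_octs)
    note [simp] = harrD[OF G(1)] harrD[OF octD(1)[OF o1]] harrD[OF octD(2)[OF o2]]
    obtain K where K: "harr K (\<Sigma>\<^sub>o X) Y'" "\<beta>\<^sub>2 \<odot> s = v' \<odot> K"
      using K[OF o2] by blast
    note [simp] = harrD[OF K(1)]
    \<comment> \<open>The existing octahedra yield the lift \<open>r \<alpha> + K w\<close>. This is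
      how far it is from the prescribed \<open>G\<close>; both restrict to \<open>g\<close> along
      \<open>v\<close>, so the difference factors through \<open>w\<close> and can be fed to
      \<open>oct_shear\<close>.\<close>
    let ?\<delta> = "G \<oplus> \<ominus> (K \<odot> w) \<oplus> \<ominus> (r \<odot> \<alpha>\<^sub>1)"
    have "?\<delta> \<odot> v = zero Y Y'"
      using G(2)[symmetric] r\<alpha>v[OF o1] by (simp add: plus_comp neg_comp comp_assoc exact_zero)
    then obtain k where k: "harr k (\<Sigma>\<^sub>o X) Y'" "?\<delta> = k \<odot> w"
      using weakly_exactD(2)[OF tri_weakly_exact[OF tris(1)], of ?\<delta>] by auto
    have "\<alpha>\<^sub>1 \<oplus> c \<odot> k \<odot> w = (c \<odot> r \<odot> \<alpha>\<^sub>1 \<oplus> s \<odot> w) \<oplus> c \<odot> ?\<delta>"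
      using \<alpha>_eq[OF o1] k(2) by simp
    also have "\<dots> = s \<odot> w \<oplus> c \<odot> G \<oplus> \<ominus> (c \<odot> K \<odot> w)"
      by (simp add: comp_plus comp_neg plus_ac)
    finally have "\<beta>\<^sub>2 \<odot> (\<alpha>\<^sub>1 \<oplus> c \<odot> k \<odot> w) =
        (\<beta>\<^sub>2 \<odot> s) \<odot> w \<oplus> (\<beta>\<^sub>2 \<odot> c) \<odot> G \<oplus> \<ominus> ((\<beta>\<^sub>2 \<odot> c) \<odot> K \<odot> w)"
      by (simp add: comp_plus comp_neg comp_assoc)
    also have "\<dots> = h"
      unfolding K(2) octD(5)[OF o2] by (simp add: G(3) comp_assoc)
    finally have "h = \<beta>\<^sub>2 \<odot> (\<alpha>\<^sub>1 \<oplus> c \<odot> k \<odot> w)" by simp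
    moreover have "oct\<^sub>1 (\<alpha>\<^sub>1 \<oplus> c \<odot> k \<odot> w) (\<beta>\<^sub>1 \<oplus> \<ominus> (g' \<odot> k \<odot> d)) \<gamma>\<^sub>1"
      using oct_shear[OF o1, of k] k(1) by simp
    ultimately show verdier_octahedra
      using o2 by blast
  qed
qed

text \<open>Dual to the case of zero \<open>f\<close>: now \<open>r \<odot> \<alpha>\<close> is
  constrained to factor through \<open>w\<close>, while the freedom lies in
  \<open>\<beta> \<odot> s\<close>. Accordingly it is the second octahedron that is moved.\<close>

lemma verdier_iff_lift_2:
  assumes "g = zero Y Y'"
  shows "verdier_octahedra \<longleftrightarrow> (\<exists>H. harr H (\<Sigma>\<^sub>o X) Z' \<and> h = H \<odot> w \<and> sus f = w' \<odot> H)"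
proof -
  have "g \<odot> u = zero X Y'"
    using assms by simp
  then obtain r s where rs: "harr r (cd c) Y'" "harr s (\<Sigma>\<^sub>o X) (cd c)"
    "r \<odot> c = iden Y'" "d \<odot> s = iden (\<Sigma>\<^sub>o X)" "c \<odot> r \<oplus> s \<odot> d = iden (cd c)"
    using choice(3) split_triangle by metis
  note [simp] = harrD[OF rs(1)] harrD[OF rs(2)]
  have k: "\<exists>k. harr k (\<Sigma>\<^sub>o X) Y' \<and> r \<odot> \<alpha> = k \<odot> w" if "oct\<^sub>1 \<alpha> \<beta> \<gamma>" for \<alpha> \<beta> \<gamma>
  proof -
    note o1 = octD[OF that]
    note [simp] = harrD[OF o1(1)]
    have "(r \<odot> \<alpha>) \<odot> v = zero Y Y'"
      using o1(3) assms by (simp add: comp_assoc)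
    then show ?thesis
      using weakly_exactD(2)[OF tri_weakly_exact[OF tris(1)], of "r \<odot> \<alpha>"] by simp
  qed
  have \<beta>_eq: "\<beta> = v' \<odot> r \<oplus> \<beta> \<odot> s \<odot> d" if "oct\<^sub>2 \<alpha> \<beta> \<gamma>" for \<alpha> \<beta> \<gamma>
    using octD(1,2,5)[OF that] arg_cong[OF rs(5), of "\<lambda>x. \<beta> \<odot> x"]
    by (simp add: comp_plus harr_def flip: comp_assoc)
  have w\<beta>s: "w' \<odot> \<beta> \<odot> s = sus f" if "oct\<^sub>2 \<alpha> \<beta> \<gamma>" for \<alpha> \<beta> \<gamma>
    using arg_cong[OF octD(6)[OF that], of "\<lambda>x. x \<odot> s"] rs(4) by (simp add: comp_assoc)
  show ?thesis
  proof
    assume verdier_octahedra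
    then obtain \<alpha>\<^sub>1 \<beta>\<^sub>1 \<gamma>\<^sub>1 \<alpha>\<^sub>2 \<beta>\<^sub>2 \<gamma>\<^sub>2 where o1: "oct\<^sub>1 \<alpha>\<^sub>1 \<beta>\<^sub>1 \<gamma>\<^sub>1" and o2: "oct\<^sub>2 \<alpha>\<^sub>2 \<beta>\<^sub>2 \<gamma>\<^sub>2"
      and h: "h = \<beta>\<^sub>2 \<odot> \<alpha>\<^sub>1"
      by blast
    note [simp] = harrD[OF octD(1)[OF o1]] harrD[OF octD(2)[OF o2]]
    obtain k where k: "harr k (\<Sigma>\<^sub>o X) Y'" "r \<odot> \<alpha>\<^sub>1 = k \<odot> w"
      using k[OF o1] by blast
    note [simp] = harrD[OF k(1)]
    have "h = (v' \<odot> r \<oplus> \<beta>\<^sub>2 \<odot> s \<odot> d) \<odot> \<alpha>\<^sub>1"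
      using h \<beta>_eq[OF o2] by simp
    also have "\<dots> = (v' \<odot> k \<oplus> \<beta>\<^sub>2 \<odot> s) \<odot> w"
      using k(2) octD(4)[OF o1] by (simp add: plus_comp comp_assoc)
    finally have "h = (v' \<odot> k \<oplus> \<beta>\<^sub>2 \<odot> s) \<odot> w" .
    moreover have "w' \<odot> v' \<odot> k = zero (\<Sigma>\<^sub>o X) (\<Sigma>\<^sub>o X')"
      using exact_zero(3) by (simp flip: comp_assoc)
    then have "sus f = w' \<odot> (v' \<odot> k \<oplus> \<beta>\<^sub>2 \<odot> s)"
      using w\<beta>s[OF o2] by (simp add: comp_plus)
    moreover have "harr (v' \<odot> k \<oplus> \<beta>\<^sub>2 \<odot> s) (\<Sigma>\<^sub>o X) Z'"
      by (simp add: harr_def)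
    ultimately show "\<exists>H. harr H (\<Sigma>\<^sub>o X) Z' \<and> h = H \<odot> w \<and> sus f = w' \<odot> H"
      by (intro exI[of _ "v' \<odot> k \<oplus> \<beta>\<^sub>2 \<odot> s"] conjI)
  next
    assume "\<exists>H. harr H (\<Sigma>\<^sub>o X) Z' \<and> h = H \<odot> w \<and> sus f = w' \<odot> H"
    then obtain H where H: "harr H (\<Sigma>\<^sub>o X) Z'" "h = H \<odot> w" "sus f = w' \<odot> H"
      by blast
    obtain \<alpha>\<^sub>1 \<beta>\<^sub>1 \<gamma>\<^sub>1 \<alpha>\<^sub>2 \<beta>\<^sub>2 \<gamma>\<^sub>2 where o1: "oct\<^sub>1 \<alpha>\<^sub>1 \<beta>\<^sub>1 \<gamma>\<^sub>1" and o2: "oct\<^sub>2 \<alpha>\<^sub>2 \<beta>\<^sub>2 \<gamma>\<^sub>2"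
      by (rule ex_octs)
    note [simp] = harrD[OF H(1)] harrD[OF octD(1)[OF o1]] harrD[OF octD(2)[OF o2]]
    obtain k where k: "harr k (\<Sigma>\<^sub>o X) Y'" "r \<odot> \<alpha>\<^sub>1 = k \<odot> w"
      using k[OF o1] by blast
    note [simp] = harrD[OF k(1)]
    \<comment> \<open>The difference between the prescribed \<open>H\<close> and the lift
      \<open>v' k + \<beta> s\<close> of the existing octahedra. Both become \<open>sus f\<close>
      after \<open>w'\<close>, so it lifts through \<open>v'\<close>.\<close>
    let ?\<delta> = "H \<oplus> \<ominus> (v' \<odot> k) \<oplus> \<ominus> (\<beta>\<^sub>2 \<odot> s)"
    have "w' \<odot> v' \<odot> k = zero (\<Sigma>\<^sub>o X) (\<Sigma>\<^sub>o X')"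
      using exact_zero(3) by (simp flip: comp_assoc)
    then have "w' \<odot> ?\<delta> = zero (\<Sigma>\<^sub>o X) (\<Sigma>\<^sub>o X')"
      using H(3)[symmetric] w\<beta>s[OF o2] by (simp add: comp_plus comp_neg)
    then obtain l where l: "harr l (\<Sigma>\<^sub>o X) Y'" "?\<delta> = v' \<odot> l"
      using weakly_exactD(3)[OF tri_weakly_exact[OF tris(2)], of ?\<delta>] by auto
    note [simp] = harrD[OF l(1)]
    have "\<beta>\<^sub>2 \<oplus> v' \<odot> l \<odot> d = (v' \<odot> r \<oplus> \<beta>\<^sub>2 \<odot> s \<odot> d) \<oplus> ?\<delta> \<odot> d"
      using \<beta>_eq[OF o2] l(2) by (simp add: comp_assoc)
    also have "\<dots> = v' \<odot> r \<oplus> H \<odot> d \<oplus> \<ominus> (v' \<odot> k \<odot> d)"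
      by (simp add: plus_comp neg_comp comp_assoc plus_ac)
    finally have "(\<beta>\<^sub>2 \<oplus> v' \<odot> l \<odot> d) \<odot> \<alpha>\<^sub>1 =
        v' \<odot> r \<odot> \<alpha>\<^sub>1 \<oplus> H \<odot> d \<odot> \<alpha>\<^sub>1 \<oplus> \<ominus> (v' \<odot> k \<odot> d \<odot> \<alpha>\<^sub>1)"
      by (simp add: plus_comp neg_comp comp_assoc)
    also have "\<dots> = h"
      unfolding k(2) octD(4)[OF o1] by (simp add: H(2))
    finally have "h = (\<beta>\<^sub>2 \<oplus> v' \<odot> l \<odot> d) \<odot> \<alpha>\<^sub>1" by simp
    \<comment> \<open>The shear is taken along \<open>\<ominus> l\<close>, because
      \<open>oct_shear\<close> changes \<beta> with the opposite sign.\<close>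
    moreover have "oct\<^sub>2 (\<alpha>\<^sub>2 \<oplus> c \<odot> \<ominus> l \<odot> f'') (\<beta>\<^sub>2 \<oplus> v' \<odot> l \<odot> d) \<gamma>\<^sub>2"
      using oct_shear[OF o2, of "\<ominus> l"] by (simp add: harr_def comp_neg neg_comp)
    ultimately show verdier_octahedra
      using o1 by blast
  qed
qed

end

section \<open>Goodness in terms of arrows\<close>

context triangulated_category
begin

lemma is_biproduct_dsum:
  "X \<in> Obj T \<Longrightarrow> Y \<in> Obj T \<Longrightarrow> is_biproduct T X Y (dsum T X Y)"
  unfolding dsum_def using ex_biproduct by (rule someI_ex)

text \<open>The last map of the mapping cone is a matrix into a suspended direct sum; this allows
  \<open>arr_mat2\<close> to be applied to it.\<close>

lemma is_biproduct_susp: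
  assumes "is_biproduct T X Y B" "X \<in> Obj T" "Y \<in> Obj T"
  shows "is_biproduct T (\<Sigma>\<^sub>o X) (\<Sigma>\<^sub>o Y) (susp_biprod T B)"
proof -
  have z: "\<Sigma>\<^sub>m (zerom T V W) = zerom T (\<Sigma>\<^sub>o V) (\<Sigma>\<^sub>o W)" if "V \<in> Obj T" "W \<in> Obj T" for V W
    using sus_zero[OF that] that by (simp add: zero_def sus_arr hom_closed)
  note S = endofunctorD[OF susp_functor]
  have B: "apex B \<in> Obj T" "inj1 B \<in> Hom T X (apex B)" "inj2 B \<in> Hom T Y (apex B)"
    "prj1 B \<in> Hom T (apex B) X" "prj2 B \<in> Hom T (apex B) Y"
    "prj1 B \<cdot> inj1 B = Ident T X" "prj2 B \<cdot> inj2 B = Ident T Y"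
    "prj1 B \<cdot> inj2 B = zerom T Y X" "prj2 B \<cdot> inj1 B = zerom T X Y"
    "inj1 B \<cdot> prj1 B \<^bold>+ inj2 B \<cdot> prj2 B = Ident T (apex B)"
    using assms(1) by (simp_all add: is_biproduct_def)
  have "\<Sigma>\<^sub>m (inj1 B \<cdot> prj1 B) \<^bold>+ \<Sigma>\<^sub>m (inj2 B \<cdot> prj2 B) = Ident T (\<Sigma>\<^sub>o (apex B))"
    using arg_cong[OF B(10), of \<Sigma>\<^sub>m] B(1-5) assms(2,3)
    by (simp add: susp_add cmp_in[of _ X] cmp_in[of _ Y] S(2))
  moreover have "\<Sigma>\<^sub>m (prj1 B) \<cdot> \<Sigma>\<^sub>m (inj1 B) = \<Sigma>\<^sub>m (prj1 B \<cdot> inj1 B)"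
    "\<Sigma>\<^sub>m (prj2 B) \<cdot> \<Sigma>\<^sub>m (inj2 B) = \<Sigma>\<^sub>m (prj2 B \<cdot> inj2 B)"
    "\<Sigma>\<^sub>m (prj1 B) \<cdot> \<Sigma>\<^sub>m (inj2 B) = \<Sigma>\<^sub>m (prj1 B \<cdot> inj2 B)"
    "\<Sigma>\<^sub>m (prj2 B) \<cdot> \<Sigma>\<^sub>m (inj1 B) = \<Sigma>\<^sub>m (prj2 B \<cdot> inj1 B)"
    "\<Sigma>\<^sub>m (inj1 B \<cdot> prj1 B) = \<Sigma>\<^sub>m (inj1 B) \<cdot> \<Sigma>\<^sub>m (prj1 B)"
    "\<Sigma>\<^sub>m (inj2 B \<cdot> prj2 B) = \<Sigma>\<^sub>m (inj2 B) \<cdot> \<Sigma>\<^sub>m (prj2 B)"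
    using B(1-5) assms(2,3) by (metis S(4))+
  ultimately show ?thesis
    using B assms(2,3) by (simp add: is_biproduct_def susp_biprod_def S z)
qed

lemma map_of_triangles_arr:
  assumes "Tri X Y Z u v w \<in> exact_triangles T" "Tri X' Y' Z' u' v' w' \<in> exact_triangles T"
    and "triangle_map T (Tri X Y Z u v w) (Tri X' Y' Z' u' v' w') f g h"
  shows "map_of_triangles T X Y Z X' Y' Z' (arr X Y u) (arr Y Z v) (arr Z (\<Sigma>\<^sub>o X) w)
    (arr X' Y' u') (arr Y' Z' v') (arr Z' (\<Sigma>\<^sub>o X') w') (arr X X' f) (arr Y Y' g) (arr Z Z' h)"
proof unfold_locales
  note c = exact_candidate[OF assms(1)] exact_candidate[OF assms(2)]
  show "tri (arr X Y u) (arr Y Z v) (arr Z (\<Sigma>\<^sub>o X) w)" "tri (arr X' Y' u') (arr Y' Z' v') (arr Z' (\<Sigma>\<^sub>o X') w')"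
    using assms(1,2) by (simp_all add: tri_arr)
  show "harr (arr X Y u) X Y" "harr (arr Y Z v) Y Z" "harr (arr X' Y' u') X' Y'"
    "harr (arr Y' Z' v') Y' Z'" "harr (arr X X' f) X X'" "harr (arr Y Y' g) Y Y'" "harr (arr Z Z' h) Z Z'"
    using c assms(3) by (simp_all add: harr_arr)
  show "arr Y Y' g \<odot> arr X Y u = arr X' Y' u' \<odot> arr X X' f"
    "arr Z Z' h \<odot> arr Y Z v = arr Y' Z' v' \<odot> arr Y Y' g"
    "sus (arr X X' f) \<odot> arr Z (\<Sigma>\<^sub>o X) w = arr Z' (\<Sigma>\<^sub>o X') w' \<odot> arr Z Z' h"
    using c assms(3) endofunctorD(3)[OF susp_functor] by (simp_all add: sus_arr arr_ops)
qed

end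

context map_of_triangles
begin

text \<open>The first equation is stated after suspension, which removes \<open>desusp\<close>; no
  information is lost, as \<Sigma> is faithful.\<close>

abbreviation "null_homotopy F G H \<equiv>
  harr F Y X' \<and> harr G Z Y' \<and> harr H (\<Sigma>\<^sub>o X) Z' \<and>
  sus f = sus (F \<odot> u) \<oplus> w' \<odot> H \<and> g = G \<odot> v \<oplus> u' \<odot> F \<and> h = H \<odot> w \<oplus> v' \<odot> G"

lemma null_homotopy_mor_iff:
  assumes "harr F Y X'" "harr G Z Y'" "harr H (\<Sigma>\<^sub>o X) Z'"
  shows "mor f = mor F \<cdot> mor u \<^bold>+ desusp T X X' (mor w' \<cdot> mor H) \<and>
      mor g = mor G \<cdot> mor v \<^bold>+ mor u' \<cdot> mor F \<and> mor h = mor H \<cdot> mor w \<^bold>+ mor v' \<cdot> mor G \<longleftrightarrow>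
    null_homotopy F G H"
proof -
  note [simp] = harrD[OF assms(1)] harrD[OF assms(2)] harrD[OF assms(3)]
  let ?l = "arr X X' (desusp T X X' (mor w' \<cdot> mor H))"
  have w'H: "mor w' \<cdot> mor H \<in> Hom T (\<Sigma>\<^sub>o X) (\<Sigma>\<^sub>o X')"
    using ok_mor[of "w' \<odot> H"] by (simp add: mor_simps)
  note l = desusp_arr[OF arrowsD(22,24) w'H]
  have [simp]: "ok ?l" "dm ?l = X" "cd ?l = X'"
    using l(1) by (simp_all add: ok_arr)
  have "sus ?l = w' \<odot> H"
    unfolding l(2) by (simp add: arrow_eq_iff mor_simps ok_arr w'H)
  then have "sus f = sus (F \<odot> u) \<oplus> w' \<odot> H \<longleftrightarrow> sus f = sus (F \<odot> u \<oplus> ?l)"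
    by (simp add: sus_plus)
  also have "\<dots> \<longleftrightarrow> f = F \<odot> u \<oplus> ?l"
    using sus_cancel[of f "F \<odot> u \<oplus> ?l"] by auto
  finally have *: "sus f = sus (F \<odot> u) \<oplus> w' \<odot> H \<longleftrightarrow> f = F \<odot> u \<oplus> ?l" .
  show ?thesis
    unfolding * by (simp add: assms arrow_eq_iff mor_simps)
qed

lemma nullhomotopic_iff:
  "nullhomotopic T (Tri X Y Z (mor u) (mor v) (mor w)) (Tri X' Y' Z' (mor u') (mor v') (mor w'))
    (mor f) (mor g) (mor h) \<longleftrightarrow> (\<exists>F G H. null_homotopy F G H)"
    (is "?N \<longleftrightarrow> ?A")
proof
  assume ?N
  then obtain F G H where FGH: "F \<in> Hom T Y X'" "G \<in> Hom T Z Y'" "H \<in> Hom T (\<Sigma>\<^sub>o X) Z'"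
    "mor f = F \<cdot> mor u \<^bold>+ desusp T X X' (mor w' \<cdot> H) \<and>
      mor g = G \<cdot> mor v \<^bold>+ mor u' \<cdot> F \<and> mor h = H \<cdot> mor w \<^bold>+ mor v' \<cdot> G"
    by auto
  then have "harr (arr Y X' F) Y X'" "harr (arr Z Y' G) Z Y'" "harr (arr (\<Sigma>\<^sub>o X) Z' H) (\<Sigma>\<^sub>o X) Z'"
    by (simp_all add: harr_arr)
  from null_homotopy_mor_iff[OF this] FGH(4) show ?A
    unfolding arr_sel by blast
next
  assume ?A
  then obtain F G H where FGH: "null_homotopy F G H"
    by blast
  then have "mor F \<in> Hom T Y X'" "mor G \<in> Hom T Z Y'" "mor H \<in> Hom T (\<Sigma>\<^sub>o X) Z'"
    using ok_mor by (metis harr_def)+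
  then show ?N
    using null_homotopy_mor_iff[of F G H] FGH unfolding nullhomotopic.simps by blast
qed

lemma null_homotopy_lifts:
  "f = zero X X' \<Longrightarrow> harr G Z Y' \<Longrightarrow> g = G \<odot> v \<Longrightarrow> h = v' \<odot> G \<Longrightarrow>
    null_homotopy (zero Y X') G (zero (\<Sigma>\<^sub>o X) Z')"
  "g = zero Y Y' \<Longrightarrow> harr H (\<Sigma>\<^sub>o X) Z' \<Longrightarrow> h = H \<odot> w \<Longrightarrow> sus f = w' \<odot> H \<Longrightarrow>
    null_homotopy (zero Y X') (zero Z Y') H"
  "h = zero Z Z' \<Longrightarrow> harr F Y X' \<Longrightarrow> f = F \<odot> u \<Longrightarrow> g = u' \<odot> F \<Longrightarrow>
    null_homotopy F (zero Z Y') (zero (\<Sigma>\<^sub>o X) Z')"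
  by (auto simp: harr_def sus_zero)

end

context cone
begin

lemma null_homotopy_iff_cone_tri:
  assumes "f = zero X X' \<or> g = zero Y Y' \<or> h = zero Z Z'"
  shows "(\<exists>F G H. null_homotopy F G H) \<longleftrightarrow> cone_tri"
proof
  show "cone_tri" if "\<exists>F G H. null_homotopy F G H"
    using that cone_tri_if_nullhomotopic by blast
next
  assume cone: "cone_tri"
  consider "f = zero X X'" | "g = zero Y Y'" | "h = zero Z Z'"
    using assms by blast
  then show "\<exists>F G H. null_homotopy F G H"
  proof cases
    case 1
    with lift_if_cone_tri_1[OF 1 cone] null_homotopy_lifts(1) show ?thesis by metis
  next
    case 2
    with lift_if_cone_tri_2[OF 2 cone] null_homotopy_lifts(2) show ?thesis by metis
  next
    case 3
    with lift_if_cone_tri_3[OF 3 cone] null_homotopy_lifts(3) show ?thesis by metis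
  qed
qed

text \<open>A null homotopy may have three nonzero components. The passage to a lift goes through
  the cone: the homotopy makes it exact, and exactness returns a homotopy with a single
  component.\<close>

lemma lift_iff_null_homotopy:
  "f = zero X X' \<Longrightarrow> (\<exists>G. harr G Z Y' \<and> g = G \<odot> v \<and> h = v' \<odot> G) \<longleftrightarrow>
    (\<exists>F G H. null_homotopy F G H)"
  "g = zero Y Y' \<Longrightarrow> (\<exists>H. harr H (\<Sigma>\<^sub>o X) Z' \<and> h = H \<odot> w \<and> sus f = w' \<odot> H) \<longleftrightarrow>
    (\<exists>F G H. null_homotopy F G H)"
  using null_homotopy_lifts(1,2) null_homotopy_iff_cone_tri lift_if_cone_tri_1 lift_if_cone_tri_2
  by metis+

end

context verdier_data
begin

lemma verdier_good_iff:
  "verdier_good T (Tri X Y Z (mor u) (mor v) (mor w)) (Tri X' Y' Z' (mor u') (mor v') (mor w'))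
    (Tri X X' (cd f') (mor f) (mor f') (mor f'')) (Tri Y Y' (cd g') (mor g) (mor g') (mor g''))
    (Tri X Y' (cd c) (mor g \<cdot> mor u) (mor c) (mor d)) (mor h) \<longleftrightarrow> verdier_octahedra"
    (is "verdier_good T ?t ?t' ?t\<^sub>f ?t\<^sub>g ?t\<^sub>A _ \<longleftrightarrow> _")
proof -
  \<comment> \<open>The shared triangle is recorded on gu, whereas the second octahedron asks for it
    on u'f.\<close>
  have gu: "mor g \<cdot> mor u = mor u' \<cdot> mor f"
    using arg_cong[OF squares(1), of mor] by (simp add: mor_simps)
  have can: "candidate u v w" "candidate u' v' w'" "candidate f f' f''" "candidate g g' g''"
    "candidate (g \<odot> u) c d" "candidate (u' \<odot> f) c d"
    using tris choice squares(1) by (simp_all add: tri_def)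
  have iff1: "octahedron T ?t ?t\<^sub>g ?t\<^sub>A (mor \<alpha>) (mor \<beta>) (mor \<gamma>) \<longleftrightarrow> oct\<^sub>1 \<alpha> \<beta> \<gamma>"
    if "harr \<alpha> Z (cd c)" "harr \<beta> (cd c) (cd g')" "harr \<gamma> (cd g') (\<Sigma>\<^sub>o Z)" for \<alpha> \<beta> \<gamma>
    using octahedron_mor_iff[OF can(1,4,5), of \<alpha> \<beta> \<gamma>] that by (simp del: octahedron.simps)
  have iff2: "octahedron T ?t\<^sub>f ?t' ?t\<^sub>A (mor \<alpha>) (mor \<beta>) (mor \<gamma>) \<longleftrightarrow> oct\<^sub>2 \<alpha> \<beta> \<gamma>"
    if "harr \<alpha> (cd f') (cd c)" "harr \<beta> (cd c) Z'" "harr \<gamma> Z' (\<Sigma>\<^sub>o (cd f'))" for \<alpha> \<beta> \<gamma>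
    using octahedron_mor_iff[OF can(3,2,6), of \<alpha> \<beta> \<gamma>] that gu by (simp del: octahedron.simps)
  have ob: "cd f' \<in> Obj T" "cd g' \<in> Obj T"
    using candidateD[OF can(3)] candidateD[OF can(4)] by simp_all
  show ?thesis
  proof
    assume "verdier_good T ?t ?t' ?t\<^sub>f ?t\<^sub>g ?t\<^sub>A (mor h)"
    then obtain \<alpha>\<^sub>1 \<beta>\<^sub>1 \<gamma>\<^sub>1 \<alpha>\<^sub>2 \<beta>\<^sub>2 \<gamma>\<^sub>2 where oct: "octahedron T ?t ?t\<^sub>g ?t\<^sub>A \<alpha>\<^sub>1 \<beta>\<^sub>1 \<gamma>\<^sub>1"
      "octahedron T ?t\<^sub>f ?t' ?t\<^sub>A \<alpha>\<^sub>2 \<beta>\<^sub>2 \<gamma>\<^sub>2" and h: "mor h = \<beta>\<^sub>2 \<cdot> \<alpha>\<^sub>1"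
      unfolding verdier_good_def by blast
    have m: "\<alpha>\<^sub>1 \<in> Hom T Z (cd c)" "\<beta>\<^sub>1 \<in> Hom T (cd c) (cd g')" "\<gamma>\<^sub>1 \<in> Hom T (cd g') (\<Sigma>\<^sub>o Z)"
      "\<alpha>\<^sub>2 \<in> Hom T (cd f') (cd c)" "\<beta>\<^sub>2 \<in> Hom T (cd c) Z'" "\<gamma>\<^sub>2 \<in> Hom T Z' (\<Sigma>\<^sub>o (cd f'))"
      using oct unfolding octahedron.simps by blast+
    let ?\<alpha>\<^sub>1 = "arr Z (cd c) \<alpha>\<^sub>1" and ?\<beta>\<^sub>1 = "arr (cd c) (cd g') \<beta>\<^sub>1" and ?\<gamma>\<^sub>1 = "arr (cd g') (\<Sigma>\<^sub>o Z) \<gamma>\<^sub>1"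
    let ?\<alpha>\<^sub>2 = "arr (cd f') (cd c) \<alpha>\<^sub>2" and ?\<beta>\<^sub>2 = "arr (cd c) Z' \<beta>\<^sub>2" and ?\<gamma>\<^sub>2 = "arr Z' (\<Sigma>\<^sub>o (cd f')) \<gamma>\<^sub>2"
    have "oct\<^sub>1 ?\<alpha>\<^sub>1 ?\<beta>\<^sub>1 ?\<gamma>\<^sub>1"
      using iff1[of ?\<alpha>\<^sub>1 ?\<beta>\<^sub>1 ?\<gamma>\<^sub>1] oct(1) m ob by (simp del: octahedron.simps add: harr_arr)
    moreover have "oct\<^sub>2 ?\<alpha>\<^sub>2 ?\<beta>\<^sub>2 ?\<gamma>\<^sub>2"
      using iff2[of ?\<alpha>\<^sub>2 ?\<beta>\<^sub>2 ?\<gamma>\<^sub>2] oct(2) m ob by (simp del: octahedron.simps add: harr_arr)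
    moreover have "h = ?\<beta>\<^sub>2 \<odot> ?\<alpha>\<^sub>1"
      using h m by (simp add: arrow_eq_iff ok_arr mor_simps)
    ultimately show verdier_octahedra by blast
  next
    assume verdier_octahedra
    then obtain \<alpha>\<^sub>1 \<beta>\<^sub>1 \<gamma>\<^sub>1 \<alpha>\<^sub>2 \<beta>\<^sub>2 \<gamma>\<^sub>2 where oct: "oct\<^sub>1 \<alpha>\<^sub>1 \<beta>\<^sub>1 \<gamma>\<^sub>1" "oct\<^sub>2 \<alpha>\<^sub>2 \<beta>\<^sub>2 \<gamma>\<^sub>2"
      and h: "h = \<beta>\<^sub>2 \<odot> \<alpha>\<^sub>1"
      by blast
    have "octahedron T ?t ?t\<^sub>g ?t\<^sub>A (mor \<alpha>\<^sub>1) (mor \<beta>\<^sub>1) (mor \<gamma>\<^sub>1)"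
      using iff1 octD(1,2,7)[OF oct(1)] oct(1) by (simp del: octahedron.simps)
    moreover have "octahedron T ?t\<^sub>f ?t' ?t\<^sub>A (mor \<alpha>\<^sub>2) (mor \<beta>\<^sub>2) (mor \<gamma>\<^sub>2)"
      using iff2 octD(1,2,7)[OF oct(2)] oct(2) by (simp del: octahedron.simps)
    moreover have "mor h = mor \<beta>\<^sub>2 \<cdot> mor \<alpha>\<^sub>1"
      unfolding h using octD(1)[OF oct(1)] octD(2)[OF oct(2)] by (simp add: harr_def mor_simps)
    ultimately show "verdier_good T ?t ?t' ?t\<^sub>f ?t\<^sub>g ?t\<^sub>A (mor h)"
      unfolding verdier_good_def by blast
  qed
qed

end

theorem proposition7p4:
  fixes T :: "('o, 'm, 'e) triangulated_scheme"
    and X Y Z X' Y' Z' :: 'o and u v w u' v' w' f g h :: 'm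
    and t t' :: "('o, 'm) triangle"
  assumes "triangulated_category T"
    and "t = Tri X Y Z u v w" and "t' = Tri X' Y' Z' u' v' w'"
    and "t \<in> exact_triangles T" and "t' \<in> exact_triangles T"
    and "triangle_map T t t' f g h"
    and "f = zerom T X X' \<or> g = zerom T Y Y' \<or> h = zerom T Z Z'"
  shows "(nullhomotopic T t t' f g h \<longleftrightarrow> good T t t' f g h) \<and>
    (f = zerom T X X' \<or> g = zerom T Y Y' \<longrightarrow>
      (\<forall>t\<^sub>f t\<^sub>g t\<^sub>A. verdier_choice T t t' f g t\<^sub>f t\<^sub>g t\<^sub>A \<longrightarrow>
        (nullhomotopic T t t' f g h \<longleftrightarrow> verdier_good T t t' t\<^sub>f t\<^sub>g t\<^sub>A h)))"
proof -
  interpret triangulated_category T by fact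
  let ?u = "arr X Y u" and ?v = "arr Y Z v" and ?w = "arr Z (\<Sigma>\<^sub>o\<^bsub>T\<^esub> X) w"
  let ?u' = "arr X' Y' u'" and ?v' = "arr Y' Z' v'" and ?w' = "arr Z' (\<Sigma>\<^sub>o\<^bsub>T\<^esub> X') w'"
  let ?f = "arr X X' f" and ?g = "arr Y Y' g" and ?h = "arr Z Z' h"
  let ?BP = "dsum T X' Y" and ?BQ = "dsum T Y' Z" and ?BR = "dsum T Z' (\<Sigma>\<^sub>o\<^bsub>T\<^esub> X)"
  have mem: "X \<in> Obj T" "Y \<in> Obj T" "Z \<in> Obj T" "X' \<in> Obj T" "Y' \<in> Obj T" "Z' \<in> Obj T"
    "u \<in> Hom T X Y" "v \<in> Hom T Y Z" "w \<in> Hom T Z (\<Sigma>\<^sub>o\<^bsub>T\<^esub> X)"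
    "u' \<in> Hom T X' Y'" "v' \<in> Hom T Y' Z'" "w' \<in> Hom T Z' (\<Sigma>\<^sub>o\<^bsub>T\<^esub> X')"
    "f \<in> Hom T X X'" "g \<in> Hom T Y Y'" "h \<in> Hom T Z Z'"
    using exact_candidate[OF assms(4)] exact_candidate[OF assms(5)] assms(2,3,6) by simp_all
  note S = endofunctorD(3)[OF susp_functor]
  have B: "is_biproduct T X' Y ?BP" "is_biproduct T Y' Z ?BQ" "is_biproduct T Z' (\<Sigma>\<^sub>o\<^bsub>T\<^esub> X) ?BR"
    using is_biproduct_dsum mem by simp_all
  interpret map_of_triangles T X Y Z X' Y' Z' ?u ?v ?w ?u' ?v' ?w' ?f ?g ?h
    using map_of_triangles_arr assms by blast
  interpret cone T X Y Z X' Y' Z' ?u ?v ?w ?u' ?v' ?w' ?f ?g ?h "apex ?BP" "apex ?BQ" "apex ?BR"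
    "arr X' (apex ?BP) (inj1 ?BP)" "arr Y (apex ?BP) (inj2 ?BP)"
    "arr (apex ?BP) X' (prj1 ?BP)" "arr (apex ?BP) Y (prj2 ?BP)"
    "arr Y' (apex ?BQ) (inj1 ?BQ)" "arr Z (apex ?BQ) (inj2 ?BQ)"
    "arr (apex ?BQ) Y' (prj1 ?BQ)" "arr (apex ?BQ) Z (prj2 ?BQ)"
    "arr Z' (apex ?BR) (inj1 ?BR)" "arr (\<Sigma>\<^sub>o\<^bsub>T\<^esub> X) (apex ?BR) (inj2 ?BR)"
    "arr (apex ?BR) Z' (prj1 ?BR)" "arr (apex ?BR) (\<Sigma>\<^sub>o\<^bsub>T\<^esub> X) (prj2 ?BR)"
    using biproduct_arr B mem by unfold_locales simp_all
  have zero_iff: "?f = zero X X' \<longleftrightarrow> f = zerom T X X'" "?g = zero Y Y' \<longleftrightarrow> g = zerom T Y Y'"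
    "?h = zero Z Z' \<longleftrightarrow> h = zerom T Z Z'"
    by (simp_all add: zero_def)
  have null_iff: "nullhomotopic T t t' f g h \<longleftrightarrow> (\<exists>F G H. null_homotopy F G H)"
    using nullhomotopic_iff unfolding assms(2,3) arr_sel .
  have neg_mem: "negm T Y Z v \<in> Hom T Y Z" "negm T Z (\<Sigma>\<^sub>o\<^bsub>T\<^esub> X) w \<in> Hom T Z (\<Sigma>\<^sub>o\<^bsub>T\<^esub> X)"
    "negm T (\<Sigma>\<^sub>o\<^bsub>T\<^esub> X) (\<Sigma>\<^sub>o\<^bsub>T\<^esub> Y) (\<Sigma>\<^sub>m\<^bsub>T\<^esub> u) \<in> Hom T (\<Sigma>\<^sub>o\<^bsub>T\<^esub> X) (\<Sigma>\<^sub>o\<^bsub>T\<^esub> Y)"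
    using mem S by (simp_all add: hom_closed)
  have "good T t t' f g h \<longleftrightarrow> cone_tri"
  proof -
    note SB = is_biproduct_susp[OF B(1) mem(4,2)]
    note m1 = arr_mat2[OF B(1,2) mem(4,2,5,3,10,14) neg_mem(1)]
    note m2 = arr_mat2[OF B(2,3) mem(5,3,6) susp_obj_in[OF mem(1)] mem(11,15) neg_mem(2)]
    note m3 = arr_mat2[OF B(3) SB mem(6) susp_obj_in[OF mem(1)] susp_obj_in[OF mem(4)]
        susp_obj_in[OF mem(2)] mem(12) S[OF mem(1,4,13)] neg_mem(3)]
    have negs: "neg ?v = arr Y Z (negm T Y Z v)" "neg ?w = arr Z (\<Sigma>\<^sub>o\<^bsub>T\<^esub> X) (negm T Z (\<Sigma>\<^sub>o\<^bsub>T\<^esub> X) w)"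
      "neg (sus ?u) = arr (\<Sigma>\<^sub>o\<^bsub>T\<^esub> X) (\<Sigma>\<^sub>o\<^bsub>T\<^esub> Y) (negm T (\<Sigma>\<^sub>o\<^bsub>T\<^esub> X) (\<Sigma>\<^sub>o\<^bsub>T\<^esub> Y) (\<Sigma>\<^sub>m\<^bsub>T\<^esub> u))"
      using mem S by (simp_all add: arr_ops sus_arr)
    have BP: "inj1 ?BP \<in> Hom T X' (apex ?BP)" "inj2 ?BP \<in> Hom T Y (apex ?BP)" "apex ?BP \<in> Obj T"
      using B(1) by (simp_all add: is_biproduct_def)
    \<comment> \<open>The target of the third matrix is \<open>susp_biprod\<close>, whose structure
      maps are the suspended ones; with this all three matrices match the arrows of
      \<open>cone_tri\<close>.\<close>
    have sus: "sus ?f = arr (\<Sigma>\<^sub>o\<^bsub>T\<^esub> X) (\<Sigma>\<^sub>o\<^bsub>T\<^esub> X') (\<Sigma>\<^sub>m\<^bsub>T\<^esub> f)"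
      "sus (arr X' (apex ?BP) (inj1 ?BP)) =
        arr (\<Sigma>\<^sub>o\<^bsub>T\<^esub> X') (apex (susp_biprod T ?BP)) (inj1 (susp_biprod T ?BP))"
      "sus (arr Y (apex ?BP) (inj2 ?BP)) =
        arr (\<Sigma>\<^sub>o\<^bsub>T\<^esub> Y) (apex (susp_biprod T ?BP)) (inj2 (susp_biprod T ?BP))"
      using mem BP by (simp_all add: sus_arr susp_biprod_def)
    show ?thesis
      unfolding good_def assms(2,3) mapping_cone.simps negs sus m1(1)[symmetric] m2(1)[symmetric]
        m3(1)[symmetric] tri_arr[symmetric] by (simp add: susp_biprod_def)
  qed
  with null_iff null_homotopy_iff_cone_tri assms(7)
  have "nullhomotopic T t t' f g h \<longleftrightarrow> good T t t' f g h"
    unfolding zero_iff by simp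
  moreover have "nullhomotopic T t t' f g h \<longleftrightarrow> verdier_good T t t' t\<^sub>f t\<^sub>g t\<^sub>A h"
    if zero: "f = zerom T X X' \<or> g = zerom T Y Y'" and choice: "verdier_choice T t t' f g t\<^sub>f t\<^sub>g t\<^sub>A"
    for t\<^sub>f t\<^sub>g t\<^sub>A
  proof -
    obtain X'' f' f'' Y'' g' g'' A c d where ch: "t\<^sub>f = Tri X X' X'' f f' f''"
      "t\<^sub>g = Tri Y Y' Y'' g g' g''" "t\<^sub>A = Tri X Y' A (g \<cdot>\<^bsub>T\<^esub> u) c d"
      and ex: "t\<^sub>f \<in> exact_triangles T" "t\<^sub>g \<in> exact_triangles T" "t\<^sub>A \<in> exact_triangles T"
      using choice unfolding assms(2,3) by auto
    have "arr X Y' (g \<cdot>\<^bsub>T\<^esub> u) = comp ?g ?u"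
      using mem by (simp add: arr_ops)
    then interpret verdier_data T X Y Z X' Y' Z' ?u ?v ?w ?u' ?v' ?w' ?f ?g ?h
      "arr X' X'' f'" "arr X'' (\<Sigma>\<^sub>o\<^bsub>T\<^esub> X) f''" "arr Y' Y'' g'" "arr Y'' (\<Sigma>\<^sub>o\<^bsub>T\<^esub> Y) g''"
      "arr Y' A c" "arr A (\<Sigma>\<^sub>o\<^bsub>T\<^esub> X) d"
      using ex unfolding ch tri_arr[symmetric] by unfold_locales simp_all
    have "verdier_good T t t' t\<^sub>f t\<^sub>g t\<^sub>A h \<longleftrightarrow> verdier_octahedra"
      using verdier_good_iff unfolding assms(2,3) ch arr_sel .
    also have "\<dots> \<longleftrightarrow> (\<exists>F G H. null_homotopy F G H)"
      using zero unfolding zero_iff[symmetric]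
    proof
      assume z: "?f = zero X X'"
      show ?thesis
        by (rule trans[OF verdier_iff_lift_1[OF z] lift_iff_null_homotopy(1)[OF z]])
    next
      assume z: "?g = zero Y Y'"
      show ?thesis
        by (rule trans[OF verdier_iff_lift_2[OF z] lift_iff_null_homotopy(2)[OF z]])
    qed
    finally show ?thesis
      using null_iff by simp
  qed
  ultimately show ?thesis by blast
qed

end
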